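(* Let $n\ge 1$ be an integer, let $\alpha>0$ and $1<q\le 1+\frac{\alpha}{n}$ be real numbers, and let $\mathbb S=(0,+\infty)\times\mathbb R^n$. Let $\mathcal L=\sum_{i,j=1}^n\frac{\partial}{\partial x_i}\left[a_{ij}(t,x)\frac{\partial}{\partial x_j}\right]$, where the $a_{ij}$ are measurable and locally bounded in $\mathbb S$, $a_{ij}=a_{ji}$ a.e. in $\mathbb S$, and $0\le\sum_{i,j=1}^n a_{ij}(t,x)\xi_i\xi_j\le A(t,x)|\xi|^2$ for all $\xi\in\mathbb R^n$ and almost all $(t,x)\in\mathbb S$, with $A$ a measurable, non-negative, locally bounded function in $\mathbb S$. Suppose there is a constant $c>0$ such that $$\operatorname*{ess\,sup}_{(t,x)\in(0,+\infty)\times\{R/2<|x|<R\}}A(t,x)\le cR^{2-\alpha}\quad\text{for all }R>1 .$$ Let $u$ be a non-negative entire weak solution in $\mathbb S$ of $u_t\ge\mathcal Lu+|u|^{q-1}u$. Then $u=0$ (a.e.) in $\mathbb S$.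
   Context: For a bounded domain $\Pi\subset\mathbb S$ and $\hat q=\max\{1,q\}$, $W^{\mathcal L,q}(\Pi)$ denotes the completion of (the functions of finite norm in) $C^\infty(\Pi)$ with respect to the norm $$\|w\|_{W^{\mathcal L,q}(\Pi)}=\int_\Pi|w_t|\,dt\,dx+\left[\int_\Pi\sum_{i,j=1}^n a_{ij}(t,x)\frac{\partial w}{\partial x_i}\frac{\partial w}{\partial x_j}\,dt\,dx\right]^{1/2}+\left[\int_\Pi|w|^{\hat q}\,dt\,dx\right]^{1/\hat q}.$$ A function $w$ belongs to $W^{\mathcal L,q}_{\mathrm{loc}}(\mathbb S)$ if it belongs to $W^{\mathcal L,q}(\Pi)$ for every bounded domain $\Pi\subset\mathbb S$. For elements of the completion, $w_t$ and the expressions $\sum a_{ij}\frac{\partial\varphi}{\partial x_i}\frac{\partial w}{\partial x_j}$, $\sum a_{ij}\frac{\partial w}{\partial x_i}\frac{\partial w}{\partial x_j}$ are understood as limits along approximating sequences of smooth functions. A measurable function $u$ on $\mathbb S$ is an entire weak solution of $u_t\ge\mathcal Lu+|u|^{q-1}u$ in $\mathbb S$ if $u\in W^{\mathcal L,q}_{\mathrm{loc}}(\mathbb S)$ and, for every non-negative $\varphi\in C^\infty(\mathbb S)$ with compact support in $\mathbb S$, $$\int_{\mathbb S}\Big[u_t\varphi+\sum_{i,j=1}^n a_{ij}\frac{\partial\varphi}{\partial x_i}\frac{\partial u}{\partial x_j}-|u|^{q-1}u\,\varphi\Big]dt\,dx\ \ge 0.$$ No condition is imposed on the behaviour of solutions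 at $t=0$ or at infinity. *)

theory Defs
  imports "HOL-Analysis.Analysis" "HOL-Probability.Essential_Supremum"
begin

text \<open>Space-time points are pairs \<open>(t, x)\<close>; the space dimension is \<open>n = CARD('n)\<close>.\<close>

definition half_space :: "(real \<times> (real ^ 'n)) set" where
  "half_space = {0<..} \<times> UNIV"

definition locally_bounded_on :: "'a::topological_space set \<Rightarrow> ('a \<Rightarrow> real) \<Rightarrow> bool" where
  "locally_bounded_on S f \<longleftrightarrow> (\<forall>K. compact K \<and> K \<subseteq> S \<longrightarrow> bounded (f ` K))"

text \<open>Only meant for open \<open>S\<close>.\<close>

fun Ck_on :: "nat \<Rightarrow> ('a::euclidean_space \<Rightarrow> real) \<Rightarrow> 'a set \<Rightarrow> bool" where
  "Ck_on 0 f S \<longleftrightarrow> continuous_on S f"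
| "Ck_on (Suc k) f S \<longleftrightarrow> f differentiable_on S \<and>
     (\<forall>b\<in>Basis. Ck_on k (\<lambda>p. frechet_derivative f (at p) b) S)"

definition smooth_on :: "('a::euclidean_space \<Rightarrow> real) \<Rightarrow> 'a set \<Rightarrow> bool" where
  "smooth_on f S \<longleftrightarrow> (\<forall>k. Ck_on k f S)"

definition dt :: "(real \<times> (real ^ 'n) \<Rightarrow> real) \<Rightarrow> real \<times> (real ^ 'n) \<Rightarrow> real" where
  "dt f p = frechet_derivative f (at p) (1, 0)"

definition dx :: "'n \<Rightarrow> (real \<times> (real ^ 'n) \<Rightarrow> real) \<Rightarrow> real \<times> (real ^ 'n) \<Rightarrow> real" where
  "dx i f p = frechet_derivative f (at p) (0, axis i 1)"

type_synonym 'n coeffs = "'n \<Rightarrow> 'n \<Rightarrow> real \<times> (real ^ 'n) \<Rightarrow> real"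

definition grad_form ::
  "'n coeffs \<Rightarrow> (real \<times> (real ^ 'n) \<Rightarrow> real) \<Rightarrow> (real \<times> (real ^ 'n) \<Rightarrow> real) \<Rightarrow> real \<times> (real ^ 'n) \<Rightarrow> real"
  where "grad_form a f g p = (\<Sum>i\<in>UNIV. \<Sum>j\<in>UNIV. a i j p * dx i f p * dx j g p)"

definition qhat :: "real \<Rightarrow> real" where
  "qhat q = max 1 q"

definition W_smooth ::
  "'n coeffs \<Rightarrow> real \<Rightarrow> (real \<times> (real ^ 'n)) set \<Rightarrow> (real \<times> (real ^ 'n) \<Rightarrow> real) set" where
  "W_smooth a q \<Omega> = {w. smooth_on w \<Omega>
     \<and> integrable (lebesgue_on \<Omega>) (dt w)
     \<and> integrable (lebesgue_on \<Omega>) (grad_form a w w)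
     \<and> integrable (lebesgue_on \<Omega>) (\<lambda>p. \<bar>w p\<bar> powr qhat q)}"

definition W_norm ::
  "'n coeffs \<Rightarrow> real \<Rightarrow> (real \<times> (real ^ 'n)) set \<Rightarrow> (real \<times> (real ^ 'n) \<Rightarrow> real) \<Rightarrow> real" where
  "W_norm a q \<Omega> w =
     (\<integral>p. \<bar>dt w p\<bar> \<partial>lebesgue_on \<Omega>)
     + (\<integral>p. grad_form a w w p \<partial>lebesgue_on \<Omega>) powr (1/2)
     + (\<integral>p. \<bar>w p\<bar> powr qhat q \<partial>lebesgue_on \<Omega>) powr (1 / qhat q)"

definition W_Cauchy ::
  "'n coeffs \<Rightarrow> real \<Rightarrow> (real \<times> (real ^ 'n)) set \<Rightarrow> (nat \<Rightarrow> real \<times> (real ^ 'n) \<Rightarrow> real) \<Rightarrow> bool" where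
  "W_Cauchy a q \<Omega> w \<longleftrightarrow> (\<forall>k. w k \<in> W_smooth a q \<Omega>) \<and>
     (\<forall>e>0. \<exists>N. \<forall>k\<ge>N. \<forall>l\<ge>N. W_norm a q \<Omega> (\<lambda>p. w k p - w l p) < e)"

definition in_Lp :: "real \<Rightarrow> 'a::euclidean_space set \<Rightarrow> ('a \<Rightarrow> real) \<Rightarrow> bool" where
  "in_Lp r \<Omega> f \<longleftrightarrow> f \<in> borel_measurable (lebesgue_on \<Omega>)
     \<and> integrable (lebesgue_on \<Omega>) (\<lambda>p. \<bar>f p\<bar> powr r)"

definition Lp_tendsto ::
  "real \<Rightarrow> 'a::euclidean_space set \<Rightarrow> (nat \<Rightarrow> 'a \<Rightarrow> real) \<Rightarrow> ('a \<Rightarrow> real) \<Rightarrow> bool" where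
  "Lp_tendsto r \<Omega> f g \<longleftrightarrow> (\<forall>k. in_Lp r \<Omega> (f k)) \<and> in_Lp r \<Omega> g
     \<and> (\<lambda>k. \<integral>p. \<bar>f k p - g p\<bar> powr r \<partial>lebesgue_on \<Omega>) \<longlonglongrightarrow> 0"

definition test_function :: "(real \<times> (real ^ 'n) \<Rightarrow> real) \<Rightarrow> bool" where
  "test_function \<phi> \<longleftrightarrow> smooth_on \<phi> half_space
     \<and> compact (closure (support_on half_space \<phi>))
     \<and> closure (support_on half_space \<phi>) \<subseteq> half_space"

text \<open>
  An element of the completion is given by a Cauchy sequence of smooth functions. It is seen
  through its limits: the function \<open>u\<close>, its time derivative \<open>ut\<close>, and, for every test function
  \<open>\<phi>\<close>, the limit \<open>E \<phi>\<close> of \<open>\<Sum> a\<^sub>i\<^sub>j \<partial>\<^sub>i\<phi> \<partial>\<^sub>j w\<^sub>k\<close>. The convergence to \<open>ut\<close> and \<open>E \<phi>\<close>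
  costs nothing: for a Cauchy sequence these limits exist in \<open>L\<^sup>1\<close> (for the second one, by the
  Cauchy-Schwarz inequality, when the form is non-negative and locally bounded). As the coefficients may degenerate, the form need not be closable,
  so \<open>E\<close> may depend on the element of the completion and not only on \<open>u\<close>; it is therefore carried
  along.
\<close>

definition W_element ::
  "'n coeffs \<Rightarrow> real \<Rightarrow> (real \<times> (real ^ 'n)) set \<Rightarrow> (real \<times> (real ^ 'n) \<Rightarrow> real)
    \<Rightarrow> (real \<times> (real ^ 'n) \<Rightarrow> real)
    \<Rightarrow> ((real \<times> (real ^ 'n) \<Rightarrow> real) \<Rightarrow> real \<times> (real ^ 'n) \<Rightarrow> real) \<Rightarrow> bool" where
  "W_element a q \<Omega> u ut E \<longleftrightarrow> (\<exists>w. W_Cauchy a q \<Omega> w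
     \<and> Lp_tendsto (qhat q) \<Omega> w u
     \<and> Lp_tendsto 1 \<Omega> (\<lambda>k. dt (w k)) ut
     \<and> (\<forall>\<phi>. test_function \<phi> \<longrightarrow> Lp_tendsto 1 \<Omega> (\<lambda>k. grad_form a \<phi> (w k)) (E \<phi>)))"

text \<open>
  The approximating sequence may change with the bounded domain, but the limits \<open>ut\<close> and \<open>E\<close>
  are functions on the whole half-space, so that the elements on different domains agree on
  overlaps.
\<close>

definition W_loc_element ::
  "'n coeffs \<Rightarrow> real \<Rightarrow> (real \<times> (real ^ 'n) \<Rightarrow> real) \<Rightarrow> (real \<times> (real ^ 'n) \<Rightarrow> real)
    \<Rightarrow> ((real \<times> (real ^ 'n) \<Rightarrow> real) \<Rightarrow> real \<times> (real ^ 'n) \<Rightarrow> real) \<Rightarrow> bool" where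
  "W_loc_element a q u ut E \<longleftrightarrow>
     (\<forall>\<Omega>. open \<Omega> \<and> connected \<Omega> \<and> \<Omega> \<noteq> {} \<and> bounded \<Omega> \<and> \<Omega> \<subseteq> half_space
        \<longrightarrow> W_element a q \<Omega> u ut E)"

definition entire_weak_solution ::
  "'n coeffs \<Rightarrow> real \<Rightarrow> (real \<times> (real ^ 'n) \<Rightarrow> real) \<Rightarrow> bool" where
  "entire_weak_solution a q u \<longleftrightarrow> u \<in> borel_measurable (lebesgue_on half_space) \<and>
     (\<exists>ut E. W_loc_element a q u ut E \<and>
       (\<forall>\<phi>. test_function \<phi> \<and> (\<forall>p\<in>half_space. 0 \<le> \<phi> p) \<longrightarrow>
          0 \<le> (\<integral>p. ut p * \<phi> p + E \<phi> p - \<bar>u p\<bar> powr (q - 1) * u p * \<phi> p \<partial>lebesgue_on half_space)))"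

end

theory Submission
  imports Defs
begin

text \<open>Test the inequality with \<open>\<phi> = g u * \<zeta>\<close>, where \<open>g s\<close> behaves like \<open>(s + \<epsilon>) powr (- \<nu>)\<close>
  and \<open>\<zeta> = \<omega> * \<psi> ^ m\<close> is a cutoff. The gradient of \<open>u\<close> is absorbed by the good term coming from
  \<open>g' < 0\<close>, which leaves
  \<open>\<integral> u powr q * g u * \<zeta> \<le> C * \<integral> (u + \<epsilon>) powr (1 - \<nu>) * \<omega> * \<psi> ^ (m - 2) * (- \<partial>\<^sub>t \<psi> + A * \<bar>\<nabla>\<psi>\<bar>\<^sup>2 / \<nu>)\<close>.
  The part of \<open>\<partial>\<^sub>t \<zeta>\<close> due to the cutoff \<open>\<omega>\<close> near \<open>t = 0\<close> has the favourable sign, so nothing is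
  needed at the initial time. The cutoff is logarithmic: \<open>\<psi> = \<eta> (ln S / N)\<close> with \<open>S\<close> comparable to
  \<open>t + \<bar>x\<bar> powr \<alpha>\<close>. With \<open>\<nu> = 1 / N\<close> the last bracket is of size \<open>\<kappa> = 1 / (N * S)\<close> on the shell
  \<open>exp N \<le> S \<le> exp (2 * N)\<close>. Young's inequality reduces the right-hand side to
  \<open>\<integral> \<kappa> powr (1 + (1 - \<nu>) / (q - 1))\<close>, which is of order \<open>N powr (- 1 / (2 * (q - 1)))\<close> as soon as
  \<open>q \<le> 1 + \<alpha> / n\<close>. The logarithm gains the decay that is missing in the critical case, so no
  separate argument is needed there.\<close>

section \<open>Functions of class C^k and smooth cutoffs\<close>

text \<open>The solution has no gradient of its own, so \<open>g u * \<zeta>\<close> is never tested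
  literally. The test functions are \<open>g (w k) * \<zeta>\<close> with smooth approximants
  \<open>w k\<close>, paired with \<open>w l\<close>; the error is the form of
  \<open>w k - w l\<close>, small by the Cauchy property. Hence \<open>g\<close> has to be bounded,
  with bounded derivative, and the square of \<open>g\<close> over \<open>g'\<close> may grow no
  faster than the power \<open>q\<close> that the norm controls. The choice
  \<open>\<nu> = 1 / N\<close> balances two costs. Absorbing the gradient costs
  \<open>1 / \<nu> = N\<close>, which the second factor \<open>1 / N\<close> in the energy of a
  logarithmic cutoff repays exactly. The exponent of \<open>1 / S\<close> falls short of the
  critical one by at most \<open>\<nu> / (q - 1)\<close>, which on
  \<open>S \<le> exp (2 * N)\<close> costs only the constant \<open>exp (2 / (q - 1))\<close>. The
  regularization \<epsilon> is chosen after \<open>N\<close>, because of the integral of \<kappa>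
  only finiteness is used. The final bound concerns \<open>u powr q / (1 + u)\<close> on a fixed
  cylinder, a quantity free of all parameters, so \<open>N\<close> can tend to infinity.\<close>

lemma Ck_on_differentiable:
  assumes "Ck_on (Suc k) f S" "open S" "x \<in> S"
  shows "f differentiable at x"
  using assms at_within_open[of x S] by (auto simp: differentiable_on_def)

text \<open>\<open>frechet_derivative\<close> is a choice among all derivatives; both functions
  admit the same candidates at \<open>x\<close>, so the choices coincide, even where no derivative
  exists.\<close>

lemma frechet_derivative_cong_open:
  assumes "open S" "x \<in> S" "\<And>y. y \<in> S \<Longrightarrow> f y = g y"
  shows "frechet_derivative f (at x) = frechet_derivative g (at x)"
proof -
  have "(f has_derivative D) (at x) \<longleftrightarrow> (g has_derivative D) (at x)" for D
    using assms has_derivative_transform_within_open[of f D x UNIV S g]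
      has_derivative_transform_within_open[of g D x UNIV S f] by auto
  then show ?thesis
    by (simp add: frechet_derivative_def)
qed

lemma Ck_on_cong:
  assumes "open S" "\<And>y. y \<in> S \<Longrightarrow> f y = g y" "Ck_on k f S"
  shows "Ck_on k g S"
  using assms(2,3)
proof (induction k arbitrary: f g)
  case 0
  then show ?case using continuous_on_cong[of S S f g] by auto
next
  case (Suc k)
  have "g differentiable_on S"
    using Suc.prems differentiable_transform_within[where d=1, of f _ S g] by (simp add: differentiable_on_def)
  moreover have "Ck_on k (\<lambda>p. frechet_derivative g (at p) b) S" if "b \<in> Basis" for b
    using Suc.IH[of "\<lambda>p. frechet_derivative f (at p) b"] Suc.prems that
      frechet_derivative_cong_open[OF assms(1), of _ f g] by auto
  ultimately show ?case by auto
qed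

lemma Ck_on_Un:
  assumes "open S" "open T" "Ck_on k f S" "Ck_on k f T"
  shows "Ck_on k f (S \<union> T)"
  using assms(3,4)
proof (induction k arbitrary: f)
  case 0
  then show ?case using assms(1,2) by (auto intro: continuous_on_open_Un)
next
  case (Suc k)
  have "f differentiable at x" if "x \<in> S \<union> T" for x
    using Ck_on_differentiable Suc.prems assms(1,2) that by blast
  then have "f differentiable_on S \<union> T"
    by (simp add: differentiable_on_def differentiable_at_withinI)
  then show ?case using Suc by auto
qed

lemma Ck_on_subset:
  assumes "open S" "open T" "T \<subseteq> S" "Ck_on k f S"
  shows "Ck_on k f T"
  using assms(4)
proof (induction k arbitrary: f)
  case 0
  then show ?case using assms(3) by (auto intro: continuous_on_subset)
next
  case (Suc k)
  then show ?case using assms(3) by (auto intro: differentiable_on_subset)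
qed

lemma Ck_on_SucD:
  "open S \<Longrightarrow> Ck_on (Suc k) f S \<Longrightarrow> Ck_on k f S"
proof (induction k arbitrary: f)
  case 0
  then show ?case by (auto intro: differentiable_imp_continuous_on)
qed auto

lemma Ck_on_const: "Ck_on k (\<lambda>_. c) S"
  by (induction k arbitrary: c) (auto simp: frechet_derivative_const)

lemma Ck_on_bounded_linear:
  assumes "bounded_linear f"
  shows "Ck_on k f S"
proof (cases k)
  case 0
  then show ?thesis using assms by (simp add: bounded_linear.linear linear_continuous_on)
next
  case (Suc m)
  have d: "(f has_derivative f) (at x within T)" for x T
    using assms by (rule bounded_linear_imp_has_derivative)
  have "frechet_derivative f (at x) = f" for x
    using frechet_derivative_at[OF d[of x UNIV]] by simp
  then show ?thesis using Suc Ck_on_const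
    by (auto simp: differentiable_on_def differentiable_def intro: d)
qed

lemma Ck_on_add:
  assumes "open S" "Ck_on k f S" "Ck_on k g S"
  shows "Ck_on k (\<lambda>x. f x + g x) S"
  using assms(2,3)
proof (induction k arbitrary: f g)
  case 0
  then show ?case by (auto intro: continuous_intros)
next
  case (Suc k)
  have *: "frechet_derivative (\<lambda>x. f x + g x) (at p) b = frechet_derivative f (at p) b + frechet_derivative g (at p) b"
    if "p \<in> S" for p b
  proof -
    have "((\<lambda>x. f x + g x) has_derivative (\<lambda>h. frechet_derivative f (at p) h + frechet_derivative g (at p) h)) (at p)"
      using Ck_on_differentiable[OF Suc.prems(1) assms(1) that] Ck_on_differentiable[OF Suc.prems(2) assms(1) that]
      by (intro has_derivative_add) (auto simp: frechet_derivative_works)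
    from frechet_derivative_at[OF this, symmetric] show ?thesis by simp
  qed
  have "Ck_on k (\<lambda>p. frechet_derivative (\<lambda>x. f x + g x) (at p) b) S" if "b \<in> Basis" for b
    by (rule Ck_on_cong[OF assms(1) *[symmetric]], assumption, rule Suc.IH) (use Suc.prems that in auto)
  then show ?case
    using Suc.prems by (simp add: differentiable_on_add)
qed

lemma Ck_on_mult:
  assumes "open S" "Ck_on k f S" "Ck_on k g S"
  shows "Ck_on k (\<lambda>x. f x * g x) S"
  using assms(2,3)
proof (induction k arbitrary: f g)
  case 0
  then show ?case by (auto intro: continuous_intros)
next
  case (Suc k)
  have *: "frechet_derivative (\<lambda>x. f x * g x) (at p) b = f p * frechet_derivative g (at p) b + frechet_derivative f (at p) b * g p"
    if "p \<in> S" for p b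
  proof -
    have "((\<lambda>x. f x * g x) has_derivative (\<lambda>h. f p * frechet_derivative g (at p) h + frechet_derivative f (at p) h * g p)) (at p)"
      using Ck_on_differentiable[OF Suc.prems(1) assms(1) that] Ck_on_differentiable[OF Suc.prems(2) assms(1) that]
      by (intro has_derivative_mult) (auto simp: frechet_derivative_works)
    from frechet_derivative_at[OF this, symmetric] show ?thesis by simp
  qed
  have k: "Ck_on k f S" "Ck_on k g S"
    using Suc.prems Ck_on_SucD assms(1) by blast+
  have "Ck_on k (\<lambda>p. frechet_derivative (\<lambda>x. f x * g x) (at p) b) S" if "b \<in> Basis" for b
    by (rule Ck_on_cong[OF assms(1) *[symmetric]], assumption, rule Ck_on_add[OF assms(1)]; rule Suc.IH)
      (use Suc.prems that k in auto)
  then show ?case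
    using Suc.prems by (simp add: differentiable_on_mult)
qed

lemma frechet_derivative_compose_real:
  fixes g :: "real \<Rightarrow> real" and f :: "'a::real_normed_vector \<Rightarrow> real"
  assumes "f differentiable at p" "g differentiable at (f p)"
  shows "frechet_derivative (\<lambda>x. g (f x)) (at p) b = frechet_derivative g (at (f p)) 1 * frechet_derivative f (at p) b"
proof -
  have "((\<lambda>x. g (f x)) has_derivative (\<lambda>h. frechet_derivative g (at (f p)) (frechet_derivative f (at p) h))) (at p)"
    by (rule has_derivative_compose[OF assms(1)[unfolded frechet_derivative_works] assms(2)[unfolded frechet_derivative_works]])
  from frechet_derivative_at[OF this, symmetric]
  have "frechet_derivative (\<lambda>x. g (f x)) (at p) b = frechet_derivative g (at (f p)) (frechet_derivative f (at p) b)"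
    by simp
  also have "\<dots> = frechet_derivative g (at (f p)) (frechet_derivative f (at p) b *\<^sub>R 1)"
    by simp
  also have "\<dots> = frechet_derivative g (at (f p)) 1 * frechet_derivative f (at p) b"
    using linear_frechet_derivative[OF assms(2)] by (simp only: linear.scaleR) simp
  finally show ?thesis .
qed

lemma Ck_on_compose:
  fixes g :: "real \<Rightarrow> real"
  assumes "open S" "open T" "f ` S \<subseteq> T" "Ck_on k f S" "Ck_on k g T"
  shows "Ck_on k (\<lambda>x. g (f x)) S"
  using assms(3-5)
proof (induction k arbitrary: g)
  case 0
  then show ?case by (auto intro: continuous_on_compose2)
next
  case (Suc k)
  have df: "f differentiable at p" if "p \<in> S" for p
    using Ck_on_differentiable[OF Suc.prems(2) assms(1) that] .
  have dg: "g differentiable at (f p)" if "p \<in> S" for p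
    using Ck_on_differentiable[OF Suc.prems(3) assms(2)] that Suc.prems(1) by blast
  note * = frechet_derivative_compose_real[OF df dg]
  have k: "Ck_on k f S"
    using Suc.prems Ck_on_SucD assms(1) by blast
  have "(\<lambda>x. g (f x)) differentiable_on S"
    using df dg differentiable_chain_at[of f _ g, unfolded o_def]
    by (simp add: differentiable_on_def differentiable_at_withinI)
  moreover have "Ck_on k (\<lambda>p. frechet_derivative (\<lambda>x. g (f x)) (at p) b) S" if "b \<in> Basis" for b
    apply (rule Ck_on_cong[OF assms(1) *[symmetric]], assumption, assumption)
    apply (rule Ck_on_mult[OF assms(1)])
     apply (rule Suc.IH[OF Suc.prems(1) k])
    using Suc.prems that by auto
  ultimately show ?case by simp
qed

lemma smooth_on_cong: "open S \<Longrightarrow> (\<And>y. y \<in> S \<Longrightarrow> f y = g y) \<Longrightarrow> smooth_on f S \<Longrightarrow> smooth_on g S"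
  using Ck_on_cong unfolding smooth_on_def by blast

lemma smooth_on_Un: "open S \<Longrightarrow> open T \<Longrightarrow> smooth_on f S \<Longrightarrow> smooth_on f T \<Longrightarrow> smooth_on f (S \<union> T)"
  using Ck_on_Un unfolding smooth_on_def by blast

lemma smooth_on_subset: "open S \<Longrightarrow> open T \<Longrightarrow> T \<subseteq> S \<Longrightarrow> smooth_on f S \<Longrightarrow> smooth_on f T"
  using Ck_on_subset unfolding smooth_on_def by blast

lemma smooth_on_const: "smooth_on (\<lambda>_. c) S"
  using Ck_on_const unfolding smooth_on_def by blast

lemma smooth_on_bounded_linear: "bounded_linear f \<Longrightarrow> smooth_on f S"
  using Ck_on_bounded_linear unfolding smooth_on_def by blast

lemma smooth_on_add: "open S \<Longrightarrow> smooth_on f S \<Longrightarrow> smooth_on g S \<Longrightarrow> smooth_on (\<lambda>x. f x + g x) S"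
  using Ck_on_add unfolding smooth_on_def by blast

lemma smooth_on_mult: "open S \<Longrightarrow> smooth_on f S \<Longrightarrow> smooth_on g S \<Longrightarrow> smooth_on (\<lambda>x. f x * g x) S"
  using Ck_on_mult unfolding smooth_on_def by blast

lemma smooth_on_compose:
  fixes g :: "real \<Rightarrow> real"
  shows "open S \<Longrightarrow> open T \<Longrightarrow> f ` S \<subseteq> T \<Longrightarrow> smooth_on f S \<Longrightarrow> smooth_on g T \<Longrightarrow> smooth_on (\<lambda>x. g (f x)) S"
  using Ck_on_compose unfolding smooth_on_def by blast

lemma smooth_on_diff:
  assumes "open S" "smooth_on f S" "smooth_on g S"
  shows "smooth_on (\<lambda>x. f x - g x) S"
  using smooth_on_add[OF assms(1,2) smooth_on_mult[OF assms(1) smooth_on_const[of "-1"] assms(3)]]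
  by simp

lemma smooth_on_power:
  assumes "open S" "smooth_on f S"
  shows "smooth_on (\<lambda>x. f x ^ m) S"
  using assms by (induction m) (auto intro: smooth_on_const smooth_on_mult)

lemma smooth_on_sum:
  assumes "open S" "\<And>i. i \<in> J \<Longrightarrow> smooth_on (f i) S"
  shows "smooth_on (\<lambda>x. \<Sum>i\<in>J. f i x) S"
  using assms(2)
proof (induction J rule: infinite_finite_induct)
  case (insert x F)
  then show ?case using assms(1) by (auto intro: smooth_on_add)
qed (auto intro: smooth_on_const)

lemma smooth_on_ident: "smooth_on (\<lambda>x. x) (S :: real set)"
  by (intro smooth_on_bounded_linear bounded_linear_ident)

lemma smooth_on_imp_differentiable: "smooth_on f S \<Longrightarrow> open S \<Longrightarrow> x \<in> S \<Longrightarrow> f differentiable at x"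
  using Ck_on_differentiable[of 0] unfolding smooth_on_def by blast

lemma smooth_on_imp_continuous_on: "smooth_on f S \<Longrightarrow> continuous_on S f"
  unfolding smooth_on_def using Ck_on.simps(1) by blast

lemma smooth_on_frechet_derivative:
  "smooth_on f S \<Longrightarrow> b \<in> Basis \<Longrightarrow> smooth_on (\<lambda>p. frechet_derivative f (at p) b) S"
  unfolding smooth_on_def using Ck_on.simps(2) by blast

lemma has_real_derivative_frechet:
  fixes g :: "real \<Rightarrow> real"
  assumes "(g has_real_derivative d) (at x)"
  shows "frechet_derivative g (at x) h = d * h"
  using frechet_derivative_at[OF assms[unfolded has_field_derivative_def], symmetric] by simp

text \<open>The induction on the order runs over the whole family at once: each derivative is a
  combination of two members, which the induction hypothesis covers at their own indices. The
  families in question are \<open>x powr r\<close>, indexed by \<open>r\<close>, and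
  \<open>exp_cutoff j\<close>, indexed by \<open>j\<close>.\<close>

lemma smooth_on_deriv_family:
  fixes F :: "'i \<Rightarrow> real \<Rightarrow> real"
  assumes "open S"
    and "\<And>i x. x \<in> S \<Longrightarrow> \<exists>d. (F i has_real_derivative d) (at x)"
    and "\<And>i. \<exists>c d j l. \<forall>x\<in>S. (F i has_real_derivative c * F j x + d * F l x) (at x)"
  shows "smooth_on (F i) S"
proof -
  have "Ck_on k (F i) S" for k
  proof (induction k arbitrary: i)
    case 0
    have "isCont (F i) x" if "x \<in> S" for x
      using assms(2)[OF that, of i] DERIV_isCont by blast
    then show ?case by (simp add: continuous_at_imp_continuous_on)
  next
    case (Suc k)
    obtain c d j l where *: "\<And>x. x \<in> S \<Longrightarrow> (F i has_real_derivative c * F j x + d * F l x) (at x)"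
      using assms(3)[of i] by blast
    have "F i differentiable_on S"
      by (simp add: differentiable_on_def differentiable_at_withinI real_differentiable_def[THEN iffD2, OF exI, OF *])
    moreover have "Ck_on k (\<lambda>p. frechet_derivative (F i) (at p) 1) S"
    proof (rule Ck_on_cong[OF assms(1)])
      show "c * F j x + d * F l x = frechet_derivative (F i) (at x) 1" if "x \<in> S" for x
        by (simp add: has_real_derivative_frechet[OF *[OF that]])
      show "Ck_on k (\<lambda>x. c * F j x + d * F l x) S"
        by (intro Ck_on_add Ck_on_mult Ck_on_const Suc.IH assms(1))
    qed
    ultimately show ?case by simp
  qed
  then show ?thesis unfolding smooth_on_def by blast
qed

lemma smooth_on_powr: "smooth_on (\<lambda>x::real. x powr r) {0<..}"
proof (rule smooth_on_deriv_family[where F = "\<lambda>r x. x powr r"])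
  fix i :: real
  have "\<forall>x\<in>{0<..}. ((\<lambda>x. x powr i) has_real_derivative i * x powr (i - 1) + 0 * x powr i) (at x)"
    by (auto intro!: derivative_eq_intros simp: field_simps powr_diff)
  then show "\<exists>c d j l. \<forall>x\<in>{0<..}. ((\<lambda>x. x powr i) has_real_derivative c * x powr j + d * x powr l) (at x)"
    by blast
  show "\<exists>d. ((\<lambda>x. x powr i) has_real_derivative d) (at x)" if "x \<in> {0<..}" for x
    using that has_real_derivative_powr by blast
qed auto

text \<open>The derivative \<open>x powr (-1)\<close> is a power, so a single step of the recursion
  reduces the claim to \<open>smooth_on_powr\<close>.\<close>

lemma smooth_on_ln: "smooth_on (ln :: real \<Rightarrow> real) {0<..}"
proof -
  have d: "(ln has_real_derivative x powr (-1)) (at x)" if "x > 0" for x :: real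
    using that by (auto intro!: derivative_eq_intros simp: powr_minus field_simps)
  have "Ck_on k (ln :: real \<Rightarrow> real) {0<..}" for k
  proof (cases k)
    case 0
    then show ?thesis by (auto intro!: continuous_intros)
  next
    case (Suc m)
    have "Ck_on m (\<lambda>p. frechet_derivative ln (at p) 1) {0::real<..}"
      by (rule Ck_on_cong[of _ "\<lambda>x. x powr (-1)"])
        (use smooth_on_powr[of "-1"] in \<open>auto simp: smooth_on_def has_real_derivative_frechet[OF d]\<close>)
    then show ?thesis using Suc d
      by (auto simp: differentiable_on_def intro!: differentiable_at_withinI real_differentiable_def[THEN iffD2, OF exI, OF d])
  qed
  then show ?thesis unfolding smooth_on_def by blast
qed

section \<open>The flat exponential and a smooth cutoff on the line\<close>

definition exp_cutoff :: "nat \<Rightarrow> real \<Rightarrow> real" where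
  "exp_cutoff j x = (if x > 0 then exp (- 1 / x) / x ^ j else 0)"

lemma exp_cutoff_tendsto: "((\<lambda>x. exp_cutoff j x) \<longlongrightarrow> 0) (at 0)"
proof -
  have "((\<lambda>x::real. exp (- 1 / x) / x ^ j) \<longlongrightarrow> 0) (at_right 0)"
  proof -
    have "((\<lambda>y::real. y ^ j / exp y) \<longlongrightarrow> 0) at_top" by (rule tendsto_power_div_exp_0)
    then have "((\<lambda>x::real. inverse x ^ j / exp (inverse x)) \<longlongrightarrow> 0) (at_right 0)"
      using filterlim_compose[OF _ filterlim_inverse_at_top_right] by blast
    then show ?thesis
      by (simp add: field_simps exp_minus power_inverse)
  qed
  then have "((\<lambda>x. exp_cutoff j x) \<longlongrightarrow> 0) (at_right 0)"
    by (rule Lim_transform_eventually) (auto simp: exp_cutoff_def eventually_at_filter)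
  moreover have "((\<lambda>x. exp_cutoff j x) \<longlongrightarrow> 0) (at_left 0)"
    by (rule Lim_transform_eventually[OF tendsto_const]) (auto simp: exp_cutoff_def eventually_at_filter)
  ultimately show ?thesis by (simp add: filterlim_split_at)
qed

text \<open>The powers of \<open>x\<close> in the denominator close the family under
  differentiation: the exponential contributes \<open>1 / x ^ 2\<close>, hence the index
  \<open>j + 2\<close>, and the factor \<open>1 / x ^ j\<close> contributes the index
  \<open>j + 1\<close>.\<close>

lemma exp_cutoff_deriv:
  "(exp_cutoff j has_real_derivative - real j * exp_cutoff (Suc j) x + 1 * exp_cutoff (Suc (Suc j)) x) (at x)"
proof -
  consider "x > 0" | "x < 0" | "x = 0" by linarith
  then show ?thesis
  proof cases
    case 1
    have "((\<lambda>x. exp (- 1 / x) / x ^ j) has_real_derivative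
        - real j * (exp (- 1 / x) / x ^ Suc j) + 1 * (exp (- 1 / x) / x ^ Suc (Suc j))) (at x)"
    proof -
      \<comment> \<open>For \<open>j = 0\<close> the truncated exponent is off by one, but the
        factor \<open>real j\<close> vanishes.\<close>
      have "real j * x ^ (j - Suc 0) * x = real j * x ^ j"
        by (cases j) auto
      then show ?thesis
        using 1 by (auto intro!: derivative_eq_intros simp: field_simps power2_eq_square)
    qed
    then have "(exp_cutoff j has_real_derivative
        - real j * (exp (- 1 / x) / x ^ Suc j) + 1 * (exp (- 1 / x) / x ^ Suc (Suc j))) (at x)"
      by (rule has_field_derivative_transform_within[where d=x]) (use 1 in \<open>auto simp: exp_cutoff_def dist_real_def\<close>)
    then show ?thesis using 1 by (simp add: exp_cutoff_def)
  next
    case 2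
    have "((\<lambda>_. 0) has_real_derivative 0) (at x)" by simp
    then have "(exp_cutoff j has_real_derivative 0) (at x)"
      by (rule has_field_derivative_transform_within[where d="-x"]) (use 2 in \<open>auto simp: exp_cutoff_def dist_real_def\<close>)
    then show ?thesis using 2 by (simp add: exp_cutoff_def)
  next
    case 3
    \<comment> \<open>The difference quotient of \<open>exp_cutoff j\<close> at 0 is
      \<open>exp_cutoff (Suc j)\<close>, whose limit is already known.\<close>
    have "(exp_cutoff j has_real_derivative 0) (at 0)"
      unfolding has_field_derivative_iff
      by (rule Lim_transform_eventually[OF exp_cutoff_tendsto[of "Suc j"]])
        (auto simp: exp_cutoff_def eventually_at_filter)
    then show ?thesis using 3 by (simp add: exp_cutoff_def)
  qed
qed

lemma smooth_on_exp_cutoff: "smooth_on (exp_cutoff j) UNIV"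
  by (rule smooth_on_deriv_family) (use exp_cutoff_deriv in \<open>blast+\<close>)

text \<open>With \<open>f x = exp (- 1 / x)\<close>, the function \<open>f (1 / e - f (x - 1))\<close> is constant up to \<open>1\<close>
  and vanishes from \<open>2\<close> on.\<close>

lemma smooth_cutoff_exists:
  obtains \<eta> \<eta>' :: "real \<Rightarrow> real" and M :: real where
    "smooth_on \<eta> UNIV" "\<And>x. (\<eta> has_real_derivative \<eta>' x) (at x)"
    "\<And>x. x \<le> 1 \<Longrightarrow> \<eta> x = 1" "\<And>x. 2 \<le> x \<Longrightarrow> \<eta> x = 0" "\<And>x. 0 \<le> \<eta> x" "\<And>x. \<eta> x \<le> 1"
    "\<And>x. \<eta>' x \<le> 0" "\<And>x. \<bar>\<eta>' x\<bar> \<le> M" "\<And>x. x \<le> 1 \<Longrightarrow> \<eta>' x = 0" "\<And>x. 2 \<le> x \<Longrightarrow> \<eta>' x = 0"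
proof -
  let ?f = "exp_cutoff 0" and ?f' = "exp_cutoff 2"
  \<comment> \<open>\<open>e\<close> is the value of \<open>?f\<close> at 1, so the inner argument
    \<open>e - ?f (x - 1)\<close> equals \<open>e\<close> for \<open>x \<le> 1\<close> and is at
    most 0 for \<open>2 \<le> x\<close>. Dividing by \<open>?f e\<close> normalizes the plateau to
    1.\<close>
  define e where "e = exp (- 1 :: real)"
  have e: "0 < e" by (simp add: e_def)
  define \<eta> where "\<eta> x = ?f (e - ?f (x - 1)) / ?f e" for x
  define \<eta>' where "\<eta>' x = - ?f' (e - ?f (x - 1)) * ?f' (x - 1) / ?f e" for x
  have d: "(?f has_real_derivative ?f' x) (at x)" for x
    using exp_cutoff_deriv[of 0 x] by (simp add: eval_nat_numeral)
  have fe: "?f e > 0" using e by (simp add: exp_cutoff_def)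
  have mono: "mono ?f"
  proof (rule monoI)
    fix x y :: real assume "x \<le> y"
    then show "?f x \<le> ?f y"
    proof (rule DERIV_nonneg_imp_nondecreasing)
      show "\<exists>y. (?f has_real_derivative y) (at z) \<and> 0 \<le> y" for z
        using d[of z] by (intro exI[of _ "?f' z"]) (simp add: exp_cutoff_def)
    qed
  qed
  have f0: "?f x = 0" "?f' x = 0" if "x \<le> 0" for x using that by (auto simp: exp_cutoff_def)
  have fnn: "0 \<le> ?f x" "0 \<le> ?f' x" for x by (auto simp: exp_cutoff_def)
  have f1: "?f (x - 1) \<ge> e" if "2 \<le> x" for x
    using monoD[OF mono, of 1 "x - 1"] that by (simp add: exp_cutoff_def e_def)
  have sm: "smooth_on \<eta> UNIV"
  proof -
    have 1: "smooth_on (\<lambda>x. ?f (x - 1)) UNIV"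
      by (rule smooth_on_compose[where T=UNIV]) (auto intro: smooth_on_diff smooth_on_const smooth_on_ident smooth_on_exp_cutoff)
    have "smooth_on (\<lambda>x. ?f (e - ?f (x - 1))) UNIV"
      by (rule smooth_on_compose[where T=UNIV]) (auto intro: smooth_on_diff smooth_on_const 1 smooth_on_exp_cutoff)
    then show ?thesis
      unfolding \<eta>_def divide_inverse by (intro smooth_on_mult smooth_on_const) auto
  qed
  have ch: "(\<eta> has_real_derivative \<eta>' x) (at x)" for x
    unfolding \<eta>_def \<eta>'_def using fe
    by (auto intro!: derivative_eq_intros DERIV_chain2[OF d] simp: field_simps)
  have cont: "continuous_on UNIV \<eta>'"
  proof -
    have c: "continuous_on UNIV (exp_cutoff j)" for j
      by (rule smooth_on_imp_continuous_on[OF smooth_on_exp_cutoff])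
    show ?thesis unfolding \<eta>'_def
      using fe by (intro continuous_intros continuous_on_compose2[OF c]) auto
  qed
  have z: "\<eta>' x = 0" if "x \<le> 1 \<or> 2 \<le> x" for x
    using that f0 f1[of x] by (auto simp: \<eta>'_def)
  obtain M where M: "\<And>x. x \<in> {1..2} \<Longrightarrow> \<bar>\<eta>' x\<bar> \<le> M"
  proof -
    have "compact (\<eta>' ` {1..2})"
      by (intro compact_continuous_image continuous_on_subset[OF cont]) auto
    then have "bounded (\<eta>' ` {1..2})" by (rule compact_imp_bounded)
    then obtain B where "\<forall>y\<in>\<eta>' ` {1..2}. norm y \<le> B" by (auto simp: bounded_iff)
    then show ?thesis using that[of B] by auto
  qed
  have Mall: "\<bar>\<eta>' x\<bar> \<le> M" for x
    using M[of x] M[of 1] z[of x] by (cases "x \<in> {1..2}") auto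
  have le1: "\<eta> x \<le> 1" for x
    using monoD[OF mono, of "e - ?f (x - 1)" e] fnn[of "x - 1"] fe by (simp add: \<eta>_def)
  show ?thesis
    by (rule that[OF sm ch _ _ _ le1 _ Mall z z])
      (use fe fnn f0 f1 in \<open>auto simp: \<eta>_def \<eta>'_def intro!: divide_nonpos_pos mult_nonneg_nonneg\<close>)
qed

section \<open>The nonlinear weight\<close>

lemma antiderivative_exists:
  fixes g :: "real \<Rightarrow> real"
  assumes "continuous_on UNIV g"
  obtains G where "\<And>x. (G has_real_derivative g x) (at x)" "G 0 = 0"
proof -
  have "\<exists>F. \<forall>x. - \<infinity> < ereal x \<longrightarrow> ereal x < \<infinity> \<longrightarrow> (F has_vector_derivative g x) (at x)"
    by (rule einterval_antiderivative) (use assms in \<open>auto simp: continuous_on_eq_continuous_at\<close>)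
  then obtain F where F: "\<And>x. (F has_real_derivative g x) (at x)"
    by (auto simp: has_real_derivative_iff_has_vector_derivative)
  show ?thesis
  proof (rule that[of "\<lambda>x. F x - F 0"])
    show "((\<lambda>x. F x - F 0) has_real_derivative g x) (at x)" for x
      using DERIV_diff[OF F[of x] DERIV_const[of "F 0"]] by simp
  qed simp
qed

text \<open>A smooth bounded substitute for \<open>s powr (- \<nu>)\<close>, strictly decreasing on the whole line because
  the smooth functions approximating a non-negative solution may change sign.
  The bound by \<open>1 + \<bar>s\<bar> powr q\<close> at \<open>-\<infinity>\<close> is what forces the exponent \<open>\<beta> \<le> q - 1\<close>.\<close>

lemma weight_function_exists:
  fixes \<epsilon> \<nu> \<beta> q :: real
  assumes "0 < \<epsilon>" "\<epsilon> \<le> 1" "0 < \<nu>" "\<nu> \<le> \<beta>" "\<beta> \<le> 1" "\<nu> \<le> 1/2" "1 + \<beta> \<le> q"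
  obtains g g' G :: "real \<Rightarrow> real" and M C :: real where
    "smooth_on g UNIV" "\<And>x. (g has_real_derivative g' x) (at x)" "continuous_on UNIV g'"
    "\<And>x. (G has_real_derivative g x) (at x)" "G 0 = 0"
    "\<And>x. 0 < g x" "\<And>x. g x \<le> M" "\<And>x. g' x < 0" "\<And>x. \<bar>g' x\<bar> \<le> M"
    "\<And>x. (g x)\<^sup>2 / (2 * \<bar>g' x\<bar>) \<le> C * (1 + \<bar>x\<bar> powr q)"
    "\<And>x. 0 \<le> x \<Longrightarrow> G x \<le> 2 * (x + \<epsilon>) powr (1 - \<nu>)"
    "\<And>x. 0 \<le> x \<Longrightarrow> 0 \<le> G x"
    "\<And>x. 0 \<le> x \<Longrightarrow> (g x)\<^sup>2 / (2 * \<bar>g' x\<bar>) \<le> (1 / \<nu>) * (x + \<epsilon>) powr (1 - \<nu>)"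
    "\<And>x. 0 \<le> x \<Longrightarrow> (x + \<epsilon>) powr (- \<nu>) / 4 \<le> g x"
proof -
  \<comment> \<open>\<open>\<rho>\<close> smooths \<open>|s|\<close>, and \<open>\<theta>\<close>
    smooths \<open>2 * max s 0\<close> while staying positive, with derivative
    \<open>\<theta> / \<rho>\<close>. \<open>Y\<close> saturates at \<epsilon> for negative
    \<open>s\<close> and is comparable to \<open>s powr \<beta>\<close> for large \<open>s\<close>,
    so its power \<open>- \<nu> / \<beta>\<close> is bounded and decays like
    \<open>s powr (- \<nu>)\<close>. At minus infinity \<open>\<theta>\<close> is of order
    \<open>\<epsilon> ^ 2 / |s|\<close>, so \<open>|g'|\<close> decays like
    \<open>|s| powr (- 1 - \<beta>)\<close>; this produces the growth \<open>1 + \<beta>\<close>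
    that \<open>q\<close> has to dominate.\<close>
  define \<rho> where "\<rho> s = (s\<^sup>2 + \<epsilon>\<^sup>2) powr (1/2)" for s :: real
  define \<theta> where "\<theta> s = s + \<rho> s" for s
  define Y where "Y s = \<epsilon> + \<theta> s powr \<beta>" for s
  define g where "g s = Y s powr (- \<nu> / \<beta>)" for s
  define g' where "g' s = - \<nu> * (Y s powr (- \<nu> / \<beta> - 1) * \<theta> s powr \<beta> / \<rho> s)" for s
  have \<beta>: "0 < \<beta>" using assms by simp
  have pos: "0 < s\<^sup>2 + \<epsilon>\<^sup>2" for s using assms(1) by (simp add: add_nonneg_pos)
  have \<rho>sq: "(\<rho> s)\<^sup>2 = s\<^sup>2 + \<epsilon>\<^sup>2" and \<rho>pos: "0 < \<rho> s" for s
    using pos[of s] by (simp_all add: \<rho>_def powr_half_sqrt)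
  have \<rho>abs: "\<bar>s\<bar> < \<rho> s" for s
    by (rule power2_less_imp_less) (use assms(1) \<rho>pos[of s] in \<open>simp_all add: \<rho>sq\<close>)
  have \<rho>eps: "\<epsilon> \<le> \<rho> s" for s
    by (rule power2_le_imp_le) (use \<rho>pos[of s] in \<open>simp_all add: \<rho>sq\<close>)
  have \<rho>le: "\<rho> s \<le> \<bar>s\<bar> + \<epsilon>" for s
    by (rule power2_le_imp_le) (use assms(1) in \<open>simp_all add: \<rho>sq power2_sum\<close>)
  have \<theta>pos: "0 < \<theta> s" for s using \<rho>abs[of s] by (simp add: \<theta>_def)
  have Ypos: "0 < Y s" "\<epsilon> \<le> Y s" "\<theta> s powr \<beta> \<le> Y s" for s
    using \<theta>pos[of s] assms(1) by (simp_all add: Y_def add_pos_nonneg)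
  have d\<rho>: "(\<rho> has_real_derivative s / \<rho> s) (at s)" for s
  proof -
    have "((\<lambda>s. (s\<^sup>2 + \<epsilon>\<^sup>2) powr (1/2)) has_real_derivative (1/2) * (s\<^sup>2 + \<epsilon>\<^sup>2) powr (1/2 - 1) * (2 * s)) (at s)"
      by (rule DERIV_fun_powr[unfolded of_nat_1]) (use pos[of s] in \<open>auto intro!: derivative_eq_intros\<close>)
    moreover have "(s\<^sup>2 + \<epsilon>\<^sup>2) powr (1/2 - 1) = 1 / \<rho> s"
      using pos[of s] by (simp add: \<rho>_def powr_minus_divide)
    ultimately show ?thesis by (simp add: \<rho>_def[abs_def])
  qed
  have d\<theta>: "(\<theta> has_real_derivative \<theta> s / \<rho> s) (at s)" for s
    unfolding \<theta>_def[abs_def] using \<rho>pos[of s]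
    by (auto intro!: derivative_eq_intros d\<rho> simp: field_simps)
  have dY: "(Y has_real_derivative \<beta> * \<theta> s powr \<beta> / \<rho> s) (at s)" for s
  proof -
    have "((\<lambda>s. \<theta> s powr \<beta>) has_real_derivative \<beta> * \<theta> s powr (\<beta> - 1) * (\<theta> s / \<rho> s)) (at s)"
      by (rule DERIV_fun_powr[OF d\<theta> \<theta>pos, unfolded of_nat_1])
    moreover have "\<beta> * \<theta> s powr (\<beta> - 1) * (\<theta> s / \<rho> s) = \<beta> * \<theta> s powr \<beta> / \<rho> s"
      using \<theta>pos[of s] by (simp add: powr_diff)
    ultimately have "((\<lambda>s. \<theta> s powr \<beta>) has_real_derivative \<beta> * \<theta> s powr \<beta> / \<rho> s) (at s)" by (simp only:)
    from DERIV_add[OF DERIV_const[of \<epsilon>] this] show ?thesis unfolding Y_def[abs_def] by simp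
  qed
  have dg: "(g has_real_derivative g' s) (at s)" for s
  proof -
    have "((\<lambda>s. Y s powr (- \<nu> / \<beta>)) has_real_derivative (- \<nu> / \<beta>) * Y s powr (- \<nu> / \<beta> - 1) * (\<beta> * \<theta> s powr \<beta> / \<rho> s)) (at s)"
      by (rule DERIV_fun_powr[OF dY Ypos(1), unfolded of_nat_1])
    then show ?thesis using \<beta> by (simp add: g_def[abs_def] g'_def field_simps)
  qed
  have sm: "smooth_on g UNIV"
  proof -
    have \<rho>: "smooth_on \<rho> UNIV" unfolding \<rho>_def[abs_def]
      by (rule smooth_on_compose[OF _ _ _ _ smooth_on_powr])
        (use pos in \<open>auto intro!: smooth_on_add smooth_on_const smooth_on_power smooth_on_ident\<close>)
    have \<theta>: "smooth_on \<theta> UNIV" unfolding \<theta>_def[abs_def]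
      by (intro smooth_on_add smooth_on_ident \<rho>) auto
    have Y: "smooth_on Y UNIV" unfolding Y_def[abs_def]
      by (intro smooth_on_add smooth_on_const smooth_on_compose[OF _ _ _ \<theta> smooth_on_powr]) (use \<theta>pos in auto)
    show ?thesis unfolding g_def[abs_def]
      by (rule smooth_on_compose[OF _ _ _ Y smooth_on_powr]) (use Ypos in auto)
  qed
  have cont: "isCont \<rho> s" "isCont \<theta> s" "isCont Y s" for s
    using d\<rho> d\<theta> dY DERIV_isCont by blast+
  have cg': "continuous_on UNIV g'"
    unfolding continuous_on_eq_continuous_at[OF open_UNIV] g'_def[abs_def]
    using Ypos(1) \<theta>pos \<rho>pos by (auto intro!: continuous_intros cont simp: less_imp_neq[THEN not_sym])
  have cg: "continuous_on UNIV g" using smooth_on_imp_continuous_on[OF sm] .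
  obtain G where G: "\<And>x. (G has_real_derivative g x) (at x)" "G 0 = 0"
using antiderivative_exists[OF cg] by blast  have gpos: "0 < g s" for s using Ypos(1)[of s] by (simp add: g_def)
  have g'neg: "g' s < 0" for s
    unfolding g'_def using Ypos(1)[of s] \<theta>pos[of s] \<rho>pos[of s] assms(3)
    by (simp add: mult_less_0_iff)
  have gle: "g s \<le> \<epsilon> powr (- \<nu> / \<beta>)" for s
    unfolding g_def using Ypos(2)[of s] assms \<beta> by (intro powr_mono2') auto
  have g'le: "\<bar>g' s\<bar> \<le> \<nu> * \<epsilon> powr (- \<nu> / \<beta>) / \<epsilon>" for s
  proof -
    have "\<bar>g' s\<bar> = \<nu> * g s * (\<theta> s powr \<beta> / Y s) / \<rho> s"
    proof -
      have "\<bar>g' s\<bar> = - g' s" using g'neg[of s] by simp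
      also have "\<dots> = \<nu> * g s * (\<theta> s powr \<beta> / Y s) / \<rho> s"
        using Ypos(1)[of s] by (simp add: g'_def g_def powr_diff)
      finally show ?thesis .
    qed
    also have "\<dots> \<le> \<nu> * \<epsilon> powr (- \<nu> / \<beta>) * 1 / \<epsilon>"
      using assms Ypos[of s] \<rho>eps[of s] gle[of s] gpos[of s] \<rho>pos[of s]
      by (intro frac_le mult_mono) auto
    finally show ?thesis by simp
  qed
  have H: "(g s)\<^sup>2 / (2 * \<bar>g' s\<bar>) = Y s powr (1 - \<nu> / \<beta>) * \<theta> s powr (- \<beta>) * \<rho> s / (2 * \<nu>)" for s
  proof -
    have "(g s)\<^sup>2 = Y s powr (1 - \<nu> / \<beta>) * Y s powr (- \<nu> / \<beta> - 1)"
      by (simp add: g_def power2_eq_square flip: powr_add)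
    moreover have "\<theta> s powr (- \<beta>) * \<theta> s powr \<beta> = 1"
      using \<theta>pos[of s] by (simp add: powr_minus)
    moreover have "\<bar>g' s\<bar> = - g' s" using g'neg[of s] by simp
    then have "\<bar>g' s\<bar> = \<nu> * (Y s powr (- \<nu> / \<beta> - 1) * \<theta> s powr \<beta> / \<rho> s)"
      unfolding g'_def by simp
    ultimately show ?thesis
    proof -
      assume 1: "(g s)\<^sup>2 = Y s powr (1 - \<nu> / \<beta>) * Y s powr (- \<nu> / \<beta> - 1)"
        and 2: "\<theta> s powr (- \<beta>) * \<theta> s powr \<beta> = 1"
        and 3: "\<bar>g' s\<bar> = \<nu> * (Y s powr (- \<nu> / \<beta> - 1) * \<theta> s powr \<beta> / \<rho> s)"
      have alg: "P * Z / (2 * (\<nu> * (Z * t / r))) = P * t' * r / (2 * \<nu>)"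
        if "t' * t = 1" "Z > 0" "t > 0" "r > 0" for P Z t t' r :: real
      proof -
        have "t' = 1 / t" using that by (simp add: field_simps)
        then show ?thesis using that assms(3) by (simp add: field_simps)
      qed
      show ?thesis unfolding 1 3
        by (rule alg[OF 2]) (use Ypos(1)[of s] \<theta>pos[of s] \<rho>pos[of s] in auto)
    qed
  qed
  have "\<exists>C. \<forall>s. (g s)\<^sup>2 / (2 * \<bar>g' s\<bar>) \<le> C * (1 + \<bar>s\<bar> powr q)"
  proof -
    define K where "K = \<epsilon> powr (- \<nu> / \<beta>) / (2 * \<nu>)"
    have K: "K > 0" using assms by (simp add: K_def)
    have "(g s)\<^sup>2 / (2 * \<bar>g' s\<bar>) \<le> (K * (1 + (2 / \<epsilon>\<^sup>2) powr \<beta>) * 2 * 2 powr q) * (1 + \<bar>s\<bar> powr q)" for s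
    proof -
      define r where "r = 1 + \<bar>s\<bar>"
      have r: "1 \<le> r" by (simp add: r_def)
      have \<rho>r: "\<rho> s \<le> r" using \<rho>le[of s] assms(2) by (simp add: r_def)
      have th: "\<theta> s powr (- \<beta>) \<le> (2 / \<epsilon>\<^sup>2) powr \<beta> * r powr \<beta>"
      proof -
        \<comment> \<open>Rationalizing: \<open>\<rho> s - s\<close> is the conjugate of
          \<open>\<theta> s\<close>, which bounds \<open>1 / \<theta> s\<close> linearly on the
          negative side.\<close>
        have "\<theta> s * (\<rho> s - s) = \<epsilon>\<^sup>2"
          using \<rho>sq[of s] by (simp add: \<theta>_def algebra_simps power2_eq_square)
        then have "1 / \<theta> s = (\<rho> s - s) / \<epsilon>\<^sup>2"
          using \<theta>pos[of s] assms(1) by (simp add: field_simps)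
        also have "\<dots> \<le> 2 * r / \<epsilon>\<^sup>2"
          using \<rho>r by (intro divide_right_mono) (auto simp: r_def)
        finally have "(1 / \<theta> s) powr \<beta> \<le> (2 / \<epsilon>\<^sup>2 * r) powr \<beta>"
          using \<theta>pos[of s] \<beta> by (intro powr_mono2) auto
        then show ?thesis
          using \<theta>pos[of s] r assms(1) by (simp add: powr_mult powr_divide powr_minus_divide)
      qed
      have "Y s powr (1 - \<nu> / \<beta>) * \<theta> s powr (- \<beta>) = Y s * Y s powr (- \<nu> / \<beta>) * \<theta> s powr (- \<beta>)"
        using Ypos(1)[of s] by (simp add: powr_diff powr_minus_divide)
      also have "\<dots> \<le> Y s * \<epsilon> powr (- \<nu> / \<beta>) * \<theta> s powr (- \<beta>)"
        using gle[of s] Ypos(1)[of s] by (intro mult_right_mono mult_left_mono) (auto simp: g_def)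
      also have "\<dots> = \<epsilon> powr (- \<nu> / \<beta>) * (\<epsilon> * \<theta> s powr (- \<beta>) + 1)"
        using \<theta>pos[of s] by (simp add: Y_def algebra_simps powr_minus)
      also have "\<dots> \<le> \<epsilon> powr (- \<nu> / \<beta>) * (1 * ((2 / \<epsilon>\<^sup>2) powr \<beta> * r powr \<beta>) + r powr \<beta>)"
        using th assms(1,2) r \<beta> by (intro mult_left_mono add_mono mult_mono) (auto simp: ge_one_powr_ge_zero)
      also have "\<dots> = \<epsilon> powr (- \<nu> / \<beta>) * (1 + (2 / \<epsilon>\<^sup>2) powr \<beta>) * r powr \<beta>"
        by (simp add: algebra_simps)
      finally have 1: "Y s powr (1 - \<nu> / \<beta>) * \<theta> s powr (- \<beta>) \<le> \<epsilon> powr (- \<nu> / \<beta>) * (1 + (2 / \<epsilon>\<^sup>2) powr \<beta>) * r powr \<beta>" .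
      have "(g s)\<^sup>2 / (2 * \<bar>g' s\<bar>) \<le> \<epsilon> powr (- \<nu> / \<beta>) * (1 + (2 / \<epsilon>\<^sup>2) powr \<beta>) * r powr \<beta> * r / (2 * \<nu>)"
        unfolding H using 1 \<rho>r \<rho>pos[of s] assms(3)
        by (intro divide_right_mono mult_mono[OF 1]) (auto intro!: mult_nonneg_nonneg add_nonneg_nonneg)
      also have "\<dots> = K * (1 + (2 / \<epsilon>\<^sup>2) powr \<beta>) * r powr (1 + \<beta>)"
        using r by (simp add: K_def powr_add)
      also have "\<dots> \<le> K * (1 + (2 / \<epsilon>\<^sup>2) powr \<beta>) * (2 * 2 powr q * (1 + \<bar>s\<bar> powr q))"
      proof (rule mult_left_mono)
        have "r powr (1 + \<beta>) \<le> r powr q" using r assms(7) by (intro powr_mono) auto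
        also have "\<dots> \<le> (2 * max 1 \<bar>s\<bar>) powr q" using r assms \<beta> by (intro powr_mono2) (auto simp: r_def)
        also have "\<dots> = 2 powr q * max 1 \<bar>s\<bar> powr q" by (simp add: powr_mult)
        also have "\<dots> \<le> 2 powr q * (2 * (1 + \<bar>s\<bar> powr q))"
          by (intro mult_left_mono) (auto simp: max_def)
        finally show "r powr (1 + \<beta>) \<le> 2 * 2 powr q * (1 + \<bar>s\<bar> powr q)" by (simp add: algebra_simps)
      qed (use K in \<open>auto intro!: mult_nonneg_nonneg add_nonneg_nonneg\<close>)
      finally show ?thesis by (simp add: algebra_simps)
    qed
    then show ?thesis by blast
  qed
  then obtain C where C: "\<And>s. (g s)\<^sup>2 / (2 * \<bar>g' s\<bar>) \<le> C * (1 + \<bar>s\<bar> powr q)" by blast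
  have \<theta>ge: "s + \<epsilon> \<le> \<theta> s" "\<theta> s \<le> 2 * (s + \<epsilon>)" "\<rho> s \<le> \<theta> s" "\<epsilon> \<le> \<theta> s" if "0 \<le> s" for s
    using \<rho>eps[of s] \<rho>le[of s] that assms(1) by (auto simp: \<theta>_def)
  have Yle: "Y s \<le> 2 * \<theta> s powr \<beta>" if "0 \<le> s" for s
  proof -
    have "\<epsilon> powr 1 \<le> \<epsilon> powr \<beta>" using assms by (intro powr_mono') auto
    also have "\<dots> \<le> \<theta> s powr \<beta>" using \<theta>ge(4)[OF that] assms(1) \<beta> by (intro powr_mono2) auto
    finally show ?thesis using assms(1) by (simp add: Y_def)
  qed
  have gup: "g s \<le> (s + \<epsilon>) powr (- \<nu>)" if "0 \<le> s" for s
  proof -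
    have "g s \<le> (\<theta> s powr \<beta>) powr (- \<nu> / \<beta>)"
      unfolding g_def using Ypos(3)[of s] \<theta>pos[of s] assms \<beta> by (intro powr_mono2') auto
    also have "\<dots> = \<theta> s powr (- \<nu>)" using \<beta> by (simp add: powr_powr)
    also have "\<dots> \<le> (s + \<epsilon>) powr (- \<nu>)" using \<theta>ge(1)[OF that] that assms by (intro powr_mono2') auto
    finally show ?thesis .
  qed
  have glow: "(s + \<epsilon>) powr (- \<nu>) / 4 \<le> g s" if "0 \<le> s" for s
  proof -
    \<comment> \<open>Two factors 2 are lost below, in
      \<open>Y s \<le> 2 * \<theta> s powr \<beta>\<close> and in
      \<open>\<theta> s \<le> 2 * (s + \<epsilon>)\<close>. They enter with the exponents
      \<open>\<nu> / \<beta>\<close> and \<nu>, both at most 1, so each costs at most 1/2; hence the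
      constant 4.\<close>
    have half: "1/2 \<le> 2 powr (- x)" if "x \<le> 1" for x :: real
      using powr_mono[of "-1" "-x" 2] that by (simp add: powr_minus_divide)
    have "(s + \<epsilon>) powr (- \<nu>) / 4 = 1/2 * (1/2 * (s + \<epsilon>) powr (- \<nu>))" by simp
    also have "\<dots> \<le> 2 powr (- (\<nu> / \<beta>)) * (2 powr (- \<nu>) * (s + \<epsilon>) powr (- \<nu>))"
      using half[of "\<nu> / \<beta>"] half[of \<nu>] assms \<beta> by (intro mult_mono) auto
    also have "\<dots> = 2 powr (- (\<nu> / \<beta>)) * (2 * (s + \<epsilon>)) powr (- \<nu>)"
      using that assms(1) by (subst powr_mult) auto
    also have "\<dots> \<le> 2 powr (- (\<nu> / \<beta>)) * \<theta> s powr (- \<nu>)"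
      using \<theta>ge(2)[OF that] \<theta>pos[of s] assms by (intro mult_left_mono powr_mono2') auto
    also have "\<dots> = (2 * \<theta> s powr \<beta>) powr (- \<nu> / \<beta>)"
      using \<beta> by (simp add: powr_mult powr_powr)
    also have "\<dots> \<le> g s"
      unfolding g_def using Yle[OF that] Ypos(1)[of s] assms \<beta> by (intro powr_mono2') auto
    finally show ?thesis .
  qed
  have Hle: "(g s)\<^sup>2 / (2 * \<bar>g' s\<bar>) \<le> (1 / \<nu>) * (s + \<epsilon>) powr (1 - \<nu>)" if "0 \<le> s" for s
  proof -
    \<comment> \<open>The factor 2 lost here cancels the 2 in the denominator
      \<open>2 * \<nu>\<close>, so that exactly \<open>1 / \<nu>\<close> remains.\<close>
    have "Y s powr (1 - \<nu> / \<beta>) \<le> (2 * \<theta> s powr \<beta>) powr (1 - \<nu> / \<beta>)"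
      using Yle[OF that] Ypos(1)[of s] assms \<beta> by (intro powr_mono2) auto
    also have "\<dots> = 2 powr (1 - \<nu> / \<beta>) * \<theta> s powr (\<beta> - \<nu>)"
    proof -
      have "\<beta> * (1 - \<nu> / \<beta>) = \<beta> - \<nu>" using \<beta> by (simp add: field_simps)
      then show ?thesis by (simp add: powr_mult powr_powr)
    qed
    also have "\<dots> \<le> 2 powr 1 * \<theta> s powr (\<beta> - \<nu>)"
      using assms \<beta> by (intro mult_right_mono powr_mono) auto
    finally have "Y s powr (1 - \<nu> / \<beta>) * \<theta> s powr (- \<beta>) \<le> 2 * \<theta> s powr (\<beta> - \<nu>) * \<theta> s powr (- \<beta>)"
      by (intro mult_right_mono) auto
    also have "\<dots> = 2 * \<theta> s powr (- \<nu>)" by (simp flip: powr_add)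
    also have "\<dots> \<le> 2 * \<rho> s powr (- \<nu>)"
      using \<theta>ge(3)[OF that] \<rho>pos[of s] assms by (intro mult_left_mono powr_mono2') auto
    finally have "(g s)\<^sup>2 / (2 * \<bar>g' s\<bar>) \<le> 2 * \<rho> s powr (- \<nu>) * \<rho> s / (2 * \<nu>)"
      unfolding H using \<rho>pos[of s] assms(3) by (intro divide_right_mono mult_right_mono) auto
    also have "\<dots> = (1 / \<nu>) * \<rho> s powr (1 - \<nu>)"
      using \<rho>pos[of s] by (simp add: powr_diff powr_minus_divide)
    also have "\<dots> \<le> (1 / \<nu>) * (s + \<epsilon>) powr (1 - \<nu>)"
      using \<rho>le[of s] \<rho>pos[of s] that assms by (intro mult_left_mono powr_mono2) auto
    finally show ?thesis .
  qed
  have Gnn: "0 \<le> G s" if "0 \<le> s" for s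
  proof -
    have "G 0 \<le> G s"
      by (rule DERIV_nonneg_imp_nondecreasing[OF that]) (use G(1) gpos less_imp_le in blast)
    then show ?thesis using G(2) by simp
  qed
  have Gle: "G s \<le> 2 * (s + \<epsilon>) powr (1 - \<nu>)" if "0 \<le> s" for s
  proof -
    \<comment> \<open>Comparison with the antiderivative of
      \<open>(s + \<epsilon>) powr (- \<nu>)\<close>; the constant 2 bounds
      \<open>1 / (1 - \<nu>)\<close> for \<open>\<nu> \<le> 1/2\<close>.\<close>
    let ?P = "\<lambda>s. (s + \<epsilon>) powr (1 - \<nu>) / (1 - \<nu>) - G s"
    have "?P 0 \<le> ?P s"
    proof (rule DERIV_nonneg_imp_nondecreasing[OF that])
      fix x assume x: "0 \<le> x" "x \<le> s"
      have "((\<lambda>s. (s + \<epsilon>) powr (1 - \<nu>)) has_real_derivative (1 - \<nu>) * (x + \<epsilon>) powr (1 - \<nu> - 1) * 1) (at x)"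
        by (rule DERIV_fun_powr[unfolded of_nat_1]) (use x assms(1) in \<open>auto intro!: derivative_eq_intros\<close>)
      from DERIV_diff[OF DERIV_cdivide[OF this, of "1 - \<nu>"] G(1)]
      have "(?P has_real_derivative (x + \<epsilon>) powr (- \<nu>) - g x) (at x)"
        using assms by simp
      then show "\<exists>y. (?P has_real_derivative y) (at x) \<and> 0 \<le> y"
        using gup[OF x(1)] by (intro exI[of _ "(x + \<epsilon>) powr (- \<nu>) - g x"]) simp
    qed
    then have "G s \<le> (s + \<epsilon>) powr (1 - \<nu>) / (1 - \<nu>) - \<epsilon> powr (1 - \<nu>) / (1 - \<nu>)" using G(2) by simp
    also have "\<dots> \<le> (s + \<epsilon>) powr (1 - \<nu>) / (1 - \<nu>)" using assms by simp
    also have "\<dots> \<le> (s + \<epsilon>) powr (1 - \<nu>) / (1/2)" using assms by (intro divide_left_mono) auto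
    finally show ?thesis by simp
  qed
  let ?M = "max (\<epsilon> powr (- \<nu> / \<beta>)) (\<nu> * \<epsilon> powr (- \<nu> / \<beta>) / \<epsilon>)"
  show ?thesis
    by (rule that[OF sm dg cg' G gpos _ g'neg _ C Gle Gnn Hle glow, of ?M])
      (use gle g'le in \<open>simp_all add: le_max_iff_disj\<close>)
qed

section \<open>Coefficient forms and localization\<close>

text \<open>Separating the form from the derivatives reduces the pointwise estimates to bilinear
  algebra at a single point of a set of full measure.\<close>

definition coeff_form :: "'n coeffs \<Rightarrow> real \<times> (real ^ 'n) \<Rightarrow> real ^ 'n \<Rightarrow> real ^ 'n \<Rightarrow> real" where
  "coeff_form a p \<xi> \<eta> = (\<Sum>i\<in>UNIV. \<Sum>j\<in>UNIV. a i j p * \<xi> $ i * \<eta> $ j)"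

definition grad :: "(real \<times> (real ^ 'n) \<Rightarrow> real) \<Rightarrow> real \<times> (real ^ 'n) \<Rightarrow> real ^ 'n" where
  "grad f p = (\<chi> i. dx i f p)"

lemma grad_form_eq: "grad_form a f g p = coeff_form a p (grad f p) (grad g p)"
  by (simp add: grad_form_def coeff_form_def grad_def)

lemma coeff_form_add_left: "coeff_form a p (x + y) z = coeff_form a p x z + coeff_form a p y z"
  by (simp add: coeff_form_def algebra_simps sum.distrib)

lemma coeff_form_add_right: "coeff_form a p z (x + y) = coeff_form a p z x + coeff_form a p z y"
  by (simp add: coeff_form_def algebra_simps sum.distrib)

lemma coeff_form_scaleR_left: "coeff_form a p (r *\<^sub>R x) z = r * coeff_form a p x z"
  by (simp add: coeff_form_def sum_distrib_left ac_simps)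

lemma coeff_form_scaleR_right: "coeff_form a p z (r *\<^sub>R x) = r * coeff_form a p z x"
  by (simp add: coeff_form_def sum_distrib_left ac_simps)

lemma coeff_form_minus_left: "coeff_form a p (- x) z = - coeff_form a p x z"
  using coeff_form_scaleR_left[of a p "-1"] by simp

lemma coeff_form_minus_right: "coeff_form a p z (- x) = - coeff_form a p z x"
  using coeff_form_scaleR_right[of a p _ "-1"] by simp

lemma coeff_form_diff_left: "coeff_form a p (x - y) z = coeff_form a p x z - coeff_form a p y z"
  using coeff_form_add_left[of a p x "- y"] by (simp add: coeff_form_minus_left)

lemma coeff_form_diff_right: "coeff_form a p z (x - y) = coeff_form a p z x - coeff_form a p z y"
  using coeff_form_add_right[of a p z x "- y"] by (simp add: coeff_form_minus_right)

lemmas coeff_form_bilinear = coeff_form_diff_left coeff_form_diff_right coeff_form_add_left coeff_form_add_right coeff_form_scaleR_left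
  coeff_form_scaleR_right coeff_form_minus_left coeff_form_minus_right

lemma coeff_form_commute:
  assumes "\<And>i j. a i j p = a j i p"
  shows "coeff_form a p x y = coeff_form a p y x"
  unfolding coeff_form_def
  by (subst sum.swap) (simp add: assms[of _ _] ac_simps cong: sum.cong)

definition psd_at :: "'n coeffs \<Rightarrow> real \<times> (real ^ 'n) \<Rightarrow> bool" where
  "psd_at a p \<longleftrightarrow> (\<forall>i j. a i j p = a j i p) \<and> (\<forall>\<xi>. 0 \<le> coeff_form a p \<xi> \<xi>)"

lemma psd_at_commute: "psd_at a p \<Longrightarrow> coeff_form a p x y = coeff_form a p y x"
  unfolding psd_at_def by (intro coeff_form_commute) auto

lemma psd_at_nonneg: "psd_at a p \<Longrightarrow> 0 \<le> coeff_form a p \<xi> \<xi>"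
  unfolding psd_at_def by auto

lemma psd_at_Cauchy_Schwarz:
  assumes "psd_at a p"
  shows "(coeff_form a p x y)\<^sup>2 \<le> coeff_form a p x x * coeff_form a p y y"
proof -
  define P where "P = coeff_form a p x x"
  define Q where "Q = coeff_form a p x y"
  define R where "R = coeff_form a p y y"
  have R: "0 \<le> R" using psd_at_nonneg[OF assms] by (simp add: R_def)
  have ineq: "0 \<le> P + 2 * t * Q + t\<^sup>2 * R" for t
  proof -
    have "0 \<le> coeff_form a p (x + t *\<^sub>R y) (x + t *\<^sub>R y)"
      by (rule psd_at_nonneg[OF assms])
    also have "\<dots> = P + 2 * t * Q + t\<^sup>2 * R"
      using psd_at_commute[OF assms, of y x]
      by (simp add: coeff_form_bilinear P_def Q_def R_def algebra_simps power2_eq_square)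
    finally show ?thesis .
  qed
  have "Q\<^sup>2 \<le> P * R"
  \<comment> \<open>The form may degenerate, and the quadratic in \<open>t\<close> then loses its
    leading term. In that case the linear coefficient must vanish, as the witness would give the
    value -1. Otherwise \<open>- Q / R\<close> is the minimizer.\<close>
  proof (cases "R = 0")
    case True
    have "Q = 0"
    proof (rule ccontr)
      assume "Q \<noteq> 0"
      then show False using ineq[of "- (P + 1) / (2 * Q)"] True by (simp add: field_simps)
    qed
    then show ?thesis using True by simp
  next
    case False
    then have "0 < R" using R by simp
    then show ?thesis using ineq[of "- Q / R"] by (simp add: power2_eq_square field_simps)
  qed
  then show ?thesis by (simp add: P_def Q_def R_def)
qed

lemma le_half_sum_of_square_le_prod:
  fixes P Q y :: real
  assumes "y\<^sup>2 \<le> P * Q" "0 \<le> P" "0 \<le> Q"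
  shows "y \<le> (P + Q) / 2"
proof (rule power2_le_imp_le)
  have "P * Q \<le> ((P + Q) / 2)\<^sup>2"
    using zero_le_square[of "P - Q"] by (simp add: power2_eq_square algebra_simps)
  then show "y\<^sup>2 \<le> ((P + Q) / 2)\<^sup>2" using assms(1) by simp
qed (use assms in simp)

text \<open>Both the cross term with the gradient \<open>z\<close> of the cutoff and the error from using \<open>v\<close> in place
  of \<open>x\<close> are absorbed by the good term \<open>- \<bar>s'\<bar> * \<zeta> * coeff_form a p x x\<close>.\<close>

lemma coeff_form_absorb:
  assumes "psd_at a p" "s' < 0" "0 \<le> \<zeta>" "0 \<le> b"
    and "(coeff_form a p z x)\<^sup>2 \<le> b * \<zeta> * coeff_form a p x x"
  shows "coeff_form a p ((s' * \<zeta>) *\<^sub>R v + s *\<^sub>R z) x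
    \<le> s\<^sup>2 / (2 * \<bar>s'\<bar>) * b + \<bar>s'\<bar> * \<zeta> / 2 * coeff_form a p (v - x) (v - x)"
proof -
  define d where "d = v - x"
  define X where "X = coeff_form a p x x"
  define D where "D = coeff_form a p d d"
  define m where "m = - s'"
  have m: "0 < m" "\<bar>s'\<bar> = m" "s' = - m" using assms(2) by (auto simp: m_def)
  have X: "0 \<le> X" and D: "0 \<le> D" using psd_at_nonneg[OF assms(1)] by (auto simp: X_def D_def)
  have "0 \<le> coeff_form a p (d + x) (d + x)" using psd_at_nonneg[OF assms(1)] .
  then have dx: "- coeff_form a p d x \<le> (X + D) / 2"
    using psd_at_commute[OF assms(1), of x d] by (simp add: coeff_form_bilinear X_def D_def)
  have "s * coeff_form a p z x \<le> (m * \<zeta> * X + s\<^sup>2 * b / m) / 2"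
  proof (rule le_half_sum_of_square_le_prod)
    have "(s * coeff_form a p z x)\<^sup>2 = s\<^sup>2 * (coeff_form a p z x)\<^sup>2"
      by (simp add: power_mult_distrib)
    also have "\<dots> \<le> s\<^sup>2 * (b * \<zeta> * X)"
      using assms(5) by (intro mult_left_mono) (auto simp: X_def)
    also have "\<dots> = m * \<zeta> * X * (s\<^sup>2 * b / m)" using m by simp
    finally show "(s * coeff_form a p z x)\<^sup>2 \<le> m * \<zeta> * X * (s\<^sup>2 * b / m)" .
  qed (use m X assms in auto)
  moreover have "(m * \<zeta>) * (- coeff_form a p d x) \<le> (m * \<zeta>) * ((X + D) / 2)"
    using dx m assms(3) by (intro mult_left_mono) auto
  moreover have "coeff_form a p ((s' * \<zeta>) *\<^sub>R v + s *\<^sub>R z) x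
      = - (m * \<zeta>) * X + (m * \<zeta>) * (- coeff_form a p d x) + s * coeff_form a p z x"
  proof -
    have "v = x + d" by (simp add: d_def)
    then show ?thesis by (simp add: m(3) coeff_form_bilinear X_def algebra_simps)
  qed
  \<comment> \<open>Each of the two estimates uses exactly half of the good term
    \<open>m * \<zeta> * X\<close>, so nothing of \<open>X\<close> is left.\<close>
  ultimately have "coeff_form a p ((s' * \<zeta>) *\<^sub>R v + s *\<^sub>R z) x
      \<le> - (m * \<zeta>) * X + (m * \<zeta>) * ((X + D) / 2) + (m * \<zeta> * X + s\<^sup>2 * b / m) / 2"
    by linarith
  also have "\<dots> = s\<^sup>2 / (2 * m) * b + m * \<zeta> / 2 * D"
    using m(1) by (simp add: field_simps)
  finally show ?thesis using m by (simp add: D_def d_def)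
qed

section \<open>Derivative rules, gluing by zero, and integration along time lines\<close>

lemma frechet_derivative_mult_real:
  fixes f g :: "'a::real_normed_vector \<Rightarrow> real"
  assumes "f differentiable at p" "g differentiable at p"
  shows "frechet_derivative (\<lambda>x. f x * g x) (at p) b
    = f p * frechet_derivative g (at p) b + frechet_derivative f (at p) b * g p"
proof -
  have "((\<lambda>x. f x * g x) has_derivative
      (\<lambda>h. f p * frechet_derivative g (at p) h + frechet_derivative f (at p) h * g p)) (at p)"
    using assms by (intro has_derivative_mult) (auto simp: frechet_derivative_works)
  from frechet_derivative_at[OF this, symmetric] show ?thesis by simp
qed

lemma frechet_derivative_compose_has_real_derivative:
  fixes g :: "real \<Rightarrow> real" and f :: "'a::real_normed_vector \<Rightarrow> real"
  assumes "f differentiable at p" "(g has_real_derivative g') (at (f p))"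
  shows "frechet_derivative (\<lambda>x. g (f x)) (at p) b = g' * frechet_derivative f (at p) b"
proof -
  have "g differentiable at (f p)"
    using assms(2) by (auto simp: real_differentiable_def)
  then show ?thesis
    using frechet_derivative_compose_real[OF assms(1)] has_real_derivative_frechet[OF assms(2)] by simp
qed

lemma frechet_derivative_diff_real:
  fixes f g :: "'a::real_normed_vector \<Rightarrow> real"
  assumes "f differentiable at p" "g differentiable at p"
  shows "frechet_derivative (\<lambda>x. f x - g x) (at p) b = frechet_derivative f (at p) b - frechet_derivative g (at p) b"
proof -
  have "((\<lambda>x. f x - g x) has_derivative
      (\<lambda>h. frechet_derivative f (at p) h - frechet_derivative g (at p) h)) (at p)"
    using assms by (intro has_derivative_diff) (auto simp: frechet_derivative_works)
  from frechet_derivative_at[OF this, symmetric] show ?thesis by simp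
qed

lemma grad_diff:
  assumes "f differentiable at p" "g differentiable at p"
  shows "grad (\<lambda>x. f x - g x) p = grad f p - grad g p"
  using assms by (simp add: grad_def dx_def frechet_derivative_diff_real vec_eq_iff)

lemma smooth_on_antiderivative:
  fixes G g :: "real \<Rightarrow> real"
  assumes "smooth_on g UNIV" "\<And>x. (G has_real_derivative g x) (at x)"
  shows "smooth_on G UNIV"
proof -
  have d: "G differentiable_on UNIV"
    using assms(2) by (auto simp: differentiable_on_def real_differentiable_def)
  have "(\<lambda>p. frechet_derivative G (at p) 1) = g"
    using has_real_derivative_frechet[OF assms(2)] by auto
  then have "Ck_on (Suc k) G UNIV" for k
    using assms(1) d by (simp add: smooth_on_def)
  then have "Ck_on k G UNIV" for k
    using differentiable_imp_continuous_on[OF d] by (cases k) auto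
  then show ?thesis by (simp add: smooth_on_def)
qed

text \<open>\<Omega> and \<open>- K\<close> are open, cover the space, and the extension is smooth
  on each of them. This turns products of approximants and cutoffs, controlled only on \<Omega>,
  into globally smooth functions.\<close>

lemma smooth_on_glue_zero:
  assumes "open \<Omega>" "smooth_on f \<Omega>" "closed K" "K \<subseteq> \<Omega>" "\<And>p. p \<in> \<Omega> - K \<Longrightarrow> f p = 0"
  shows "smooth_on (\<lambda>p. if p \<in> \<Omega> then f p else 0) UNIV"
proof -
  let ?f = "\<lambda>p. if p \<in> \<Omega> then f p else 0"
  have "smooth_on ?f \<Omega>"
    by (rule smooth_on_cong[OF assms(1) _ assms(2)]) simp
  moreover have "smooth_on ?f (- K)"
    by (rule smooth_on_cong[OF _ _ smooth_on_const[of 0]]) (use assms in auto)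
  moreover have "\<Omega> \<union> - K = UNIV" using assms(4) by auto
  ultimately show ?thesis
    using smooth_on_Un[of \<Omega> "- K" ?f] assms(1,3) by (simp add: open_Compl)
qed

lemma frechet_derivative_zero_open:
  assumes "open S" "p \<in> S" "\<And>x. x \<in> S \<Longrightarrow> f x = 0"
  shows "frechet_derivative f (at p) b = 0"
  using frechet_derivative_cong_open[OF assms(1,2), of f "\<lambda>_. 0"] assms(3)
  by (simp add: frechet_derivative_const)

text \<open>Fubini with the time variable inside, then the fundamental theorem of calculus on every
  line parallel to the time axis. Applied to the zero extension of \<open>G (w k) * \<zeta>\<close>
  it yields the integration by parts in time.\<close>

lemma integral_dt_eq_0:
  fixes F :: "real \<times> (real ^ 'n) \<Rightarrow> real"
  assumes "\<And>p. F differentiable at p" "continuous_on UNIV (dt F)"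
    and "compact K" "\<And>p. p \<notin> K \<Longrightarrow> F p = 0"
  shows "integral\<^sup>L lborel (dt F) = 0"
proof -
  have K0: "dt F p = 0" if "p \<notin> K" for p
    unfolding dt_def
    by (rule frechet_derivative_zero_open[of "- K"])
      (use that assms(3,4) in \<open>auto simp: compact_imp_closed open_Compl\<close>)
  have "integrable lborel (\<lambda>p. indicator K p *\<^sub>R dt F p)"
    by (rule borel_integrable_compact[OF assms(3)]) (rule continuous_on_subset[OF assms(2)], simp)
  moreover have "(\<lambda>p. indicator K p *\<^sub>R dt F p) = dt F"
    by (rule ext) (use K0 in \<open>auto simp: indicator_def\<close>)
  ultimately have int: "integrable (lborel \<Otimes>\<^sub>M lborel) (case_prod (\<lambda>t x. dt F (t, x)))"
    by (simp add: lborel_prod)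
  obtain B where B: "\<And>p. p \<in> K \<Longrightarrow> norm p \<le> B"
    using compact_imp_bounded[OF assms(3)] by (auto simp: bounded_iff)
  \<comment> \<open>For \<open>|t|\<close> at least \<open>c\<close> every time line has left
    \<open>K\<close>, whatever \<open>x\<close> is, so both boundary values vanish.\<close>
  define c where "c = \<bar>B\<bar> + 1"
  have out: "(t, x) \<notin> K" if "c \<le> \<bar>t\<bar>" for t x
    using B[of "(t, x)"] norm_fst_le[of t x] that by (auto simp: c_def)
  have inner: "(\<integral>t. dt F (t, x) \<partial>lborel) = 0" for x
  proof -
    have der: "((\<lambda>t. F (t, x)) has_real_derivative dt F (t, x)) (at t)" for t
    proof -
      have 1: "((\<lambda>t. (t, x)) has_derivative (\<lambda>h. (h, 0))) (at t)"
        by (auto intro!: derivative_eq_intros)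
      have 2: "(F has_derivative frechet_derivative F (at (t, x))) (at (t, x))"
        using assms(1) by (simp add: frechet_derivative_works)
      have "frechet_derivative F (at (t, x)) (h, 0) = h * dt F (t, x)" for h
        using linear_cmul[OF linear_frechet_derivative[OF assms(1)], of "(t, x)" h "(1, 0)"]
        by (simp add: dt_def)
      with has_derivative_compose[OF 1 2] show ?thesis
        by (simp add: has_field_derivative_def mult.commute[of _ "dt F (t, x)"])
    qed
    have cont: "isCont (\<lambda>t. dt F (t, x)) t" for t
      using continuous_on_compose2[OF assms(2), of UNIV "\<lambda>t. (t, x)"]
      by (auto simp: continuous_on_eq_continuous_at intro!: continuous_intros)
    have "(\<integral>t. dt F (t, x) * indicator {- c..c} t \<partial>lborel) = F (c, x) - F (- c, x)"
      by (rule integral_FTC_Icc_real) (use der cont in \<open>auto simp: c_def\<close>)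
    moreover have "F (c, x) = 0" "F (- c, x) = 0"
      using out[of c x] out[of "- c" x] assms(4) by auto
    moreover have "(\<lambda>t. dt F (t, x) * indicator {- c..c} t) = (\<lambda>t. dt F (t, x))"
    proof
      fix t show "dt F (t, x) * indicator {- c..c} t = dt F (t, x)"
        using K0[of "(t, x)"] out[of t x] by (cases "c \<le> \<bar>t\<bar>") (auto simp: indicator_def)
    qed
    ultimately show ?thesis by simp
  qed
  have "integral\<^sup>L lborel (dt F) = integral\<^sup>L (lborel \<Otimes>\<^sub>M lborel) (case_prod (\<lambda>t x. dt F (t, x)))"
    by (simp add: lborel_prod)
  also have "\<dots> = (\<integral>x. (\<integral>t. dt F (t, x) \<partial>lborel) \<partial>lborel)"
    by (rule lborel_pair.integral_snd[OF int, symmetric])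
  finally show ?thesis by (simp add: inner)
qed

section \<open>Bounded cylinders and the exhaustion of the half-space\<close>

definition cylinder :: "real \<Rightarrow> real \<Rightarrow> real \<Rightarrow> (real \<times> (real ^ 'n)) set" where
  "cylinder s t R = {s<..<t} \<times> ball 0 R"

lemma cylinder_domain:
  assumes "0 < s" "s < t" "0 < R"
  shows "open (cylinder s t R :: (real \<times> (real ^ 'n)) set)" "connected (cylinder s t R :: (real \<times> (real ^ 'n)) set)" "(cylinder s t R :: (real \<times> (real ^ 'n)) set) \<noteq> {}"
    "bounded (cylinder s t R :: (real \<times> (real ^ 'n)) set)" "(cylinder s t R :: (real \<times> (real ^ 'n)) set) \<subseteq> half_space" "(cylinder s t R :: (real \<times> (real ^ 'n)) set) \<in> sets lebesgue"
    "emeasure lebesgue (cylinder s t R :: (real \<times> (real ^ 'n)) set) < \<infinity>"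
proof -
  show o: "open (cylinder s t R :: (real \<times> (real ^ 'n)) set)" by (auto simp: cylinder_def intro!: open_Times)
  then show "(cylinder s t R :: (real \<times> (real ^ 'n)) set) \<in> sets lebesgue" by (intro sets_completionI_sets) simp
  show "connected (cylinder s t R :: (real \<times> (real ^ 'n)) set)"
    by (auto simp: cylinder_def intro!: connected_Times convex_connected)
  show "(cylinder s t R :: (real \<times> (real ^ 'n)) set) \<noteq> {}" using assms dense[of s t] by (auto simp: cylinder_def)
  show b: "bounded (cylinder s t R :: (real \<times> (real ^ 'n)) set)" by (auto simp: cylinder_def intro!: bounded_Times)
  show "(cylinder s t R :: (real \<times> (real ^ 'n)) set) \<subseteq> half_space" using assms by (auto simp: cylinder_def half_space_def)
  show "emeasure lebesgue (cylinder s t R :: (real \<times> (real ^ 'n)) set) < \<infinity>"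
    using emeasure_bounded_finite[OF b] by (simp add: o)
qed

text \<open>The upper time end is \<open>j + 2\<close> and not \<open>j + 1\<close>: for
  \<open>j = 0\<close> the lower end is 1, and \<open>cylinder_domain\<close> needs a non-degenerate
  time interval.\<close>

lemma half_space_exhaustion: "half_space = (\<Union>j::nat. cylinder (1 / (real j + 1)) (real j + 2) (real j + 1))"
proof (intro equalityI subsetI)
  fix p :: "real \<times> (real ^ 'n)" assume "p \<in> half_space"
  then obtain t x where p: "p = (t, x)" "0 < t" by (cases p) (auto simp: half_space_def)
  obtain j :: nat where j: "max (1 / t) (max t (norm x)) < real j" using reals_Archimedean2 by blast
  have "1 / t < real j + 1" using j by simp
  then have "1 / (real j + 1) < t" using p(2) by (simp add: field_simps)
  then have "p \<in> cylinder (1 / (real j + 1)) (real j + 2) (real j + 1)"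
    using j p by (auto simp: cylinder_def)
  then show "p \<in> (\<Union>j::nat. cylinder (1 / (real j + 1)) (real j + 2) (real j + 1))" by blast
qed (auto simp: cylinder_def half_space_def intro: less_trans[of 0 "1 / (real _ + 1)"])

lemma half_space_sets:
  "open (half_space :: (real \<times> (real ^ 'n)) set)" "(half_space :: (real \<times> (real ^ 'n)) set) \<in> sets lebesgue"
proof -
  show o: "open (half_space :: (real \<times> (real ^ 'n)) set)"
    unfolding half_space_def by (auto intro!: open_Times)
  then show "(half_space :: (real \<times> (real ^ 'n)) set) \<in> sets lebesgue"
    by (intro sets_completionI_sets) simp
qed

lemma W_loc_element_cylinder:
  assumes "W_loc_element a q u ut E" "0 < s" "s < t" "0 < R"
  shows "W_element a q (cylinder s t R) u ut E"
  using assms cylinder_domain[OF assms(2-4)] unfolding W_loc_element_def by blast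

lemma measurable_half_space_exhaustion:
  assumes "\<And>s t R. 0 < s \<Longrightarrow> s < t \<Longrightarrow> 0 < R \<Longrightarrow> f \<in> borel_measurable (lebesgue_on (cylinder s t R))"
  shows "f \<in> borel_measurable (lebesgue_on (half_space :: (real \<times> (real ^ 'n)) set))"
proof (rule measurable_piecewise_restrict)
  let ?\<Omega> = "\<lambda>j::nat. cylinder (1 / (real j + 1)) (real j + 2) (real j + 1) :: (real \<times> (real ^ 'n)) set"
  have c: "0 < 1 / (real j + 1)" "1 / (real j + 1) < real j + 2" "0 < real j + 1" for j
    by (auto simp: field_simps) (smt (verit) mult_nonneg_nonneg of_nat_0_le_iff)
  note D = cylinder_domain[OF c, where 'n='n]
  show "countable (range ?\<Omega>)" by simp
  show "space (lebesgue_on half_space) \<subseteq> \<Union> (range ?\<Omega>)"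
    using half_space_exhaustion by auto
  fix \<Omega> assume "\<Omega> \<in> range ?\<Omega>"
  then obtain j where j: "\<Omega> = ?\<Omega> j" by auto
  have s: "\<Omega> \<subseteq> half_space" "\<Omega> \<in> sets lebesgue" using D j by auto
  show "\<Omega> \<inter> space (lebesgue_on half_space) \<in> sets (lebesgue_on half_space)"
    using s by (auto simp: sets_restrict_space intro!: image_eqI[of _ _ \<Omega>])
  have "restrict_space (lebesgue_on half_space) \<Omega> = lebesgue_on (?\<Omega> j)"
    using s half_space_sets(2) by (subst restrict_restrict_space) (auto simp: Int_absorb1 j)
  then show "f \<in> borel_measurable (restrict_space (lebesgue_on half_space) \<Omega>)"
    using assms[OF c] by simp
qed

lemma AE_half_space_exhaustion:
  assumes "\<And>s t R. 0 < s \<Longrightarrow> s < t \<Longrightarrow> 0 < R \<Longrightarrow> AE p in lebesgue_on (cylinder s t R). P p"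
  shows "AE p in lebesgue_on (half_space :: (real \<times> (real ^ 'n)) set). P p"
proof -
  let ?\<Omega> = "\<lambda>j::nat. cylinder (1 / (real j + 1)) (real j + 2) (real j + 1) :: (real \<times> (real ^ 'n)) set"
  have c: "0 < 1 / (real j + 1)" "1 / (real j + 1) < real j + 2" "0 < real j + 1" for j
    by (auto simp: field_simps) (smt (verit) mult_nonneg_nonneg of_nat_0_le_iff)
  have "AE p in lebesgue. p \<in> ?\<Omega> j \<longrightarrow> P p" for j
    using assms[OF c] cylinder_domain(6)[OF c] by (subst (asm) AE_restrict_space_iff) auto
  then have "AE p in lebesgue. \<forall>j. p \<in> ?\<Omega> j \<longrightarrow> P p"
    by (subst AE_all_countable) blast
  then have "AE p in lebesgue. p \<in> half_space \<longrightarrow> P p"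
    unfolding half_space_exhaustion by eventually_elim auto
  then show ?thesis using half_space_sets(2) by (subst AE_restrict_space_iff) auto
qed

lemma W_loc_element_measurable:
  assumes "W_loc_element a q u ut E"
  shows "ut \<in> borel_measurable (lebesgue_on half_space)"
    and "test_function \<phi> \<Longrightarrow> E \<phi> \<in> borel_measurable (lebesgue_on half_space)"
  using W_loc_element_cylinder[OF assms]
  by (auto intro!: measurable_half_space_exhaustion simp: W_element_def Lp_tendsto_def in_Lp_def)

text \<open>\<open>E \<phi>\<close> is only an L1 limit on bounded domains, so its support cannot be
  read off. Off \<open>K\<close> the approximating forms vanish; hence the mass of
  \<open>E \<phi>\<close> there is at most its L1 distance to them, which tends to 0. This localizes
  the integral over the half-space in the weak inequality to one cylinder.\<close>

lemma W_loc_element_form_support: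
  fixes \<phi> :: "real \<times> (real ^ 'n) \<Rightarrow> real"
  assumes "W_loc_element a q u ut E" "test_function \<phi>" "closed K"
    and "\<And>p. p \<in> half_space - K \<Longrightarrow> \<phi> p = 0"
  shows "AE p in lebesgue_on half_space. p \<notin> K \<longrightarrow> E \<phi> p = 0"
proof (rule AE_half_space_exhaustion)
  fix s t R :: real assume str: "0 < s" "s < t" "0 < R"
  define \<Omega> :: "(real \<times> (real ^ 'n)) set" where "\<Omega> = cylinder s t R"
  note D = cylinder_domain[OF str, where 'n='n, folded \<Omega>_def]
  obtain w where w: "Lp_tendsto 1 \<Omega> (\<lambda>k. grad_form a \<phi> (w k)) (E \<phi>)"
    using W_loc_element_cylinder[OF assms(1) str] assms(2) by (auto simp: W_element_def \<Omega>_def)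
  let ?M = "lebesgue_on \<Omega>"
  have iE: "integrable ?M (E \<phi>)" and iw: "integrable ?M (grad_form a \<phi> (w k))" for k
    using w by (auto simp: Lp_tendsto_def in_Lp_def intro: integrable_abs_cancel)
  have lim: "(\<lambda>k. \<integral>p. \<bar>grad_form a \<phi> (w k) p - E \<phi> p\<bar> \<partial>?M) \<longlonglongrightarrow> 0"
    using w by (simp add: Lp_tendsto_def)
  have z: "grad_form a \<phi> f p = 0" if "p \<in> half_space - K" for p f
  proof -
    have "dx i \<phi> p = 0" for i
      unfolding dx_def
      by (rule frechet_derivative_zero_open[of "half_space - K"])
        (use that assms(3,4) half_space_sets(1) in \<open>auto intro: open_Diff\<close>)
    then show ?thesis by (simp add: grad_form_def)
  qed
  have mK: "- K \<in> sets lebesgue" using assms(3) by (simp add: borel_closed Compl_in_sets_lebesgue)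
  have meas: "(\<lambda>p. indicator (- K) p * \<bar>E \<phi> p\<bar>) \<in> borel_measurable ?M"
    using iE by (intro borel_measurable_times borel_measurable_abs borel_measurable_integrable
      measurable_restrict_space1[OF borel_measurable_indicator[OF mK]])
  have int: "integrable ?M (\<lambda>p. indicator (- K) p * \<bar>E \<phi> p\<bar>)"
    by (rule Bochner_Integration.integrable_bound[OF iE meas]) (auto simp: indicator_def)
  have le: "(\<integral>p. indicator (- K) p * \<bar>E \<phi> p\<bar> \<partial>?M) \<le> (\<integral>p. \<bar>grad_form a \<phi> (w k) p - E \<phi> p\<bar> \<partial>?M)" for k
  proof (rule integral_mono[OF int])
    show "integrable ?M (\<lambda>p. \<bar>grad_form a \<phi> (w k) p - E \<phi> p\<bar>)" using iE iw by simp
    fix p assume "p \<in> space ?M"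
    then have "p \<in> half_space" using D(5) by auto
    then show "indicator (- K) p * \<bar>E \<phi> p\<bar> \<le> \<bar>grad_form a \<phi> (w k) p - E \<phi> p\<bar>"
      using z[of p "w k"] by (auto simp: indicator_def)
  qed
  have "(\<integral>p. indicator (- K) p * \<bar>E \<phi> p\<bar> \<partial>?M) \<le> 0"
    by (rule LIMSEQ_le_const[OF lim]) (use le in blast)
  then have "(\<integral>p. indicator (- K) p * \<bar>E \<phi> p\<bar> \<partial>?M) = 0"
    by (intro antisym integral_nonneg_AE) auto
  then have "AE p in ?M. indicator (- K) p * \<bar>E \<phi> p\<bar> = 0"
    by (subst (asm) integral_nonneg_eq_0_iff_AE[OF int]) auto
  then show "AE p in lebesgue_on (cylinder s t R). p \<notin> K \<longrightarrow> E \<phi> p = 0"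
    unfolding \<Omega>_def by eventually_elim (auto simp: indicator_def)
qed

text \<open>The majorant \<open>h + \<delta> k\<close> moves with \<open>k\<close>. Dominated
  convergence is therefore applied to \<open>min (f k) h\<close>, and the excess over it is at most
  \<open>\<delta> k\<close>, whose integral tends to 0. It serves for functions of
  \<open>w k\<close> growing like the power \<open>q\<close>, with \<open>\<delta> k\<close> a
  multiple of \<open>|w k - u| powr q\<close>.\<close>

lemma eventually_integral_le_limit:
  fixes f :: "nat \<Rightarrow> 'a \<Rightarrow> real"
  assumes f: "\<And>k. f k \<in> borel_measurable M" "f0 \<in> borel_measurable M"
    and h: "integrable M h" and \<delta>: "\<And>k. integrable M (\<delta> k)" "(\<lambda>k. integral\<^sup>L M (\<delta> k)) \<longlonglongrightarrow> 0"
      "AE x in M. (\<lambda>k. \<delta> k x) \<longlonglongrightarrow> 0" "\<And>k. AE x in M. 0 \<le> \<delta> k x"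
    and nn: "\<And>k. AE x in M. 0 \<le> f k x" and le: "\<And>k. AE x in M. f k x \<le> h x + \<delta> k x"
    and lim: "AE x in M. (\<lambda>k. f k x) \<longlonglongrightarrow> f0 x" and e: "0 < e"
  shows "eventually (\<lambda>k. integral\<^sup>L M (f k) \<le> integral\<^sup>L M f0 + e) sequentially"
proof -
  have nn0: "AE x in M. \<forall>k. 0 \<le> f k x \<and> f k x \<le> h x + \<delta> k x \<and> 0 \<le> \<delta> k x"
    using nn le \<delta>(4) by (simp add: AE_all_countable)
  have h0: "AE x in M. f0 x \<le> h x \<and> 0 \<le> f0 x"
    using nn0 lim \<delta>(3)
  proof eventually_elim
    case (elim x)
    have "(\<lambda>k. h x + \<delta> k x) \<longlonglongrightarrow> h x + 0" using elim by (intro tendsto_intros) auto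
    then have "f0 x \<le> h x + 0"
      by (rule LIMSEQ_le[OF elim(2)]) (use elim(1) in auto)
    moreover have "0 \<le> f0 x" by (rule LIMSEQ_le_const[OF elim(2)]) (use elim(1) in auto)
    ultimately show ?case by simp
  qed
  have hm: "h \<in> borel_measurable M" using h by auto
  let ?m = "\<lambda>k x. min (f k x) (h x)"
  have bm: "AE x in M. norm (?m k x) \<le> h x" for k
    using nn0 h0 by eventually_elim auto
  have limm: "AE x in M. (\<lambda>k. ?m k x) \<longlonglongrightarrow> f0 x"
    using lim h0
  proof eventually_elim
    case (elim x)
    have "(\<lambda>k. ?m k x) \<longlonglongrightarrow> min (f0 x) (h x)" using elim(1) by (intro tendsto_intros)
    then show ?case using elim(2) by (simp add: min_def)
  qed
  have im: "integrable M (?m k)" for k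
  proof (rule Bochner_Integration.integrable_bound[OF h])
    show "?m k \<in> borel_measurable M" using f(1) hm by (intro borel_measurable_min)
    show "AE x in M. norm (?m k x) \<le> norm (h x)" using bm[of k] by eventually_elim auto
  qed
  have conv: "(\<lambda>k. integral\<^sup>L M (?m k)) \<longlonglongrightarrow> integral\<^sup>L M f0"
    by (rule integral_dominated_convergence[OF f(2) _ h limm bm]) (use f hm in auto)
  have ifk: "integrable M (f k)" for k
    by (rule Bochner_Integration.integrable_bound[OF Bochner_Integration.integrable_add[OF h \<delta>(1)[of k]] f(1)])
      (use nn0 in eventually_elim, smt (verit) real_norm_def)
  have "integral\<^sup>L M (f k) \<le> integral\<^sup>L M (?m k) + integral\<^sup>L M (\<delta> k)" for k
  proof -
    have "integral\<^sup>L M (f k) \<le> (\<integral>x. ?m k x + \<delta> k x \<partial>M)"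
    proof (rule integral_mono_AE)
      show "integrable M (\<lambda>x. ?m k x + \<delta> k x)" using im \<delta>(1) by simp
      show "AE x in M. f k x \<le> ?m k x + \<delta> k x"
        using nn0 by eventually_elim (smt (verit) min_def)
    qed (rule ifk)
    then show ?thesis using im \<delta>(1) by simp
  qed
  moreover have "(\<lambda>k. integral\<^sup>L M (?m k) + integral\<^sup>L M (\<delta> k)) \<longlonglongrightarrow> integral\<^sup>L M f0 + 0"
    using conv \<delta>(2) by (intro tendsto_add)
  then have "eventually (\<lambda>k. integral\<^sup>L M (?m k) + integral\<^sup>L M (\<delta> k) < integral\<^sup>L M f0 + e) sequentially"
    using e by (intro order_tendstoD) auto
  ultimately show ?thesis
    by (auto elim!: eventually_mono intro: order_trans less_imp_le)
qed

lemma abs_diff_powr_le: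
  fixes x y r :: real
  assumes "0 < r"
  shows "\<bar>x - y\<bar> powr r \<le> 2 powr r * (\<bar>x\<bar> powr r + \<bar>y\<bar> powr r)"
proof -
  have "\<bar>x - y\<bar> powr r \<le> (2 * max \<bar>x\<bar> \<bar>y\<bar>) powr r"
    using assms by (intro powr_mono2) auto
  also have "\<dots> = 2 powr r * max \<bar>x\<bar> \<bar>y\<bar> powr r" by (simp add: powr_mult)
  also have "\<dots> \<le> 2 powr r * (\<bar>x\<bar> powr r + \<bar>y\<bar> powr r)"
    by (intro mult_left_mono) (auto simp: max_def)
  finally show ?thesis .
qed

lemma in_Lp_diff:
  assumes "0 < r" "in_Lp r \<Omega> f" "in_Lp r \<Omega> g"
  shows "integrable (lebesgue_on \<Omega>) (\<lambda>p. \<bar>f p - g p\<bar> powr r)"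
proof (rule Bochner_Integration.integrable_bound)
  show "integrable (lebesgue_on \<Omega>) (\<lambda>p. 2 powr r * (\<bar>f p\<bar> powr r + \<bar>g p\<bar> powr r))"
    using assms(2,3) by (auto simp: in_Lp_def)
  have m: "f \<in> borel_measurable (lebesgue_on \<Omega>)" "g \<in> borel_measurable (lebesgue_on \<Omega>)"
    using assms(2,3) by (auto simp: in_Lp_def)
  show "(\<lambda>p. \<bar>f p - g p\<bar> powr r) \<in> borel_measurable (lebesgue_on \<Omega>)"
    using m by (intro powr_real_measurable borel_measurable_abs borel_measurable_diff) auto
  show "AE p in lebesgue_on \<Omega>. norm (\<bar>f p - g p\<bar> powr r) \<le> norm (2 powr r * (\<bar>f p\<bar> powr r + \<bar>g p\<bar> powr r))"
    using abs_diff_powr_le[OF assms(1)] by (intro AE_I2) (simp add: abs_mult)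
qed

lemma Lp_tendsto_1_integral:
  assumes "Lp_tendsto 1 \<Omega> f g"
  shows "\<And>k. integrable (lebesgue_on \<Omega>) (f k)" "integrable (lebesgue_on \<Omega>) g"
    "(\<lambda>k. \<integral>p. \<bar>f k p - g p\<bar> \<partial>lebesgue_on \<Omega>) \<longlonglongrightarrow> 0"
    "(\<lambda>k. integral\<^sup>L (lebesgue_on \<Omega>) (f k)) \<longlonglongrightarrow> integral\<^sup>L (lebesgue_on \<Omega>) g"
proof -
  show i: "\<And>k. integrable (lebesgue_on \<Omega>) (f k)" "integrable (lebesgue_on \<Omega>) g"
    using assms by (auto simp: Lp_tendsto_def in_Lp_def intro: integrable_abs_cancel)
  show l: "(\<lambda>k. \<integral>p. \<bar>f k p - g p\<bar> \<partial>lebesgue_on \<Omega>) \<longlonglongrightarrow> 0"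
    using assms by (simp add: Lp_tendsto_def)
  have "(\<lambda>k. integral\<^sup>L (lebesgue_on \<Omega>) (f k) - integral\<^sup>L (lebesgue_on \<Omega>) g) \<longlonglongrightarrow> 0"
  proof (rule Lim_null_comparison[OF always_eventually l], rule allI)
    fix k
    have "integral\<^sup>L (lebesgue_on \<Omega>) (f k) - integral\<^sup>L (lebesgue_on \<Omega>) g = (\<integral>p. f k p - g p \<partial>lebesgue_on \<Omega>)"
      using i by simp
    then show "norm (integral\<^sup>L (lebesgue_on \<Omega>) (f k) - integral\<^sup>L (lebesgue_on \<Omega>) g) \<le> (\<integral>p. \<bar>f k p - g p\<bar> \<partial>lebesgue_on \<Omega>)"
      using integral_norm_bound[of "lebesgue_on \<Omega>" "\<lambda>p. f k p - g p"] by simp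
  qed
  then show "(\<lambda>k. integral\<^sup>L (lebesgue_on \<Omega>) (f k)) \<longlonglongrightarrow> integral\<^sup>L (lebesgue_on \<Omega>) g"
    by (simp add: LIM_zero_iff)
qed

lemma Lp_tendsto_subseq:
  assumes "Lp_tendsto r \<Omega> f g" "strict_mono s"
  shows "Lp_tendsto r \<Omega> (\<lambda>k. f (s k)) g"
  using assms LIMSEQ_subseq_LIMSEQ[OF _ assms(2)] by (auto simp: Lp_tendsto_def o_def)

lemma tendsto_abs_powr_zero:
  fixes x :: "nat \<Rightarrow> real"
  assumes "0 < r" "(\<lambda>k. \<bar>x k - y\<bar> powr r) \<longlonglongrightarrow> 0"
  shows "x \<longlonglongrightarrow> y"
proof -
  have "(\<lambda>k. (\<bar>x k - y\<bar> powr r) powr (1 / r)) \<longlonglongrightarrow> 0 powr (1 / r)"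
    by (rule tendsto_powr'[OF assms(2) tendsto_const]) (use assms(1) in auto)
  then have "(\<lambda>k. \<bar>x k - y\<bar>) \<longlonglongrightarrow> 0"
    using assms(1) by (simp add: powr_powr)
  then show ?thesis by (simp add: tendsto_rabs_zero_iff LIM_zero_iff)
qed

text \<open>Nonlinear expressions such as \<open>g (w k)\<close> pass to the limit through
  convergence almost everywhere, obtained along a subsequence \<open>r\<close>. The other limits
  survive the extraction, and so does the Cauchy property because
  \<open>k \<le> r k\<close>.\<close>

lemma W_element_AE_sequence:
  assumes "W_element a q \<Omega> u ut E" "1 < q"
  obtains w where "\<And>k. w k \<in> W_smooth a q \<Omega>"
    "\<And>e. 0 < e \<Longrightarrow> \<exists>N. \<forall>k\<ge>N. \<forall>l\<ge>N. W_norm a q \<Omega> (\<lambda>p. w k p - w l p) < e"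
    "Lp_tendsto q \<Omega> w u" "Lp_tendsto 1 \<Omega> (\<lambda>k. dt (w k)) ut"
    "\<And>\<phi>. test_function \<phi> \<Longrightarrow> Lp_tendsto 1 \<Omega> (\<lambda>k. grad_form a \<phi> (w k)) (E \<phi>)"
    "AE p in lebesgue_on \<Omega>. (\<lambda>k. w k p) \<longlonglongrightarrow> u p"
proof -
  have qh: "qhat q = q" using assms(2) by (simp add: qhat_def)
  obtain w where w: "W_Cauchy a q \<Omega> w" "Lp_tendsto q \<Omega> w u" "Lp_tendsto 1 \<Omega> (\<lambda>k. dt (w k)) ut"
    "\<And>\<phi>. test_function \<phi> \<Longrightarrow> Lp_tendsto 1 \<Omega> (\<lambda>k. grad_form a \<phi> (w k)) (E \<phi>)"
    using assms(1) by (auto simp: W_element_def qh)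
  have "\<exists>r::nat\<Rightarrow>nat. strict_mono r \<and> (AE p in lebesgue_on \<Omega>. (\<lambda>k. \<bar>w (r k) p - u p\<bar> powr q) \<longlonglongrightarrow> 0)"
    by (rule tendsto_L1_AE_subseq) (use w(2) assms(2) in \<open>auto simp: Lp_tendsto_def intro: in_Lp_diff\<close>)
  then obtain r :: "nat \<Rightarrow> nat" where r: "strict_mono r"
    "AE p in lebesgue_on \<Omega>. (\<lambda>k. \<bar>w (r k) p - u p\<bar> powr q) \<longlonglongrightarrow> 0" by blast
  have ge: "k \<le> r k" for k using r(1) by (rule seq_suble)
  show ?thesis
  proof (rule that[of "\<lambda>k. w (r k)"])
    show "w (r k) \<in> W_smooth a q \<Omega>" for k using w(1) by (auto simp: W_Cauchy_def)
    show "\<exists>N. \<forall>k\<ge>N. \<forall>l\<ge>N. W_norm a q \<Omega> (\<lambda>p. w (r k) p - w (r l) p) < e" if "0 < e" for e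
    proof -
      obtain N where "\<forall>k\<ge>N. \<forall>l\<ge>N. W_norm a q \<Omega> (\<lambda>p. w k p - w l p) < e"
        using w(1) \<open>0 < e\<close> unfolding W_Cauchy_def by blast
      then show ?thesis using ge order_trans[OF _ ge] by (intro exI[of _ N]) simp
    qed
    show "AE p in lebesgue_on \<Omega>. (\<lambda>k. w (r k) p) \<longlonglongrightarrow> u p"
      using r(2)
    proof eventually_elim
      case (elim p)
      show ?case by (rule tendsto_abs_powr_zero[OF _ elim]) (use assms(2) in simp)
    qed
    show "Lp_tendsto q \<Omega> (\<lambda>k. w (r k)) u" using Lp_tendsto_subseq[OF w(2) r(1)] .
    show "Lp_tendsto 1 \<Omega> (\<lambda>k. dt (w (r k))) ut" using Lp_tendsto_subseq[OF w(3) r(1)] .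
    show "Lp_tendsto 1 \<Omega> (\<lambda>k. grad_form a \<phi> (w (r k))) (E \<phi>)" if "test_function \<phi>" for \<phi>
      using Lp_tendsto_subseq[OF w(4)[OF that] r(1)] .
  qed
qed

lemma cylinder_subset_compact:
  assumes "0 < s"
  shows "compact ({s..t} \<times> cball 0 R :: (real \<times> (real ^ 'n)) set)" "({s..t} \<times> cball 0 R :: (real \<times> (real ^ 'n)) set) \<subseteq> (half_space :: (real \<times> (real ^ 'n)) set)"
    "(cylinder s t R :: (real \<times> (real ^ 'n)) set) \<subseteq> {s..t} \<times> cball 0 R"
  using assms by (auto simp: cylinder_def half_space_def intro!: compact_Times compact_cball)

lemma continuous_on_half_space_bounded:
  fixes f :: "real \<times> (real ^ 'n) \<Rightarrow> real"
  assumes "continuous_on half_space f" "0 < s"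
  obtains Z where "0 < Z" "\<And>p. p \<in> cylinder s t R \<Longrightarrow> \<bar>f p\<bar> \<le> Z"
proof -
  have "compact (f ` ({s..t} \<times> cball 0 R))"
    by (rule compact_continuous_image[OF continuous_on_subset[OF assms(1)]])
      (use cylinder_subset_compact[OF assms(2), where 'n='n] in auto)
  then obtain Z where "0 < Z" "\<forall>y\<in>f ` ({s..t} \<times> cball 0 R). norm y \<le> Z"
    by (auto dest!: compact_imp_bounded simp: bounded_pos)
  then show ?thesis using cylinder_subset_compact(3)[OF assms(2), where 'n='n, of t R] by (intro that[of Z]) auto
qed

lemma locally_bounded_on_cylinder:
  fixes f :: "real \<times> (real ^ 'n) \<Rightarrow> real"
  assumes "locally_bounded_on half_space f" "0 < s"
  obtains Z where "0 < Z" "\<And>p. p \<in> cylinder s t R \<Longrightarrow> \<bar>f p\<bar> \<le> Z"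
proof -
  have "bounded (f ` ({s..t} \<times> cball 0 R))"
    using assms(1)[unfolded locally_bounded_on_def, rule_format]
      cylinder_subset_compact(1,2)[OF assms(2), where 'n='n] by simp
  then obtain Z where "0 < Z" "\<forall>y\<in>f ` ({s..t} \<times> cball 0 R). norm y \<le> Z"
    by (auto simp: bounded_pos)
  then show ?thesis using cylinder_subset_compact(3)[OF assms(2), where 'n='n, of t R] by (intro that[of Z]) auto
qed

lemma integrable_mult_bounded:
  fixes f h :: "'a \<Rightarrow> real"
  assumes "integrable M f" "h \<in> borel_measurable M" "\<And>x. x \<in> space M \<Longrightarrow> \<bar>h x\<bar> \<le> C"
  shows "integrable M (\<lambda>x. f x * h x)"
proof (rule Bochner_Integration.integrable_bound)
  show "integrable M (\<lambda>x. C * f x)" using assms(1) by simp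
  show "(\<lambda>x. f x * h x) \<in> borel_measurable M" using assms by auto
  show "AE x in M. norm (f x * h x) \<le> norm (C * f x)"
  proof (rule AE_I2)
    fix x assume "x \<in> space M"
    then have "\<bar>h x\<bar> \<le> \<bar>C\<bar>" using assms(3) by fastforce
    then show "norm (f x * h x) \<le> norm (C * f x)"
      using mult_right_mono[of "\<bar>h x\<bar>" "\<bar>C\<bar>" "\<bar>f x\<bar>"] by (simp add: abs_mult mult.commute)
  qed
qed

lemma finite_measure_cylinder:
  assumes "0 < s" "s < t" "0 < R"
  shows "finite_measure (lebesgue_on (cylinder s t R :: (real \<times> (real ^ 'n)) set))"
proof (rule finite_measureI)
  show "emeasure (lebesgue_on (cylinder s t R)) (space (lebesgue_on (cylinder s t R :: (real \<times> (real ^ 'n)) set))) \<noteq> \<infinity>"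
    using cylinder_domain(6,7)[OF assms, where 'n='n] by (subst emeasure_restrict_space) auto
qed

lemma restrict_half_space:
  assumes "\<Omega> \<subseteq> half_space" "\<Omega> \<in> sets lebesgue"
  shows "restrict_space (lebesgue_on half_space) \<Omega> = lebesgue_on \<Omega>"
  using assms half_space_sets(2) by (subst restrict_restrict_space) (auto simp: Int_absorb1)

lemma measurable_half_space_subset:
  assumes "f \<in> borel_measurable (lebesgue_on half_space)" "\<Omega> \<subseteq> half_space" "\<Omega> \<in> sets lebesgue"
  shows "f \<in> borel_measurable (lebesgue_on \<Omega>)"
  using measurable_restrict_space1[OF assms(1), of \<Omega>] restrict_half_space[OF assms(2,3)] by simp

lemma AE_half_space_subset:
  assumes "AE p in lebesgue_on half_space. P p" "\<Omega> \<subseteq> half_space" "\<Omega> \<in> sets lebesgue"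
  shows "AE p in lebesgue_on \<Omega>. P p"
proof -
  have "AE p in lebesgue. p \<in> half_space \<longrightarrow> P p"
    using assms(1) half_space_sets(2) by (subst (asm) AE_restrict_space_iff) auto
  then have "AE p in lebesgue. p \<in> \<Omega> \<longrightarrow> P p"
    by eventually_elim (use assms(2) in auto)
  then show ?thesis using assms(3) by (subst AE_restrict_space_iff) auto
qed

lemma coeff_form_diff_le:
  assumes "psd_at a p"
  shows "coeff_form a p (x - y) (x - y) \<le> 2 * coeff_form a p x x + 2 * coeff_form a p y y"
  using psd_at_nonneg[OF assms, of "x + y"] by (simp add: coeff_form_bilinear)

lemma dx_eq_Basis: "dx i f = (\<lambda>p. frechet_derivative f (at p) (0, axis i 1))" "(0, axis i (1::real)) \<in> Basis"
  by (auto simp: dx_def[abs_def] Basis_prod_def axis_in_Basis_iff)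

lemma dt_eq_Basis: "dt f = (\<lambda>p. frechet_derivative f (at p) (1, 0))" "((1::real), 0) \<in> Basis"
  by (auto simp: dt_def[abs_def] Basis_prod_def)

lemma smooth_on_dx: "smooth_on f S \<Longrightarrow> smooth_on (dx i f) S"
  unfolding dx_eq_Basis(1) by (rule smooth_on_frechet_derivative[OF _ dx_eq_Basis(2)])

lemma smooth_on_dt: "smooth_on f S \<Longrightarrow> smooth_on (dt f) S"
  unfolding dt_eq_Basis(1) by (rule smooth_on_frechet_derivative[OF _ dt_eq_Basis(2)])

lemma grad_form_measurable:
  assumes "\<And>i j. a i j \<in> borel_measurable (lebesgue_on half_space)"
    and "open \<Omega>" "\<Omega> \<subseteq> half_space" "smooth_on f \<Omega>" "smooth_on g \<Omega>"
  shows "grad_form a f g \<in> borel_measurable (lebesgue_on \<Omega>)"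
proof -
  have s: "\<Omega> \<in> sets lebesgue" using assms(2) by (intro sets_completionI_sets) simp
  have "dx i f \<in> borel_measurable (lebesgue_on \<Omega>)" "dx i g \<in> borel_measurable (lebesgue_on \<Omega>)" for i
    using assms(4,5) s smooth_on_dx smooth_on_imp_continuous_on continuous_imp_measurable_on_sets_lebesgue by blast+
  moreover have "a i j \<in> borel_measurable (lebesgue_on \<Omega>)" for i j
    using measurable_half_space_subset[OF assms(1) assms(3) s] .
  ultimately show ?thesis unfolding grad_form_def[abs_def]
    by (intro borel_measurable_sum borel_measurable_times)
qed

text \<open>Integrability for the difference follows from that for \<open>v\<close> and
  \<open>w\<close> by the bound \<open>coeff_form_diff_le\<close>. Non-negativity allows the power
  \<open>1/2\<close> in \<open>W_norm\<close> to be read as a square root, so that the norm alone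
  controls the energy.\<close>

lemma W_norm_Cauchy_form:
  assumes a: "\<And>i j. a i j \<in> borel_measurable (lebesgue_on half_space)"
    and psd: "AE p in lebesgue_on half_space. psd_at a p"
    and \<Omega>: "open \<Omega>" "\<Omega> \<subseteq> half_space"
    and w: "v \<in> W_smooth a q \<Omega>" "w \<in> W_smooth a q \<Omega>"
  defines "d \<equiv> (\<lambda>p. v p - w p)"
  shows "integrable (lebesgue_on \<Omega>) (grad_form a d d)"
    "0 \<le> integral\<^sup>L (lebesgue_on \<Omega>) (grad_form a d d)"
    "0 < e \<Longrightarrow> W_norm a q \<Omega> d < e \<Longrightarrow> integral\<^sup>L (lebesgue_on \<Omega>) (grad_form a d d) \<le> e\<^sup>2"
proof -
  have s: "\<Omega> \<in> sets lebesgue" using \<Omega>(1) by (intro sets_completionI_sets) simp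
  have psd': "AE p in lebesgue_on \<Omega>. psd_at a p \<and> p \<in> \<Omega>"
    using AE_half_space_subset[OF psd \<Omega>(2) s] AE_space[of "lebesgue_on \<Omega>"] by eventually_elim auto
  have sm: "smooth_on v \<Omega>" "smooth_on w \<Omega>" using w by (auto simp: W_smooth_def)
  have smd: "smooth_on d \<Omega>" unfolding d_def by (intro smooth_on_diff \<Omega>(1) sm)
  have nn: "AE p in lebesgue_on \<Omega>. 0 \<le> grad_form a d d p"
    using psd' by eventually_elim (auto simp: grad_form_eq psd_at_nonneg)
  show i: "integrable (lebesgue_on \<Omega>) (grad_form a d d)"
  proof (rule Bochner_Integration.integrable_bound)
    show "integrable (lebesgue_on \<Omega>) (\<lambda>p. 2 * grad_form a v v p + 2 * grad_form a w w p)"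
      using w by (auto simp: W_smooth_def)
    show "grad_form a d d \<in> borel_measurable (lebesgue_on \<Omega>)"
      by (rule grad_form_measurable[OF a \<Omega> smd smd])
    show "AE p in lebesgue_on \<Omega>. norm (grad_form a d d p) \<le> norm (2 * grad_form a v v p + 2 * grad_form a w w p)"
      using psd' nn
    proof eventually_elim
      case (elim p)
      have "grad d p = grad v p - grad w p"
        unfolding d_def using elim sm \<Omega>(1) by (intro grad_diff) (auto intro: smooth_on_imp_differentiable)
      then have "grad_form a d d p \<le> 2 * grad_form a v v p + 2 * grad_form a w w p"
        using coeff_form_diff_le[of a p "grad v p" "grad w p"] elim by (simp add: grad_form_eq)
      then show ?case using elim by simp
    qed
  qed
  show nnI: "0 \<le> integral\<^sup>L (lebesgue_on \<Omega>) (grad_form a d d)"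
    using nn by (rule integral_nonneg_AE)
  show "integral\<^sup>L (lebesgue_on \<Omega>) (grad_form a d d) \<le> e\<^sup>2" if "0 < e" "W_norm a q \<Omega> d < e"
  proof -
    have "sqrt (integral\<^sup>L (lebesgue_on \<Omega>) (grad_form a d d)) \<le> W_norm a q \<Omega> d"
      using nnI by (simp add: W_norm_def powr_half_sqrt)
    then have "sqrt (integral\<^sup>L (lebesgue_on \<Omega>) (grad_form a d d)) \<le> e" using that by simp
    then show ?thesis by (rule sqrt_le_D)
  qed
qed

section \<open>The energy inequality\<close>

lemma abs_le_one_plus_powr:
  fixes x q :: real
  assumes "1 < q"
  shows "\<bar>x\<bar> \<le> 1 + \<bar>x\<bar> powr q"
  using powr_mono[of 1 q "\<bar>x\<bar>"] assms by (cases "\<bar>x\<bar> \<le> 1") (auto intro: add_increasing2)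

lemma tendsto_integral_diff_zero:
  fixes f h d :: "nat \<Rightarrow> 'a \<Rightarrow> real"
  assumes f: "\<And>k. integrable M (f k)" and h: "\<And>k. integrable M (h k)" and d: "\<And>k. integrable M (d k)"
    and le: "\<And>k x. x \<in> space M \<Longrightarrow> \<bar>f k x - h k x\<bar> \<le> C * d k x"
    and lim: "(\<lambda>k. integral\<^sup>L M (d k)) \<longlonglongrightarrow> 0"
  shows "(\<lambda>k. integral\<^sup>L M (f k) - integral\<^sup>L M (h k)) \<longlonglongrightarrow> 0"
proof (rule Lim_null_comparison[OF always_eventually tendsto_mult_right_zero[OF lim, of C]], rule allI)
  fix k
  have "norm (integral\<^sup>L M (f k) - integral\<^sup>L M (h k)) = norm (\<integral>x. f k x - h k x \<partial>M)"
    using f h by simp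
  also have "\<dots> \<le> (\<integral>x. norm (f k x - h k x) \<partial>M)"
    by (rule integral_norm_bound)
  also have "\<dots> \<le> (\<integral>x. C * d k x \<partial>M)"
    by (rule integral_mono) (use f h d le in auto)
  finally show "norm (integral\<^sup>L M (f k) - integral\<^sup>L M (h k)) \<le> C * integral\<^sup>L M (d k)"
    by simp
qed

text \<open>Only integrals of \<open>u\<close> survive: the gradient, whose limit need not be
  determined by \<open>u\<close> when the form degenerates, is absorbed before the limit is taken.
  The function \<open>b\<close> stands for the form of \<open>grad \<zeta>\<close> divided by
  \<zeta>, in the shape that Cauchy-Schwarz uses. Integrability belongs to the conclusion because
  these integrals are combined and compared afterwards.\<close>

lemma energy_inequality:
  fixes a :: "'n::finite coeffs" and u ut \<zeta> b :: "real \<times> (real ^ 'n) \<Rightarrow> real"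
    and g g' G :: "real \<Rightarrow> real"
  defines "M \<equiv> \<lambda>s t R. lebesgue_on (cylinder s t R :: (real \<times> (real ^ 'n)) set)"
  assumes q: "1 < q" and str: "0 < s" "s < t" "0 < R"
    and a: "\<And>i j. a i j \<in> borel_measurable (lebesgue_on half_space)"
    and psd: "AE p in lebesgue_on half_space. psd_at a p"
    and u: "u \<in> borel_measurable (lebesgue_on half_space)"
    and W: "W_loc_element a q u ut E"
    and weak: "\<And>\<phi>. test_function \<phi> \<Longrightarrow> (\<And>p. p \<in> half_space \<Longrightarrow> 0 \<le> \<phi> p) \<Longrightarrow>
      0 \<le> (\<integral>p. ut p * \<phi> p + E \<phi> p - \<bar>u p\<bar> powr (q - 1) * u p * \<phi> p \<partial>lebesgue_on half_space)"
    and \<zeta>: "smooth_on \<zeta> half_space" "\<And>p. p \<in> half_space \<Longrightarrow> 0 \<le> \<zeta> p"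
      "compact K" "K \<subseteq> cylinder s t R" "\<And>p. p \<in> half_space - K \<Longrightarrow> \<zeta> p = 0"
    and b: "b \<in> borel_measurable (M s t R)" "\<And>p. p \<in> cylinder s t R \<Longrightarrow> 0 \<le> b p"
      "\<And>p. p \<in> cylinder s t R \<Longrightarrow> b p \<le> B"
      "AE p in M s t R. \<forall>x. (coeff_form a p (grad \<zeta> p) x)\<^sup>2 \<le> b p * \<zeta> p * coeff_form a p x x"
    and g: "smooth_on g UNIV" "\<And>x. (g has_real_derivative g' x) (at x)" "continuous_on UNIV g'"
      "\<And>x. (G has_real_derivative g x) (at x)"
      "\<And>x. 0 < g x" "\<And>x. g x \<le> L" "\<And>x. g' x < 0" "\<And>x. \<bar>g' x\<bar> \<le> L"
      "\<And>x. (g x)\<^sup>2 / (2 * \<bar>g' x\<bar>) \<le> C * (1 + \<bar>x\<bar> powr q)"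
  shows "integrable (M s t R) (\<lambda>p. \<bar>u p\<bar> powr (q - 1) * u p * (g (u p) * \<zeta> p))"
    and "integrable (M s t R) (\<lambda>p. G (u p) * dt \<zeta> p)"
    and "integrable (M s t R) (\<lambda>p. (g (u p))\<^sup>2 / (2 * \<bar>g' (u p)\<bar>) * b p)"
    and "(\<integral>p. \<bar>u p\<bar> powr (q - 1) * u p * (g (u p) * \<zeta> p) \<partial>M s t R)
    \<le> - (\<integral>p. G (u p) * dt \<zeta> p \<partial>M s t R) + (\<integral>p. (g (u p))\<^sup>2 / (2 * \<bar>g' (u p)\<bar>) * b p \<partial>M s t R)"
proof -
  define \<Omega> :: "(real \<times> (real ^ 'n)) set" where "\<Omega> = cylinder s t R"
  define N where "N = lebesgue_on \<Omega>"
  define H where "H x = (g x)\<^sup>2 / (2 * \<bar>g' x\<bar>)" for x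
  define v where "v p = \<bar>u p\<bar> powr (q - 1) * u p" for p
  have MN: "M s t R = N" by (simp add: M_def N_def \<Omega>_def)
  note \<Omega> = cylinder_domain[OF str, where 'n='n, folded \<Omega>_def]
  interpret N: finite_measure N
    unfolding N_def \<Omega>_def by (rule finite_measure_cylinder[OF str])
  have spN: "space N = \<Omega>" by (simp add: N_def)
  have to_N: "f \<in> borel_measurable (lebesgue_on half_space) \<Longrightarrow> f \<in> borel_measurable N" for f :: "_ \<Rightarrow> real"
    unfolding N_def using measurable_half_space_subset[OF _ \<Omega>(5,6)] .
  have cont_N: "continuous_on \<Omega> f \<Longrightarrow> f \<in> borel_measurable N" for f :: "_ \<Rightarrow> real"
    unfolding N_def using continuous_imp_measurable_on_sets_lebesgue \<Omega>(6) by blast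
  have psdN: "AE p in N. psd_at a p \<and> p \<in> \<Omega>"
    using AE_half_space_subset[OF psd \<Omega>(5,6), folded N_def] AE_space[of N] by eventually_elim (auto simp: spN)
  obtain w where w: "\<And>k. w k \<in> W_smooth a q \<Omega>"
    "\<And>e. 0 < e \<Longrightarrow> \<exists>m. \<forall>k\<ge>m. \<forall>l\<ge>m. W_norm a q \<Omega> (\<lambda>p. w k p - w l p) < e"
    "Lp_tendsto q \<Omega> w u" "Lp_tendsto 1 \<Omega> (\<lambda>k. dt (w k)) ut"
    "\<And>\<phi>. test_function \<phi> \<Longrightarrow> Lp_tendsto 1 \<Omega> (\<lambda>k. grad_form a \<phi> (w k)) (E \<phi>)"
    "AE p in N. (\<lambda>k. w k p) \<longlonglongrightarrow> u p"
    using W_element_AE_sequence[OF W_loc_element_cylinder[OF W str] q] unfolding N_def \<Omega>_def by blast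
  have smw: "smooth_on (w k) \<Omega>" for k using w(1)[of k] by (simp add: W_smooth_def)
  have sm\<zeta>: "smooth_on \<zeta> \<Omega>" using smooth_on_subset[OF half_space_sets(1) \<Omega>(1,5) \<zeta>(1)] .
  have diff: "w k differentiable at p" "\<zeta> differentiable at p" if "p \<in> \<Omega>" for k p
    using smooth_on_imp_differentiable[OF smw \<Omega>(1) that] smooth_on_imp_differentiable[OF sm\<zeta> \<Omega>(1) that] by auto
  have smG: "smooth_on G UNIV" by (rule smooth_on_antiderivative[OF g(1,4)])
  have sgw: "smooth_on (\<lambda>p. g (w k p)) \<Omega>" "smooth_on (\<lambda>p. G (w k p)) \<Omega>" for k
    by (rule smooth_on_compose[OF \<Omega>(1) open_UNIV _ smw], simp, rule g(1) smG)+
  have L: "0 < L" using g(5,6)[of 0] by linarith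
  obtain Z where Z: "0 < Z" "\<And>p. p \<in> \<Omega> \<Longrightarrow> \<bar>\<zeta> p\<bar> \<le> Z"
    using continuous_on_half_space_bounded[OF smooth_on_imp_continuous_on[OF \<zeta>(1)] str(1)] unfolding \<Omega>_def by blast
  obtain Z' where Z': "0 < Z'" "\<And>p. p \<in> \<Omega> \<Longrightarrow> \<bar>dt \<zeta> p\<bar> \<le> Z'"
    using continuous_on_half_space_bounded[OF smooth_on_imp_continuous_on[OF smooth_on_dt[OF \<zeta>(1)]] str(1)]
    unfolding \<Omega>_def by blast
  have mu: "u \<in> borel_measurable N" by (rule to_N[OF u])
  have mw: "w k \<in> borel_measurable N" for k by (intro cont_N smooth_on_imp_continuous_on smw)
  have m\<zeta>: "\<zeta> \<in> borel_measurable N" "dt \<zeta> \<in> borel_measurable N"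
    by (intro cont_N smooth_on_imp_continuous_on smooth_on_dt sm\<zeta>)+
  have cg: "continuous_on UNIV g" "continuous_on UNIV G"
    using smooth_on_imp_continuous_on g(1) smG by auto
  have g'0: "g' x \<noteq> 0" for x using g(7)[of x] by simp
  have cH: "continuous_on UNIV H"
    unfolding H_def[abs_def] using cg(1) g(3) g'0 by (intro continuous_intros) auto
  have mH: "H \<in> borel_measurable borel" by (rule borel_measurable_continuous_onI[OF cH])
  have mg: "g \<in> borel_measurable borel" "G \<in> borel_measurable borel"
    using cg by (auto intro: borel_measurable_continuous_onI)
  have mb: "b \<in> borel_measurable N" using b(1) MN by simp
  have Hnn: "0 \<le> H x" for x by (simp add: H_def)
  have Hle: "H x \<le> C * (1 + \<bar>x\<bar> powr q)" for x using g(9) by (simp add: H_def)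
  have C: "0 \<le> C" using Hnn[of 0] Hle[of 0] by (auto simp: zero_le_mult_iff)
  have iu: "integrable N (\<lambda>p. \<bar>u p\<bar> powr q)" using w(3) by (simp add: Lp_tendsto_def in_Lp_def N_def)
  have iw: "integrable N (\<lambda>p. \<bar>w k p\<bar> powr q)" for k using w(3) by (simp add: Lp_tendsto_def in_Lp_def N_def)
  have i\<delta>: "integrable N (\<lambda>p. \<bar>w k p - u p\<bar> powr q)" for k
    unfolding N_def using w(3) q by (intro in_Lp_diff) (auto simp: Lp_tendsto_def)
  have lim\<delta>: "(\<lambda>k. \<integral>p. \<bar>w k p - u p\<bar> powr q \<partial>N) \<longlonglongrightarrow> 0" using w(3) by (simp add: Lp_tendsto_def N_def)
  have AE\<delta>: "AE p in N. (\<lambda>k. \<bar>w k p - u p\<bar> powr q) \<longlonglongrightarrow> 0"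
    using w(6)
  proof eventually_elim
    case (elim p)
    have "(\<lambda>k. \<bar>w k p - u p\<bar>) \<longlonglongrightarrow> 0" using elim by (simp add: LIM_zero tendsto_rabs_zero)
    from tendsto_powr'[OF this tendsto_const[of q]] show ?case using q by simp
  qed
  have vabs: "\<bar>v p\<bar> = \<bar>u p\<bar> powr q" for p
    using powr_add[of "\<bar>u p\<bar>" "q - 1" 1] by (simp add: v_def abs_mult)
  have mv: "v \<in> borel_measurable (lebesgue_on half_space)"
    unfolding v_def using u by (intro borel_measurable_times powr_real_measurable borel_measurable_abs) auto
  have iv: "integrable N v"
    by (rule Bochner_Integration.integrable_bound[OF iu to_N[OF mv]]) (simp add: vabs)
  have iut: "integrable N ut" using Lp_tendsto_1_integral(2)[OF w(4)] by (simp add: N_def)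
  have idw: "integrable N (dt (w k))" for k using Lp_tendsto_1_integral(1)[OF w(4)] by (simp add: N_def)

  \<comment> \<open>The approximants are smooth only on \<Omega>. Since \<zeta> vanishes off
    \<open>K\<close>, cutting at \<Omega> gives a smooth function supported in
    \<open>K\<close>.\<close>
  define \<phi> where "\<phi> k p = (if p \<in> \<Omega> then g (w k p) * \<zeta> p else 0)" for k p
  have KO: "K \<subseteq> \<Omega>" using \<zeta>(4) by (simp add: \<Omega>_def)
  have \<zeta>0: "\<zeta> p = 0" if "p \<in> \<Omega> - K" for p using \<zeta>(5) that \<Omega>(5) by blast
  have sm\<phi>: "smooth_on (\<phi> k) UNIV" for k
    unfolding \<phi>_def[abs_def]
    by (rule smooth_on_glue_zero[OF \<Omega>(1) smooth_on_mult[OF \<Omega>(1) sgw(1) sm\<zeta>] compact_imp_closed[OF \<zeta>(3)] KO])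
      (use \<zeta>0 in simp)
  have \<phi>0: "\<phi> k p = 0" if "p \<notin> K" for k p using \<zeta>0 that by (auto simp: \<phi>_def)
  have \<phi>nn: "0 \<le> \<phi> k p" for k p
  proof (cases "p \<in> \<Omega>")
    case True
    then have "0 \<le> \<zeta> p" using \<zeta>(2) \<Omega>(5) by blast
    then show ?thesis using g(5)[of "w k p"] by (simp add: \<phi>_def)
  qed (simp add: \<phi>_def)
  have test: "test_function (\<phi> k)" for k
  proof -
    have sub: "support_on half_space (\<phi> k) \<subseteq> K" using \<phi>0 by (auto simp: support_on_def)
    then have "closure (support_on half_space (\<phi> k)) \<subseteq> K"
      using \<zeta>(3) by (intro closure_minimal compact_imp_closed)
    moreover have "compact (closure (support_on half_space (\<phi> k)))"
      using bounded_subset[OF compact_imp_bounded[OF \<zeta>(3)] sub] by simp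
    ultimately show ?thesis
      using smooth_on_subset[OF open_UNIV half_space_sets(1) _ sm\<phi>[of k]] KO \<Omega>(5)
      by (auto simp: test_function_def)
  qed
  have g\<zeta>: "(\<lambda>p. g (w k p) * \<zeta> p) \<in> borel_measurable N" "\<And>p. p \<in> space N \<Longrightarrow> \<bar>g (w k p) * \<zeta> p\<bar> \<le> L * Z" for k
  proof -
    show "(\<lambda>p. g (w k p) * \<zeta> p) \<in> borel_measurable N"
      using mg(1) mw[of k] m\<zeta>(1) by measurable
    show "\<bar>g (w k p) * \<zeta> p\<bar> \<le> L * Z" if "p \<in> space N" for p
      using that g(5,6)[of "w k p"] Z(1) Z(2)[of p] L by (auto simp: abs_mult spN intro!: mult_mono)
  qed

  have weakN: "(\<integral>p. v p * (g (w k p) * \<zeta> p) \<partial>N) \<le> (\<integral>p. ut p * (g (w k p) * \<zeta> p) \<partial>N) + integral\<^sup>L N (E (\<phi> k))" for k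
  proof -
    let ?f = "\<lambda>p. ut p * \<phi> k p + E (\<phi> k) p - v p * \<phi> k p"
    have m\<phi>: "\<phi> k \<in> borel_measurable (lebesgue_on half_space)"
      by (rule continuous_imp_measurable_on_sets_lebesgue[OF continuous_on_subset[OF smooth_on_imp_continuous_on[OF sm\<phi>]] half_space_sets(2)]) simp
    have mf: "?f \<in> borel_measurable (lebesgue_on half_space)"
      using W_loc_element_measurable[OF W] test m\<phi> mv by measurable
    have mf': "(\<lambda>p. indicator \<Omega> p *\<^sub>R ?f p) \<in> borel_measurable (lebesgue_on half_space)"
      using mf by (intro borel_measurable_scaleR measurable_restrict_space1[OF borel_measurable_indicator[OF \<Omega>(6)]])
    have "AE p in lebesgue_on half_space. p \<notin> K \<longrightarrow> E (\<phi> k) p = 0"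
      by (rule W_loc_element_form_support[OF W test compact_imp_closed[OF \<zeta>(3)]]) (use \<phi>0 in auto)
    then have "AE p in lebesgue_on half_space. ?f p = indicator \<Omega> p *\<^sub>R ?f p"
    proof eventually_elim
      case (elim p)
      have "p \<notin> K" if "p \<notin> \<Omega>" using that KO by blast
      then show ?case using \<phi>0[of p k] elim by (cases "p \<in> \<Omega>") simp_all
    qed
    then have "integral\<^sup>L (lebesgue_on half_space) ?f = (\<integral>p. indicator \<Omega> p *\<^sub>R ?f p \<partial>lebesgue_on half_space)"
      by (intro integral_cong_AE mf mf')
    also have "\<dots> = integral\<^sup>L N ?f"
      unfolding N_def restrict_half_space[OF \<Omega>(5,6), symmetric]
      by (rule integral_restrict_space[symmetric])
        (use \<Omega>(5,6) in \<open>auto simp: sets_restrict_space intro!: image_eqI[of _ _ \<Omega>]\<close>)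
    also have "\<dots> = (\<integral>p. ut p * (g (w k p) * \<zeta> p) + E (\<phi> k) p - v p * (g (w k p) * \<zeta> p) \<partial>N)"
      by (rule Bochner_Integration.integral_cong) (auto simp: \<phi>_def spN)
    also have "\<dots> = (\<integral>p. ut p * (g (w k p) * \<zeta> p) \<partial>N) + integral\<^sup>L N (E (\<phi> k)) - (\<integral>p. v p * (g (w k p) * \<zeta> p) \<partial>N)"
      using integrable_mult_bounded[OF iut g\<zeta>(1,2)] integrable_mult_bounded[OF iv g\<zeta>(1,2)]
        Lp_tendsto_1_integral(2)[OF w(5)[OF test], folded N_def] by simp
    finally show ?thesis using weak[OF test[of k]] \<phi>nn by (simp add: v_def)
  qed

  have dx\<phi>: "grad (\<phi> k) p = (g' (w k p) * \<zeta> p) *\<^sub>R grad (w k) p + g (w k p) *\<^sub>R grad \<zeta> p" if "p \<in> \<Omega>" for k p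
  proof -
    have gd: "(\<lambda>p. g (w k p)) differentiable at p"
      using smooth_on_imp_differentiable[OF sgw(1) \<Omega>(1) that] .
    have "frechet_derivative (\<phi> k) (at p) = frechet_derivative (\<lambda>p. g (w k p) * \<zeta> p) (at p)"
      by (rule frechet_derivative_cong_open[OF \<Omega>(1) that]) (simp add: \<phi>_def)
    then show ?thesis
      using frechet_derivative_mult_real[OF gd diff(2)[OF that]]
        frechet_derivative_compose_has_real_derivative[OF diff(1)[OF that] g(2)]
      by (simp add: grad_def dx_def vec_eq_iff algebra_simps)
  qed
  let ?d = "\<lambda>k l p. w k p - w l p"
  note D = W_norm_Cauchy_form[OF a psd \<Omega>(1,5) w(1) w(1), folded N_def]
  have iH: "integrable N (\<lambda>p. H (f p) * b p)"
    if f: "f \<in> borel_measurable N" "integrable N (\<lambda>p. \<bar>f p\<bar> powr q)" for f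
  proof (rule integrable_mult_bounded[OF _ mb])
    show "integrable N (\<lambda>p. H (f p))"
    proof (rule Bochner_Integration.integrable_bound)
      show "integrable N (\<lambda>p. C * (1 + \<bar>f p\<bar> powr q))" using f by simp
      show "(\<lambda>p. H (f p)) \<in> borel_measurable N" using mH f(1) by measurable
      show "AE p in N. norm (H (f p)) \<le> norm (C * (1 + \<bar>f p\<bar> powr q))"
        using Hle Hnn order_trans[OF Hnn Hle] by (intro AE_I2) simp
    qed
    show "\<bar>b p\<bar> \<le> B" if "p \<in> space N" for p using b(2,3) that by (auto simp: spN \<Omega>_def)
  qed
  have iHb: "integrable N (\<lambda>p. H (w k p) * b p)" for k by (intro iH mw iw)
  \<comment> \<open>\<open>C0\<close> bounds the factor \<open>|g'| * \<zeta> / 2\<close> left by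
    \<open>coeff_form_absorb\<close>. That lemma is applied with \<open>v\<close> the gradient of
    \<open>w k\<close>, which builds the test function, and \<open>x\<close> the gradient of
    \<open>w l\<close>, with which it is paired.\<close>
  define C0 where "C0 = L * Z / 2"
  have C0: "0 < C0" using L Z by (simp add: C0_def)
  have form_le: "integral\<^sup>L N (grad_form a (\<phi> k) (w l)) \<le> (\<integral>p. H (w k p) * b p \<partial>N) + C0 * integral\<^sup>L N (grad_form a (?d k l) (?d k l))" for k l
  proof -
    have "integral\<^sup>L N (grad_form a (\<phi> k) (w l)) \<le> (\<integral>p. H (w k p) * b p + C0 * grad_form a (?d k l) (?d k l) p \<partial>N)"
    proof (rule integral_mono_AE)
      show "integrable N (grad_form a (\<phi> k) (w l))"
        using Lp_tendsto_1_integral(1)[OF w(5)[OF test]] by (simp add: N_def)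
      show "integrable N (\<lambda>p. H (w k p) * b p + C0 * grad_form a (?d k l) (?d k l) p)"
        using iHb D(1) by simp
      show "AE p in N. grad_form a (\<phi> k) (w l) p \<le> H (w k p) * b p + C0 * grad_form a (?d k l) (?d k l) p"
        using psdN b(4)[unfolded MN]
      proof eventually_elim
        case (elim p)
        then have p: "p \<in> \<Omega>" "psd_at a p" by auto
        have \<zeta>p: "0 \<le> \<zeta> p" "\<zeta> p \<le> Z" using \<zeta>(2)[of p] \<Omega>(5) p(1) Z(2)[OF p(1)] by auto
        have gd: "grad (?d k l) p = grad (w k) p - grad (w l) p"
          using diff[OF p(1)] by (intro grad_diff)
        have "grad_form a (\<phi> k) (w l) p \<le> H (w k p) * b p + \<bar>g' (w k p)\<bar> * \<zeta> p / 2 * grad_form a (?d k l) (?d k l) p"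
          unfolding grad_form_eq gd dx\<phi>[OF p(1)] H_def
          by (rule coeff_form_absorb) (use p g(7) \<zeta>p elim b(2) in \<open>auto simp: \<Omega>_def\<close>)
        also have "\<dots> \<le> H (w k p) * b p + C0 * grad_form a (?d k l) (?d k l) p"
        proof -
          have "\<bar>g' (w k p)\<bar> * \<zeta> p / 2 \<le> C0"
            unfolding C0_def using g(8)[of "w k p"] \<zeta>p L by (intro divide_right_mono mult_mono) auto
          then show ?thesis
            using psd_at_nonneg[OF p(2)] by (intro add_left_mono mult_right_mono) (auto simp: grad_form_eq)
        qed
        finally show ?case .
      qed
    qed
    then show ?thesis using iHb D(1) by simp
  qed
  \<comment> \<open>Here \<open>l\<close> tends to infinity at fixed \<open>k\<close>, which reaches
    \<open>E (\<phi> k)\<close>; the Cauchy property makes the error uniform in \<open>l\<close>.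
    The radius \<open>r\<close> is chosen so that \<open>C0 * r ^ 2 = e\<close>.\<close>
  have E_le: "\<forall>\<^sub>F k in sequentially. integral\<^sup>L N (E (\<phi> k)) \<le> (\<integral>p. H (w k p) * b p \<partial>N) + e" if "0 < e" for e
  proof -
    define r where "r = sqrt (e / C0)"
    have r: "0 < r" "C0 * r\<^sup>2 = e" using that C0 by (auto simp: r_def)
    obtain m where m: "\<And>k l. k \<ge> m \<Longrightarrow> l \<ge> m \<Longrightarrow> W_norm a q \<Omega> (?d k l) < r"
      using w(2)[OF r(1)] by blast
    have "integral\<^sup>L N (E (\<phi> k)) \<le> (\<integral>p. H (w k p) * b p \<partial>N) + e" if "k \<ge> m" for k
    proof (rule LIMSEQ_le_const2)
      show "(\<lambda>l. integral\<^sup>L N (grad_form a (\<phi> k) (w l))) \<longlonglongrightarrow> integral\<^sup>L N (E (\<phi> k))"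
        using Lp_tendsto_1_integral(4)[OF w(5)[OF test]] by (simp add: N_def)
      have "integral\<^sup>L N (grad_form a (\<phi> k) (w l)) \<le> (\<integral>p. H (w k p) * b p \<partial>N) + e" if "l \<ge> m" for l
      proof -
        have "C0 * integral\<^sup>L N (grad_form a (?d k l) (?d k l)) \<le> C0 * r\<^sup>2"
          using D(3)[OF r(1) m[OF \<open>k \<ge> m\<close> that]] C0 by (intro mult_left_mono) auto
        then show ?thesis using form_le[of k l] r(2) by linarith
      qed
      then show "\<exists>m. \<forall>l\<ge>m. integral\<^sup>L N (grad_form a (\<phi> k) (w l)) \<le> (\<integral>p. H (w k p) * b p \<partial>N) + e" by blast
    qed
    then show ?thesis by (auto simp: eventually_sequentially)
  qed
  \<comment> \<open>An upper bound is all the inequality asks for, which suits a majorant depending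
    on \<open>k\<close>: \<open>|w k| powr q\<close> is at most \<open>2 powr q\<close> times the
    sum of \<open>|w k - u| powr q\<close> and \<open>|u| powr q\<close>.\<close>
  have H_lim: "\<forall>\<^sub>F k in sequentially. (\<integral>p. H (w k p) * b p \<partial>N) \<le> (\<integral>p. H (u p) * b p \<partial>N) + e" if "0 < e" for e
  proof -
    define B' where "B' = max B 0"
    let ?h = "\<lambda>p. B' * C * (1 + 2 powr q * \<bar>u p\<bar> powr q)" and ?\<delta> = "\<lambda>k p. B' * C * 2 powr q * \<bar>w k p - u p\<bar> powr q"
    show ?thesis
    proof (rule eventually_integral_le_limit[where h="?h" and \<delta>="?\<delta>"])
      show "(\<lambda>p. H (w k p) * b p) \<in> borel_measurable N" for k using mH mw[of k] mb by measurable
      show "(\<lambda>p. H (u p) * b p) \<in> borel_measurable N" using mH mu mb by measurable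
      show "integrable N ?h" using iu by simp
      show "integrable N (?\<delta> k)" for k using i\<delta> by simp
      show "(\<lambda>k. integral\<^sup>L N (?\<delta> k)) \<longlonglongrightarrow> 0" using tendsto_mult_right_zero[OF lim\<delta>, of "B' * C * 2 powr q"] by simp
      show "AE p in N. (\<lambda>k. ?\<delta> k p) \<longlonglongrightarrow> 0" using AE\<delta> by eventually_elim (rule tendsto_mult_right_zero)
      show "AE p in N. 0 \<le> ?\<delta> k p" for k using C by (intro AE_I2) (auto simp: B'_def)
      show "AE p in N. 0 \<le> H (w k p) * b p" for k
        using Hnn b(2) by (intro AE_I2) (auto simp: spN \<Omega>_def)
      show "AE p in N. H (w k p) * b p \<le> ?h p + ?\<delta> k p" for k
      proof (rule AE_I2)
        fix p assume "p \<in> space N"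
        then have bp: "0 \<le> b p" "b p \<le> B'" using b(2,3) by (auto simp: spN \<Omega>_def B'_def le_max_iff_disj)
        have "H (w k p) * b p \<le> (C * (1 + \<bar>w k p\<bar> powr q)) * B'"
          using bp Hnn Hle C by (intro mult_mono) auto
        also have "\<dots> \<le> (C * (1 + 2 powr q * (\<bar>w k p - u p\<bar> powr q + \<bar>u p\<bar> powr q))) * B'"
          using abs_diff_powr_le[of q "w k p - u p" "- u p"] q C bp
          by (intro mult_right_mono mult_left_mono add_left_mono) auto
        also have "\<dots> = ?h p + ?\<delta> k p" by (simp add: algebra_simps)
        finally show "H (w k p) * b p \<le> ?h p + ?\<delta> k p" .
      qed
      show "AE p in N. (\<lambda>k. H (w k p) * b p) \<longlonglongrightarrow> H (u p) * b p"
        using w(6)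
      proof eventually_elim
        case (elim p)
        have "isCont H (u p)" using cH by (simp add: continuous_on_eq_continuous_at)
        from tendsto_mult[OF isCont_tendsto_compose[OF this elim] tendsto_const] show ?case .
      qed
    qed fact
  qed
  \<comment> \<open>Since \<open>|x| \<le> 1 + |x| powr q\<close> and the cylinder has finite
    measure, convergence with the exponent \<open>q\<close> descends to L1. The function
    \<open>G\<close> is Lipschitz with constant \<open>L\<close>, so L1 is the right space for
    it.\<close>
  have L1: "(\<lambda>k. \<integral>p. \<bar>w k p - u p\<bar> \<partial>N) \<longlonglongrightarrow> 0"
  proof (rule LIMSEQ_I)
    fix e :: real assume e: "0 < e"
    have "\<forall>\<^sub>F k in sequentially. (\<integral>p. \<bar>w k p - u p\<bar> \<partial>N) \<le> (\<integral>p. 0 \<partial>N) + e / 2"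
    proof (rule eventually_integral_le_limit[where h="\<lambda>_. 1" and \<delta>="\<lambda>k p. \<bar>w k p - u p\<bar> powr q"])
      show "AE p in N. \<bar>w k p - u p\<bar> \<le> 1 + \<bar>w k p - u p\<bar> powr q" for k
        using abs_le_one_plus_powr[OF q] by (intro AE_I2)
      show "AE p in N. (\<lambda>k. \<bar>w k p - u p\<bar>) \<longlonglongrightarrow> 0"
        using w(6) by eventually_elim (simp add: LIM_zero tendsto_rabs_zero)
    qed (use e mw mu i\<delta> lim\<delta> AE\<delta> in auto)
    then obtain m where "\<And>k. k \<ge> m \<Longrightarrow> (\<integral>p. \<bar>w k p - u p\<bar> \<partial>N) \<le> e / 2"
      by (auto simp: eventually_sequentially)
    moreover have "0 \<le> (\<integral>p. \<bar>w k p - u p\<bar> \<partial>N)" for k by (intro integral_nonneg_AE) auto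
    note calculation = calculation this
    show "\<exists>m. \<forall>k\<ge>m. norm ((\<integral>p. \<bar>w k p - u p\<bar> \<partial>N) - 0) < e"
    proof (intro exI[of _ m] allI impI)
      fix k assume "m \<le> k"
      then have "(\<integral>p. \<bar>w k p - u p\<bar> \<partial>N) \<le> e / 2" "0 \<le> (\<integral>p. \<bar>w k p - u p\<bar> \<partial>N)"
        using calculation by auto
      then show "norm ((\<integral>p. \<bar>w k p - u p\<bar> \<partial>N) - 0) < e" using e by simp
    qed
  qed
  have iabs: "integrable N (\<lambda>p. \<bar>f p\<bar>)"
    if f: "f \<in> borel_measurable N" "integrable N (\<lambda>p. \<bar>f p\<bar> powr q)" for f
  proof (rule Bochner_Integration.integrable_bound)
    show "integrable N (\<lambda>p. 1 + \<bar>f p\<bar> powr q)" using f by simp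
    show "AE p in N. norm \<bar>f p\<bar> \<le> norm (1 + \<bar>f p\<bar> powr q)"
      using abs_le_one_plus_powr[OF q] by (intro AE_I2) simp
  qed (use f in auto)
  have i1: "integrable N (\<lambda>p. \<bar>w k p - u p\<bar>)" for k
    by (rule iabs[OF borel_measurable_diff[OF mw mu] i\<delta>])
  have gabs: "norm (g x) \<le> L" for x using g(5,6)[of x] by simp
  have Glip: "\<bar>G x - G y\<bar> \<le> L * \<bar>x - y\<bar>" for x y
  proof -
    have "norm (G x - G y) \<le> L * norm (x - y)"
      by (rule field_differentiable_bound[where S=UNIV and f'=g])
        (use g(4) gabs in auto)
    then show ?thesis by simp
  qed
  have iG: "integrable N (\<lambda>p. G (f p) * dt \<zeta> p)"
    if "f \<in> borel_measurable N" "integrable N (\<lambda>p. \<bar>f p\<bar>)" for f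
  proof (rule integrable_mult_bounded[OF _ m\<zeta>(2)])
    show "integrable N (\<lambda>p. G (f p))"
    proof (rule Bochner_Integration.integrable_bound)
      show "integrable N (\<lambda>p. \<bar>G 0\<bar> + L * \<bar>f p\<bar>)" using that by simp
      show "(\<lambda>p. G (f p)) \<in> borel_measurable N" using that mg(2) by measurable
      show "AE p in N. norm (G (f p)) \<le> norm (\<bar>G 0\<bar> + L * \<bar>f p\<bar>)"
        using Glip[of "f _" 0] L by (intro AE_I2) (smt (verit) mult_nonneg_nonneg real_norm_def)
    qed
    show "\<bar>dt \<zeta> p\<bar> \<le> Z'" if "p \<in> space N" for p using Z' that by (simp add: spN)
  qed
  have iGw: "integrable N (\<lambda>p. G (w k p) * dt \<zeta> p)" for k by (intro iG iabs mw iw)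
  have iGu: "integrable N (\<lambda>p. G (u p) * dt \<zeta> p)" by (intro iG iabs mu iu)
  have parts: "(\<integral>p. dt (w k) p * (g (w k p) * \<zeta> p) \<partial>N) = - (\<integral>p. G (w k p) * dt \<zeta> p \<partial>N)" for k
  proof -
    define F where "F p = (if p \<in> \<Omega> then G (w k p) * \<zeta> p else 0)" for p
    have smF: "smooth_on F UNIV"
      unfolding F_def[abs_def]
      by (rule smooth_on_glue_zero[OF \<Omega>(1) smooth_on_mult[OF \<Omega>(1) sgw(2) sm\<zeta>] compact_imp_closed[OF \<zeta>(3)] KO])
        (use \<zeta>0 in simp)
    have F0: "F p = 0" if "p \<notin> K" for p using \<zeta>0 that by (auto simp: F_def)
    have cF: "continuous_on UNIV (dt F)" by (intro smooth_on_imp_continuous_on smooth_on_dt smF)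
    have dF: "dt F p = dt (w k) p * (g (w k p) * \<zeta> p) + G (w k p) * dt \<zeta> p" if "p \<in> \<Omega>" for p
    proof -
      have gd: "(\<lambda>p. G (w k p)) differentiable at p"
        using smooth_on_imp_differentiable[OF sgw(2) \<Omega>(1) that] .
      have "frechet_derivative F (at p) = frechet_derivative (\<lambda>p. G (w k p) * \<zeta> p) (at p)"
        by (rule frechet_derivative_cong_open[OF \<Omega>(1) that]) (simp add: F_def)
      then show ?thesis
        using frechet_derivative_mult_real[OF gd diff(2)[OF that]]
          frechet_derivative_compose_has_real_derivative[OF diff(1)[OF that] g(4)]
        by (simp add: dt_def algebra_simps)
    qed
    have dF0: "dt F p = 0" if "p \<notin> \<Omega>" for p
      unfolding dt_def
      by (rule frechet_derivative_zero_open[of "- K"])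
        (use that KO F0 \<zeta>(3) in \<open>auto simp: compact_imp_closed open_Compl\<close>)
    have "0 = integral\<^sup>L lborel (dt F)"
      by (rule integral_dt_eq_0[OF _ cF \<zeta>(3) F0, symmetric])
        (use smooth_on_imp_differentiable[OF smF] in auto)
    also have "\<dots> = integral\<^sup>L lebesgue (dt F)"
      using cF by (intro integral_completion[symmetric]) (simp add: borel_measurable_continuous_onI)
    also have "\<dots> = integral\<^sup>L lebesgue (\<lambda>p. indicator \<Omega> p *\<^sub>R dt F p)"
      by (rule Bochner_Integration.integral_cong) (auto simp: indicator_def dF0)
    also have "\<dots> = integral\<^sup>L N (dt F)"
      unfolding N_def by (rule integral_restrict_space[symmetric]) (use \<Omega>(6) in simp)
    also have "\<dots> = (\<integral>p. dt (w k) p * (g (w k p) * \<zeta> p) + G (w k p) * dt \<zeta> p \<partial>N)"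
      by (rule Bochner_Integration.integral_cong) (auto simp: dF spN)
    also have "\<dots> = (\<integral>p. dt (w k) p * (g (w k p) * \<zeta> p) \<partial>N) + (\<integral>p. G (w k p) * dt \<zeta> p \<partial>N)"
      by (rule Bochner_Integration.integral_add[OF integrable_mult_bounded[OF idw g\<zeta>(1,2)] iGw])
    finally show ?thesis by simp
  qed
  have G_lim: "(\<lambda>k. \<integral>p. G (w k p) * dt \<zeta> p \<partial>N) \<longlonglongrightarrow> (\<integral>p. G (u p) * dt \<zeta> p \<partial>N)"
  proof -
    have "(\<lambda>k. (\<integral>p. G (w k p) * dt \<zeta> p \<partial>N) - (\<integral>p. G (u p) * dt \<zeta> p \<partial>N)) \<longlonglongrightarrow> 0"
    proof (rule tendsto_integral_diff_zero[OF iGw iGu i1 _ L1])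
      fix k p assume p: "p \<in> space N"
      have "\<bar>G (w k p) * dt \<zeta> p - G (u p) * dt \<zeta> p\<bar> = \<bar>G (w k p) - G (u p)\<bar> * \<bar>dt \<zeta> p\<bar>"
        by (simp add: left_diff_distrib[symmetric] abs_mult)
      also have "\<dots> \<le> (L * \<bar>w k p - u p\<bar>) * Z'"
        using Glip Z'(2)[of p] p L by (intro mult_mono) (auto simp: spN)
      finally show "\<bar>G (w k p) * dt \<zeta> p - G (u p) * dt \<zeta> p\<bar> \<le> L * Z' * \<bar>w k p - u p\<bar>" by (simp add: ac_simps)
    qed
    then show ?thesis by (simp add: LIM_zero_iff)
  qed
  \<comment> \<open>\<open>ut\<close> is close to \<open>dt (w k)\<close> in L1 while
    \<open>g (w k) * \<zeta>\<close> is bounded by \<open>L * Z\<close>. So \<open>ut\<close> may be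
    exchanged for \<open>dt (w k)\<close>, for which the integration by parts is available.\<close>
  have ut_lim: "(\<lambda>k. \<integral>p. ut p * (g (w k p) * \<zeta> p) \<partial>N) \<longlonglongrightarrow> - (\<integral>p. G (u p) * dt \<zeta> p \<partial>N)"
  proof -
    have l1: "(\<lambda>k. \<integral>p. \<bar>dt (w k) p - ut p\<bar> \<partial>N) \<longlonglongrightarrow> 0"
      using Lp_tendsto_1_integral(3)[OF w(4)] by (simp add: N_def)
    have "(\<lambda>k. (\<integral>p. ut p * (g (w k p) * \<zeta> p) \<partial>N) - (\<integral>p. dt (w k) p * (g (w k p) * \<zeta> p) \<partial>N)) \<longlonglongrightarrow> 0"
    proof (rule tendsto_integral_diff_zero[OF integrable_mult_bounded[OF iut g\<zeta>(1,2)] integrable_mult_bounded[OF idw g\<zeta>(1,2)] _ _ l1])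
      fix k p assume p: "p \<in> space N"
      have "\<bar>ut p * (g (w k p) * \<zeta> p) - dt (w k) p * (g (w k p) * \<zeta> p)\<bar> = \<bar>dt (w k) p - ut p\<bar> * \<bar>g (w k p) * \<zeta> p\<bar>"
        unfolding left_diff_distrib[symmetric] abs_mult[of _ "g (w k p) * \<zeta> p"] by (simp add: abs_minus_commute)
      also have "\<dots> \<le> \<bar>dt (w k) p - ut p\<bar> * (L * Z)"
        using g\<zeta>(2)[OF p] by (intro mult_left_mono) auto
      finally show "\<bar>ut p * (g (w k p) * \<zeta> p) - dt (w k) p * (g (w k p) * \<zeta> p)\<bar> \<le> L * Z * \<bar>dt (w k) p - ut p\<bar>"
        by (simp add: ac_simps)
    qed (assumption | rule integrable_abs Bochner_Integration.integrable_diff idw iut)+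
    from tendsto_add[OF this tendsto_minus[OF G_lim]] show ?thesis by (simp add: parts)
  qed
  have v_lim: "(\<lambda>k. \<integral>p. v p * (g (w k p) * \<zeta> p) \<partial>N) \<longlonglongrightarrow> (\<integral>p. v p * (g (u p) * \<zeta> p) \<partial>N)"
  proof (rule integral_dominated_convergence[where w="\<lambda>p. L * Z * \<bar>u p\<bar> powr q"])
    show "(\<lambda>p. v p * (g (u p) * \<zeta> p)) \<in> borel_measurable N" using to_N[OF mv] mg(1) mu m\<zeta>(1) by measurable
    show "(\<lambda>p. v p * (g (w k p) * \<zeta> p)) \<in> borel_measurable N" for k using to_N[OF mv] mg(1) mw[of k] m\<zeta>(1) by measurable
    show "integrable N (\<lambda>p. L * Z * \<bar>u p\<bar> powr q)" using iu by simp
    show "AE p in N. (\<lambda>k. v p * (g (w k p) * \<zeta> p)) \<longlonglongrightarrow> v p * (g (u p) * \<zeta> p)"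
      using w(6)
    proof eventually_elim
      case (elim p)
      have "isCont g (u p)" using cg(1) by (simp add: continuous_on_eq_continuous_at)
      from tendsto_mult[OF tendsto_const tendsto_mult[OF isCont_tendsto_compose[OF this elim] tendsto_const]] show ?case .
    qed
    show "AE p in N. norm (v p * (g (w k p) * \<zeta> p)) \<le> L * Z * \<bar>u p\<bar> powr q" for k
    proof (rule AE_I2)
      fix p assume p: "p \<in> space N"
      have "norm (v p * (g (w k p) * \<zeta> p)) = \<bar>u p\<bar> powr q * \<bar>g (w k p) * \<zeta> p\<bar>" by (simp add: abs_mult vabs)
      also have "\<dots> \<le> \<bar>u p\<bar> powr q * (L * Z)" using g\<zeta>(2)[OF p] by (intro mult_left_mono) auto
      finally show "norm (v p * (g (w k p) * \<zeta> p)) \<le> L * Z * \<bar>u p\<bar> powr q" by (simp add: ac_simps)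
    qed
  qed
  have "(\<integral>p. v p * (g (u p) * \<zeta> p) \<partial>N) \<le> (- (\<integral>p. G (u p) * dt \<zeta> p \<partial>N) + (\<integral>p. H (u p) * b p \<partial>N)) + e" if e: "0 < e" for e
  proof (rule tendsto_le[OF _ _ v_lim])
    show "(\<lambda>k. (\<integral>p. ut p * (g (w k p) * \<zeta> p) \<partial>N) + ((\<integral>p. H (u p) * b p \<partial>N) + e))
        \<longlonglongrightarrow> - (\<integral>p. G (u p) * dt \<zeta> p \<partial>N) + (\<integral>p. H (u p) * b p \<partial>N) + e"
      using tendsto_add[OF ut_lim tendsto_const[of "(\<integral>p. H (u p) * b p \<partial>N) + e"]] by (simp add: algebra_simps)
    have e2: "0 < e / 2" using e by simp
    show "\<forall>\<^sub>F k in sequentially. (\<integral>p. v p * (g (w k p) * \<zeta> p) \<partial>N) \<le> (\<integral>p. ut p * (g (w k p) * \<zeta> p) \<partial>N) + ((\<integral>p. H (u p) * b p \<partial>N) + e)"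
      using E_le[OF e2] H_lim[OF e2]
    proof eventually_elim
      case (elim k)
      then show ?case using weakN[of k] by linarith
    qed
  qed simp
  then show "(\<integral>p. \<bar>u p\<bar> powr (q - 1) * u p * (g (u p) * \<zeta> p) \<partial>M s t R)
    \<le> - (\<integral>p. G (u p) * dt \<zeta> p \<partial>M s t R) + (\<integral>p. (g (u p))\<^sup>2 / (2 * \<bar>g' (u p)\<bar>) * b p \<partial>M s t R)"
    unfolding MN H_def[symmetric] v_def[symmetric] by (rule field_le_epsilon)
  show "integrable (M s t R) (\<lambda>p. G (u p) * dt \<zeta> p)" unfolding MN by (rule iGu)
  show "integrable (M s t R) (\<lambda>p. (g (u p))\<^sup>2 / (2 * \<bar>g' (u p)\<bar>) * b p)"
    unfolding MN H_def[symmetric] by (intro iH mu iu)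
  show "integrable (M s t R) (\<lambda>p. \<bar>u p\<bar> powr (q - 1) * u p * (g (u p) * \<zeta> p))"
    unfolding MN v_def[symmetric]
  proof (rule integrable_mult_bounded[OF iv])
    show "(\<lambda>p. g (u p) * \<zeta> p) \<in> borel_measurable N" using mg(1) mu m\<zeta>(1) by measurable
    show "\<bar>g (u p) * \<zeta> p\<bar> \<le> L * Z" if "p \<in> space N" for p
      using that g(5,6)[of "u p"] Z(1) Z(2)[of p] L by (auto simp: abs_mult spN intro!: mult_mono)
  qed
qed

section \<open>The logarithmic cutoff\<close>

text \<open>The spatial part \<open>(1 + \<bar>x\<bar>\<^sup>2) powr (\<alpha> / 2)\<close> of the parabolic size \<open>S\<close> is switched off on the
  unit ball, where nothing is assumed about the size of the coefficients for large times.\<close>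

locale parabolic_cutoff =
  fixes \<eta> \<eta>' :: "real \<Rightarrow> real" and M \<alpha> :: real
  assumes eta: "smooth_on \<eta> UNIV" "\<And>x. (\<eta> has_real_derivative \<eta>' x) (at x)"
    "\<And>x. x \<le> 1 \<Longrightarrow> \<eta> x = 1" "\<And>x. 2 \<le> x \<Longrightarrow> \<eta> x = 0" "\<And>x. 0 \<le> \<eta> x" "\<And>x. \<eta> x \<le> 1"
    "\<And>x. \<eta>' x \<le> 0" "\<And>x. \<bar>\<eta>' x\<bar> \<le> M" "\<And>x. x \<le> 1 \<Longrightarrow> \<eta>' x = 0" "\<And>x. 2 \<le> x \<Longrightarrow> \<eta>' x = 0"
    and alpha: "0 < \<alpha>"
begin

lemma M_nonneg: "0 \<le> M"
  using eta(8)[of 0] by linarith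

text \<open>The argument is the squared norm of \<open>x\<close>, which keeps the composition smooth
  for every \<alpha>, also at \<open>x = 0\<close>.\<close>

definition F :: "real \<Rightarrow> real" where
  "F y = (1 + y) powr (\<alpha> / 2) * (1 - \<eta> y)"

definition F' :: "real \<Rightarrow> real" where
  "F' y = \<alpha> / 2 * (1 + y) powr (\<alpha> / 2 - 1) * (1 - \<eta> y) - (1 + y) powr (\<alpha> / 2) * \<eta>' y"

definition S :: "real \<times> (real ^ 'n) \<Rightarrow> real" where
  "S p = fst p + F (snd p \<bullet> snd p)"

definition \<psi> :: "real \<Rightarrow> real \<times> (real ^ 'n) \<Rightarrow> real" where
  "\<psi> N p = \<eta> (ln (S p) / N)"

definition \<omega> :: "real \<Rightarrow> real \<times> (real ^ 'n) \<Rightarrow> real" where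
  "\<omega> \<tau> p = 1 - \<eta> (fst p / \<tau>)"

definition shell :: "real \<Rightarrow> (real \<times> (real ^ 'n)) set" where
  "shell N = {p \<in> half_space. exp N \<le> S p \<and> S p \<le> exp (2 * N)}"

lemma F_nonneg: "0 \<le> F y"
  using eta(6)[of y] by (simp add: F_def)

lemma F_eq: "2 \<le> y \<Longrightarrow> F y = (1 + y) powr (\<alpha> / 2)"
  by (simp add: F_def eta(4))

lemma F_deriv: "-1 < y \<Longrightarrow> (F has_real_derivative F' y) (at y)"
proof -
  assume y: "-1 < y"
  have "((\<lambda>y. (1 + y) powr (\<alpha> / 2)) has_real_derivative \<alpha> / 2 * (1 + y) powr (\<alpha> / 2 - 1) * 1) (at y)"
    by (rule DERIV_fun_powr[unfolded of_nat_1]) (use y in \<open>auto intro!: derivative_eq_intros\<close>)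
  from DERIV_mult[OF this DERIV_diff[OF DERIV_const[of 1] eta(2)]]
  show "(F has_real_derivative F' y) (at y)"
    by (simp add: F_def[abs_def] F'_def algebra_simps)
qed

lemma F'_zero: "y \<le> 1 \<Longrightarrow> F' y = 0"
  by (simp add: F'_def eta)

text \<open>\<open>\<eta>'\<close> lives on \<open>1 \<le> y \<le> 2\<close>, where
  \<open>1 + y \<le> 3\<close> trades one power of \<open>1 + y\<close> for the factor 3; this is
  the origin of \<open>3 * M\<close>.\<close>

lemma F'_bound:
  assumes "1 \<le> y"
  shows "\<bar>F' y\<bar> \<le> (\<alpha> / 2 + 3 * M) * (1 + y) powr (\<alpha> / 2 - 1)"
proof -
  have 1: "\<bar>\<alpha> / 2 * (1 + y) powr (\<alpha> / 2 - 1) * (1 - \<eta> y)\<bar> \<le> \<alpha> / 2 * (1 + y) powr (\<alpha> / 2 - 1) * 1"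
    unfolding abs_mult using alpha eta(5,6)[of y] by (intro mult_mono) auto
  have 2: "\<bar>(1 + y) powr (\<alpha> / 2) * \<eta>' y\<bar> \<le> 3 * M * (1 + y) powr (\<alpha> / 2 - 1)"
  proof (cases "y \<le> 2")
    case True
    have "(1 + y) powr (\<alpha> / 2) = (1 + y) * (1 + y) powr (\<alpha> / 2 - 1)"
      using assms by (simp add: powr_diff)
    also have "\<dots> \<le> 3 * (1 + y) powr (\<alpha> / 2 - 1)" using True by (intro mult_right_mono) auto
    finally have "(1 + y) powr (\<alpha> / 2) * \<bar>\<eta>' y\<bar> \<le> (3 * (1 + y) powr (\<alpha> / 2 - 1)) * M"
      using eta(8)[of y] by (intro mult_mono) auto
    then show ?thesis by (simp add: abs_mult ac_simps)
  next
    case False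
    then show ?thesis using M_nonneg by (simp add: eta)
  qed
  show ?thesis using 1 2 abs_triangle_ineq4[of "\<alpha> / 2 * (1 + y) powr (\<alpha> / 2 - 1) * (1 - \<eta> y)" "(1 + y) powr (\<alpha> / 2) * \<eta>' y"]
    unfolding F'_def by (simp add: algebra_simps)
qed

lemma S_pos: "p \<in> half_space \<Longrightarrow> 0 < S p"
  using F_nonneg by (auto simp: S_def half_space_def intro: add_pos_nonneg)

lemma smooth_on_F: "smooth_on F {-1<..}"
proof -
  have "smooth_on (\<lambda>y::real. (1 + y) powr (\<alpha> / 2)) {-1<..}"
    by (rule smooth_on_compose[OF _ _ _ _ smooth_on_powr])
      (auto intro!: smooth_on_add smooth_on_const smooth_on_ident)
  then show ?thesis
    unfolding F_def[abs_def]
    by (intro smooth_on_mult smooth_on_diff smooth_on_const smooth_on_subset[OF _ _ _ eta(1)]) auto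
qed

lemma smooth_on_norm_square: "smooth_on (\<lambda>p :: real \<times> (real ^ 'n). snd p \<bullet> snd p) UNIV"
proof -
  have l: "bounded_linear (\<lambda>p :: real \<times> (real ^ 'n). snd p $ i)" for i
    by (intro bounded_linear_compose[OF bounded_linear_vec_nth] bounded_linear_snd)
  have "smooth_on (\<lambda>p :: real \<times> (real ^ 'n). \<Sum>i\<in>UNIV. snd p $ i * snd p $ i) UNIV"
    by (intro smooth_on_sum smooth_on_mult smooth_on_bounded_linear l) auto
  then show ?thesis by (simp add: inner_vec_def)
qed

lemma smooth_on_S_UNIV: "smooth_on (S :: real \<times> (real ^ 'n) \<Rightarrow> real) UNIV"
proof -
  have "smooth_on (\<lambda>p :: real \<times> (real ^ 'n). F (snd p \<bullet> snd p)) UNIV"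
    by (rule smooth_on_compose[OF _ _ _ smooth_on_norm_square smooth_on_F])
      (auto intro: less_le_trans[of _ 0])
  then show ?thesis
    unfolding S_def[abs_def]
    by (rule smooth_on_add[OF open_UNIV smooth_on_bounded_linear[OF bounded_linear_fst]])
qed

lemma smooth_on_S: "smooth_on (S :: real \<times> (real ^ 'n) \<Rightarrow> real) half_space"
  using smooth_on_S_UNIV by (rule smooth_on_subset[OF open_UNIV half_space_sets(1) subset_UNIV])

lemma smooth_on_psi: "smooth_on (\<psi> N :: real \<times> (real ^ 'n) \<Rightarrow> real) half_space"
proof -
  have "smooth_on (\<lambda>p :: real \<times> (real ^ 'n). ln (S p)) half_space"
    by (rule smooth_on_compose[OF half_space_sets(1) _ _ smooth_on_S smooth_on_ln]) (auto simp: S_pos)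
  then have "smooth_on (\<lambda>p :: real \<times> (real ^ 'n). ln (S p) * inverse N) half_space"
    by (intro smooth_on_mult smooth_on_const half_space_sets(1))
  then show ?thesis
    unfolding \<psi>_def[abs_def] divide_inverse
    by (intro smooth_on_compose[OF half_space_sets(1) open_UNIV _ _ eta(1)]) auto
qed

lemma smooth_on_omega: "smooth_on (\<omega> \<tau> :: real \<times> (real ^ 'n) \<Rightarrow> real) half_space"
proof -
  have "smooth_on (\<lambda>p :: real \<times> (real ^ 'n). fst p * inverse \<tau>) half_space"
    by (intro smooth_on_mult smooth_on_const half_space_sets(1) smooth_on_bounded_linear bounded_linear_fst)
  then show ?thesis
    unfolding \<omega>_def[abs_def] divide_inverse
    by (intro smooth_on_diff smooth_on_const half_space_sets(1)
      smooth_on_compose[OF half_space_sets(1) open_UNIV _ _ eta(1)]) auto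
qed

definition \<zeta> :: "real \<Rightarrow> real \<Rightarrow> nat \<Rightarrow> real \<times> (real ^ 'n) \<Rightarrow> real" where
  "\<zeta> \<tau> N m p = \<omega> \<tau> p * \<psi> N p ^ m"

lemma smooth_on_zeta: "smooth_on (\<zeta> \<tau> N m :: real \<times> (real ^ 'n) \<Rightarrow> real) half_space"
  unfolding \<zeta>_def[abs_def]
  by (intro smooth_on_mult smooth_on_power smooth_on_omega smooth_on_psi half_space_sets(1))

lemma psi_range: "0 \<le> \<psi> N p" "\<psi> N p \<le> 1"
  by (simp_all add: \<psi>_def eta)

lemma omega_range: "0 \<le> \<omega> \<tau> p" "\<omega> \<tau> p \<le> 1"
  by (simp_all add: \<omega>_def eta)

lemma zeta_range: "0 \<le> \<zeta> \<tau> N m p" "\<zeta> \<tau> N m p \<le> 1"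
proof -
  have "\<psi> N p ^ m \<le> 1" using psi_range by (rule power_le_one)
  then show "\<zeta> \<tau> N m p \<le> 1" "0 \<le> \<zeta> \<tau> N m p"
    using psi_range(1)[of N p] omega_range[of \<tau> p] mult_mono[of "\<omega> \<tau> p" 1 "\<psi> N p ^ m" 1]
    by (simp_all add: \<zeta>_def)
qed

lemma S_has_derivative:
  fixes p :: "real \<times> (real ^ 'n)"
  shows "frechet_derivative S (at p) h = fst h + F' (snd p \<bullet> snd p) * (2 * (snd p \<bullet> snd h))"
proof -
  let ?x = "snd p"
  have 1: "((\<lambda>p :: real \<times> (real ^ 'n). snd p \<bullet> snd p) has_derivative (\<lambda>h. snd p \<bullet> snd h + snd h \<bullet> snd p)) (at p)"
    by (intro derivative_intros)
  have "-1 < ?x \<bullet> ?x" by (rule less_le_trans[of _ 0]) auto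
  from F_deriv[OF this, unfolded has_field_derivative_def]
  have 2: "((\<lambda>p :: real \<times> (real ^ 'n). F (snd p \<bullet> snd p)) has_derivative
      (\<lambda>h. F' (?x \<bullet> ?x) * (snd p \<bullet> snd h + snd h \<bullet> snd p))) (at p)"
    by (rule has_derivative_compose[OF 1])
  have 3: "(fst has_derivative (fst :: real \<times> (real ^ 'n) \<Rightarrow> real)) (at p)"
    by (intro derivative_intros)
  have "(S has_derivative (\<lambda>h. fst h + F' (?x \<bullet> ?x) * (snd p \<bullet> snd h + snd h \<bullet> snd p))) (at p)"
    using has_derivative_add[OF 3 2] by (simp add: S_def[abs_def])
  from frechet_derivative_at[OF this, symmetric] show ?thesis
    by (simp add: inner_commute)
qed

lemma psi_derivative:
  fixes p :: "real \<times> (real ^ 'n)"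
  assumes "p \<in> half_space" "0 < N"
  shows "frechet_derivative (\<psi> N) (at p) h = \<eta>' (ln (S p) / N) / (N * S p) * frechet_derivative S (at p) h"
proof -
  have d: "((\<lambda>r. \<eta> (ln r / N)) has_real_derivative \<eta>' (ln (S p) / N) * (1 / S p / N)) (at (S p))"
    by (rule DERIV_chain2[OF eta(2)]) (use S_pos[OF assms(1)] assms(2) in \<open>auto intro!: derivative_eq_intros\<close>)
  have "S differentiable at p"
    by (rule smooth_on_imp_differentiable[OF smooth_on_S half_space_sets(1) assms(1)])
  from frechet_derivative_compose_has_real_derivative[OF this d]
  show ?thesis by (simp add: \<psi>_def[abs_def] mult.commute)
qed

lemma omega_derivative:
  fixes p :: "real \<times> (real ^ 'n)"
  assumes "0 < \<tau>"
  shows "frechet_derivative (\<omega> \<tau>) (at p) h = - \<eta>' (fst p / \<tau>) / \<tau> * fst h"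
proof -
  have d: "((\<lambda>r. 1 - \<eta> (r / \<tau>)) has_real_derivative 0 - \<eta>' (fst p / \<tau>) * (1 / \<tau>)) (at (fst p))"
    by (rule DERIV_diff[OF DERIV_const DERIV_chain2[OF eta(2)]])
      (use assms in \<open>auto intro!: derivative_eq_intros\<close>)
  have b: "(fst has_derivative (fst :: real \<times> (real ^ 'n) \<Rightarrow> real)) (at p)"
    by (intro derivative_intros)
  then have "(fst :: real \<times> (real ^ 'n) \<Rightarrow> real) differentiable at p"
    by (auto simp: differentiable_def)
  from frechet_derivative_compose_has_real_derivative[OF this d]
  show ?thesis using frechet_derivative_at[OF b, symmetric] by (simp add: \<omega>_def[abs_def])
qed

lemma zeta_derivative:
  fixes p :: "real \<times> (real ^ 'n)"
  assumes "p \<in> half_space" "0 < N" "0 < \<tau>"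
  shows "frechet_derivative (\<zeta> \<tau> N m) (at p) h
    = real m * \<omega> \<tau> p * \<psi> N p ^ (m - 1) * frechet_derivative (\<psi> N) (at p) h - \<eta>' (fst p / \<tau>) / \<tau> * fst h * \<psi> N p ^ m"
proof -
  have d: "\<psi> N differentiable at p" "\<omega> \<tau> differentiable at p"
    by (rule smooth_on_imp_differentiable[OF _ half_space_sets(1) assms(1)], rule smooth_on_psi smooth_on_omega)+
  have dp: "((\<lambda>r. r ^ m) has_real_derivative real m * \<psi> N p ^ (m - 1)) (at (\<psi> N p))"
    using DERIV_pow[of m "\<psi> N p"] by simp
  have "(\<lambda>p. \<psi> N p ^ m) differentiable at p"
    by (rule smooth_on_imp_differentiable[OF smooth_on_power[OF half_space_sets(1) smooth_on_psi] half_space_sets(1) assms(1)])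
  from frechet_derivative_mult_real[OF d(2) this]
    frechet_derivative_compose_has_real_derivative[OF d(1) dp]
  show ?thesis by (simp add: \<zeta>_def[abs_def] omega_derivative[OF assms(3)])
qed

lemma grad_zeta:
  fixes p :: "real \<times> (real ^ 'n)"
  assumes "p \<in> half_space" "0 < N" "0 < \<tau>"
  shows "grad (\<zeta> \<tau> N m) p = (real m * \<omega> \<tau> p * \<psi> N p ^ (m - 1)) *\<^sub>R grad (\<psi> N) p"
  using zeta_derivative[OF assms] by (simp add: grad_def dx_def vec_eq_iff)

lemma grad_psi:
  fixes p :: "real \<times> (real ^ 'n)"
  assumes "p \<in> half_space" "0 < N"
  shows "grad (\<psi> N) p = (\<eta>' (ln (S p) / N) / (N * S p) * (2 * F' (snd p \<bullet> snd p))) *\<^sub>R snd p"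
  using psi_derivative[OF assms] by (simp add: grad_def dx_def vec_eq_iff S_has_derivative inner_axis)

lemma ln_le_exp: "0 < x \<Longrightarrow> ln (x::real) \<le> y \<longleftrightarrow> x \<le> exp y"
  using ln_le_cancel_iff[of x "exp y"] by simp

lemma eta'_shell:
  fixes p :: "real \<times> (real ^ 'n)"
  assumes "p \<in> half_space" "0 < N" "\<eta>' (ln (S p) / N) \<noteq> 0"
  shows "p \<in> shell N"
proof -
  have "1 \<le> ln (S p) / N" "ln (S p) / N \<le> 2" using assms(3) eta(9,10) by (meson linear)+
  then have "N \<le> ln (S p)" "ln (S p) \<le> 2 * N" using assms(2) by (auto simp: field_simps)
  then show ?thesis using S_pos[OF assms(1)] assms(1) by (simp add: shell_def ln_ge_iff ln_le_exp)
qed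

lemma dt_zeta:
  fixes p :: "real \<times> (real ^ 'n)"
  assumes "p \<in> half_space" "0 < N" "0 < \<tau>"
  shows "- dt (\<zeta> \<tau> N m) p \<le> real m * M * (\<omega> \<tau> p * \<psi> N p ^ (m - 1)) * (indicator (shell N) p / (N * S p))"
proof -
  let ?e = "\<eta>' (ln (S p) / N)"
  have S: "0 < S p" using S_pos[OF assms(1)] .
  have "- ?e / (N * S p) \<le> M * (indicator (shell N) p / (N * S p))"
  proof (cases "?e = 0")
    case True
    then show ?thesis using S assms(2) M_nonneg by simp
  next
    case False
    have "- ?e / (N * S p) \<le> M / (N * S p)"
      by (rule divide_right_mono) (use eta(7,8)[of "ln (S p) / N"] S assms(2) in auto)
    then show ?thesis using eta'_shell[OF assms(1,2) False] by simp
  qed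
  then have "(real m * \<omega> \<tau> p * \<psi> N p ^ (m - 1)) * (- ?e / (N * S p))
      \<le> (real m * \<omega> \<tau> p * \<psi> N p ^ (m - 1)) * (M * (indicator (shell N) p / (N * S p)))"
    using psi_range(1)[of N p] omega_range(1)[of \<tau> p] by (intro mult_left_mono) auto
  \<comment> \<open>This term can be as large as \<open>M / \<tau>\<close>, but its sign lets it be
    dropped, so the estimate is uniform in \<tau>.\<close>
  moreover have "\<eta>' (fst p / \<tau>) / \<tau> * \<psi> N p ^ m \<le> 0"
    using eta(7)[of "fst p / \<tau>"] assms(3) psi_range(1)[of N p] by (intro mult_nonpos_nonneg divide_nonpos_pos) auto
  ultimately show ?thesis
    using zeta_derivative[OF assms, of m "(1, 0)"] psi_derivative[OF assms(1,2), of "(1, 0)"]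
    by (simp add: dt_def S_has_derivative algebra_simps)
qed

text \<open>This is the quotient \<open>grad_form a (\<zeta> \<tau> N m) (\<zeta> \<tau> N m) /
  \<zeta> \<tau> N m\<close> after cancelling one \<omega> and \<open>\<psi> ^ m\<close>. Written
  without division it also makes sense where \<zeta> vanishes.\<close>

definition energy_weight :: "'n coeffs \<Rightarrow> real \<Rightarrow> real \<Rightarrow> nat \<Rightarrow> real \<times> (real ^ 'n) \<Rightarrow> real" where
  "energy_weight a \<tau> N m p = (real m)\<^sup>2 * (\<omega> \<tau> p * \<psi> N p ^ (m - 2)) * grad_form a (\<psi> N) (\<psi> N) p"

lemma energy_weight_Cauchy_Schwarz:
  fixes p :: "real \<times> (real ^ 'n)"
  assumes "p \<in> half_space" "0 < N" "0 < \<tau>" "psd_at a p" "2 \<le> m"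
  shows "(coeff_form a p (grad (\<zeta> \<tau> N m) p) x)\<^sup>2 \<le> energy_weight a \<tau> N m p * \<zeta> \<tau> N m p * coeff_form a p x x"
proof -
  have m: "2 * (m - 1) = (m - 2) + m" using assms(5) by simp
  let ?g = "grad (\<psi> N) p"
  have "(coeff_form a p (grad (\<zeta> \<tau> N m) p) x)\<^sup>2 = ((real m)\<^sup>2 * (\<omega> \<tau> p)\<^sup>2 * \<psi> N p ^ (2 * (m - 1))) * (coeff_form a p ?g x)\<^sup>2"
    unfolding grad_zeta[OF assms(1-3)] by (simp add: coeff_form_bilinear power_mult_distrib power_mult[symmetric] mult.commute)
  also have "\<dots> \<le> ((real m)\<^sup>2 * (\<omega> \<tau> p)\<^sup>2 * \<psi> N p ^ (2 * (m - 1))) * (coeff_form a p ?g ?g * coeff_form a p x x)"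
    using psd_at_Cauchy_Schwarz[OF assms(4)] psi_range(1)[of N p] by (intro mult_left_mono) auto
  also have "\<dots> = energy_weight a \<tau> N m p * \<zeta> \<tau> N m p * coeff_form a p x x"
    unfolding m power_add by (simp add: energy_weight_def \<zeta>_def grad_form_eq power2_eq_square)
  finally show ?thesis .
qed

text \<open>Origin of the factors: the square of \<open>M\<close> comes from \<open>\<eta>'\<close>,
  the 4 from the gradient of the squared norm, the next square from \<open>F'_bound\<close>,
  \<open>2 powr (\<alpha> / 2)\<close> from comparing \<open>y\<close> with
  \<open>(1 + y) / 2\<close>, and \<open>3 powr (\<alpha> / 2)\<close> from
  \<open>one_plus_powr_le_S\<close>.\<close>

definition energy_const :: "real \<Rightarrow> real" where
  "energy_const c = M\<^sup>2 * (4 * c * (\<alpha> / 2 + 3 * M)\<^sup>2 * 2 powr (\<alpha> / 2) * 3 powr (\<alpha> / 2))"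

text \<open>For \<open>snd p \<bullet> snd p \<le> 2\<close> the cutoff in \<open>F\<close> may
  remove the spatial part of \<open>S\<close>, but there the power is bounded and
  \<open>1 \<le> S p\<close> pays for it. Beyond, \<open>F\<close> is the full power.\<close>

lemma one_plus_powr_le_S:
  fixes p :: "real \<times> (real ^ 'n)"
  assumes "p \<in> half_space" "1 \<le> S p"
  shows "(1 + snd p \<bullet> snd p) powr (\<alpha> / 2) \<le> 3 powr (\<alpha> / 2) * S p"
proof (cases "snd p \<bullet> snd p \<le> 2")
  case True
  have "(1 + snd p \<bullet> snd p) powr (\<alpha> / 2) \<le> 3 powr (\<alpha> / 2)"
    using True alpha by (intro powr_mono2) auto
  also have "\<dots> \<le> 3 powr (\<alpha> / 2) * S p" using assms(2) by simp
  finally show ?thesis .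
next
  case False
  have "(1 + snd p \<bullet> snd p) powr (\<alpha> / 2) \<le> S p"
    using assms(1) False by (auto simp: S_def F_eq half_space_def)
  also have "\<dots> = 1 * S p" by simp
  also have "\<dots> \<le> 3 powr (\<alpha> / 2) * S p"
    using alpha assms(2) by (intro mult_right_mono ge_one_powr_ge_zero) auto
  finally show ?thesis .
qed

text \<open>Scaling with \<open>y = snd p \<bullet> snd p\<close>: the coefficients are of order
  \<open>y powr (1 - \<alpha> / 2)\<close>, the square of \<open>F'\<close> is of order
  \<open>y powr (\<alpha> - 2)\<close>, and the last factor is \<open>y\<close>. The product is of
  order \<open>y powr (\<alpha> / 2)\<close>, which \<open>S\<close> dominates; the growth exponent
  \<open>2 - \<alpha>\<close> is what makes this balance. In the unit ball \<open>F'\<close>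
  vanishes.\<close>

lemma gradient_energy_bound:
  fixes p :: "real \<times> (real ^ 'n)"
  assumes p: "p \<in> half_space" "1 \<le> S p" and c: "0 \<le> c"
    and A: "0 \<le> A" "1 \<le> norm (snd p) \<Longrightarrow> A \<le> c * norm (snd p) powr (2 - \<alpha>)"
  shows "A * (2 * F' (snd p \<bullet> snd p))\<^sup>2 * (snd p \<bullet> snd p)
    \<le> 4 * c * (\<alpha> / 2 + 3 * M)\<^sup>2 * 2 powr (\<alpha> / 2) * 3 powr (\<alpha> / 2) * S p"
proof -
  define y where "y = snd p \<bullet> snd p"
  define K where "K = \<alpha> / 2 + 3 * M"
  have K: "0 < K" using alpha M_nonneg by (simp add: K_def add_pos_nonneg)
  show ?thesis
  proof (cases "y \<le> 1")
    case True
    then show ?thesis using c p(2) by (simp add: F'_zero y_def)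
  next
    case False
    then have y: "1 < y" by simp
    have ny: "norm (snd p) = y powr (1/2)"
      using y by (simp add: y_def norm_eq_sqrt_inner powr_half_sqrt)
    have "1 \<le> norm (snd p)" unfolding ny using y by (intro ge_one_powr_ge_zero) auto
    then have "A \<le> c * (y powr (1/2)) powr (2 - \<alpha>)" using A(2) ny by simp
    then have A': "A \<le> c * y powr (1 - \<alpha> / 2)" by (simp add: powr_powr diff_divide_distrib)
    have "(2 * F' y)\<^sup>2 = 4 * \<bar>F' y\<bar>\<^sup>2" by (simp add: power_mult_distrib)
    also have "\<dots> \<le> 4 * (K * (1 + y) powr (\<alpha> / 2 - 1))\<^sup>2"
      using F'_bound[of y] y K by (intro mult_left_mono power_mono) (auto simp: K_def)
    also have "\<dots> = 4 * K\<^sup>2 * (1 + y) powr (\<alpha> - 2)"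
      by (simp add: power_mult_distrib power2_eq_square powr_add[symmetric])
    finally have F: "(2 * F' y)\<^sup>2 \<le> 4 * K\<^sup>2 * (1 + y) powr (\<alpha> - 2)" .
    have "A * (2 * F' y)\<^sup>2 * y \<le> (c * y powr (1 - \<alpha> / 2)) * (4 * K\<^sup>2 * (1 + y) powr (\<alpha> - 2)) * y"
      using A' F y A(1) c by (intro mult_right_mono mult_mono) auto
    also have "\<dots> = 4 * c * K\<^sup>2 * ((y * y powr (1 - \<alpha> / 2)) * (1 + y) powr (\<alpha> - 2))"
      by simp
    \<comment> \<open>The product is split because the positive power can be enlarged to
      \<open>1 + y\<close> at once, while the negative power needs
      \<open>(1 + y) / 2 \<le> y\<close>.\<close>
    also have "y * y powr (1 - \<alpha> / 2) = y powr 2 * y powr (- (\<alpha> / 2))"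
      using y by (simp add: powr_diff powr_minus_divide power2_eq_square)
    also have "4 * c * K\<^sup>2 * ((y powr 2 * y powr (- (\<alpha> / 2))) * (1 + y) powr (\<alpha> - 2))
        \<le> 4 * c * K\<^sup>2 * (((1 + y) powr 2 * (2 powr (\<alpha> / 2) * (1 + y) powr (- (\<alpha> / 2)))) * (1 + y) powr (\<alpha> - 2))"
    proof (intro mult_left_mono mult_right_mono mult_mono)
      show "y powr 2 \<le> (1 + y) powr 2" using y by (intro powr_mono2) auto
      have "y powr (- (\<alpha> / 2)) \<le> ((1 + y) / 2) powr (- (\<alpha> / 2))"
        using y alpha by (intro powr_mono2') auto
      also have "\<dots> = 2 powr (\<alpha> / 2) * (1 + y) powr (- (\<alpha> / 2))"
        using y by (simp add: powr_divide powr_minus field_simps)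
      finally show "y powr (- (\<alpha> / 2)) \<le> 2 powr (\<alpha> / 2) * (1 + y) powr (- (\<alpha> / 2))" .
    qed (use c in auto)
    also have "\<dots> = 4 * c * K\<^sup>2 * 2 powr (\<alpha> / 2) * ((1 + y) powr 2 * (1 + y) powr (- (\<alpha> / 2)) * (1 + y) powr (\<alpha> - 2))"
      by (simp add: ac_simps)
    also have "(1 + y) powr 2 * (1 + y) powr (- (\<alpha> / 2)) * (1 + y) powr (\<alpha> - 2) = (1 + y) powr (\<alpha> / 2)"
      by (simp only: powr_add[symmetric]) simp
    also have "4 * c * K\<^sup>2 * 2 powr (\<alpha> / 2) * (1 + y) powr (\<alpha> / 2) \<le> 4 * c * K\<^sup>2 * 2 powr (\<alpha> / 2) * (3 powr (\<alpha> / 2) * S p)"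
      using one_plus_powr_le_S[OF p] c by (intro mult_left_mono) (auto simp: y_def)
    finally show ?thesis by (simp add: y_def K_def ac_simps)
  qed
qed

text \<open>The squared derivative of the logarithm gives \<open>1 / (N * S p) ^ 2\<close>, and
  \<open>gradient_energy_bound\<close> returns one factor \<open>S p\<close>. Compared with
  \<open>dt_zeta\<close> an additional \<open>1 / N\<close> remains; it pays for the factor
  \<open>1 / \<nu>\<close> of the absorbed gradient.\<close>

lemma energy_weight_bound:
  fixes p :: "real \<times> (real ^ 'n)"
  assumes p: "p \<in> half_space" and N: "1 \<le> N" and c: "0 \<le> c"
    and A: "0 \<le> A" "1 \<le> norm (snd p) \<Longrightarrow> A \<le> c * norm (snd p) powr (2 - \<alpha>)"
    and form: "\<And>\<xi>. coeff_form a p \<xi> \<xi> \<le> A * (norm \<xi>)\<^sup>2"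
  shows "energy_weight a \<tau> N m p
    \<le> (real m)\<^sup>2 * (\<omega> \<tau> p * \<psi> N p ^ (m - 2)) * (energy_const c / N * (indicator (shell N) p / (N * S p)))"
proof -
  have N0: "0 < N" using N by simp
  have S: "0 < S p" using S_pos[OF p] .
  let ?e = "\<eta>' (ln (S p) / N)" and ?x = "snd p"
  have "grad_form a (\<psi> N) (\<psi> N) p \<le> energy_const c / N * (indicator (shell N) p / (N * S p))"
  proof (cases "?e = 0")
    case True
    have "0 \<le> energy_const c / N * (indicator (shell N) p / (N * S p))"
      using c N0 S by (auto simp: energy_const_def)
    then show ?thesis using True by (simp add: grad_form_eq grad_psi[OF p N0] coeff_form_def)
  next
    case False
    have sh: "p \<in> shell N" by (rule eta'_shell[OF p N0 False])
    have "1 \<le> exp N" using N0 by simp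
    also have "exp N \<le> S p" using sh by (simp add: shell_def)
    finally have S1: "1 \<le> S p" .
    let ?r = "?e / (N * S p)"
    let ?B = "4 * c * (\<alpha> / 2 + 3 * M)\<^sup>2 * 2 powr (\<alpha> / 2) * 3 powr (\<alpha> / 2)"
    have r: "?r\<^sup>2 \<le> M\<^sup>2 / (N * S p)\<^sup>2"
    proof -
      have "\<bar>?e\<bar>\<^sup>2 \<le> M\<^sup>2" using eta(8) by (intro power_mono) auto
      then show ?thesis unfolding power_divide by (intro divide_right_mono) auto
    qed
    have "grad_form a (\<psi> N) (\<psi> N) p \<le> A * (norm ((?r * (2 * F' (?x \<bullet> ?x))) *\<^sub>R ?x))\<^sup>2"
      unfolding grad_form_eq grad_psi[OF p N0] by (rule form)
    also have "\<dots> = ?r\<^sup>2 * (A * (2 * F' (?x \<bullet> ?x))\<^sup>2 * (?x \<bullet> ?x))"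
      by (simp add: power_mult_distrib power2_norm_eq_inner power_divide)
    also have "\<dots> \<le> (M\<^sup>2 / (N * S p)\<^sup>2) * (?B * S p)"
      by (rule mult_mono[OF r gradient_energy_bound[OF p S1 c A]]) (use A(1) in auto)
    also have "\<dots> = energy_const c / N * (1 / (N * S p))"
      using S N0 by (simp add: energy_const_def power2_eq_square)
    finally show ?thesis using sh by simp
  qed
  then show ?thesis
    unfolding energy_weight_def using psi_range(1)[of N p] omega_range(1)[of \<tau> p]
    by (intro mult_left_mono) auto
qed

lemma exp_less_ln: "0 < x \<Longrightarrow> exp y < x \<longleftrightarrow> y < ln (x::real)"
  using ln_less_cancel_iff[of "exp y" x] by simp

text \<open>If \<open>norm (snd p)\<close> exceeds 2, then \<open>F\<close> is the full power and at
  least \<open>norm (snd p) powr \<alpha>\<close>. Otherwise the bound is trivial since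
  \<open>1 \<le> T\<close>; the factor 2 covers this case.\<close>

lemma sublevel_bounds:
  fixes p :: "real \<times> (real ^ 'n)"
  assumes "p \<in> half_space" "S p \<le> T" "1 \<le> T"
  shows "0 < fst p" "fst p \<le> T" "norm (snd p) \<le> 2 * T powr (1 / \<alpha>)"
proof -
  show "0 < fst p" using assms(1) by (auto simp: half_space_def)
  show "fst p \<le> T" using assms(2) F_nonneg[of "snd p \<bullet> snd p"] by (simp add: S_def)
  have T: "1 \<le> T powr (1 / \<alpha>)" using assms(3) alpha by (intro ge_one_powr_ge_zero) auto
  show "norm (snd p) \<le> 2 * T powr (1 / \<alpha>)"
  proof (cases "norm (snd p) \<le> 2")
    case True
    then show ?thesis using T by simp
  next
    case False
    let ?r = "norm (snd p)"
    have r: "snd p \<bullet> snd p = ?r\<^sup>2" by (simp add: power2_norm_eq_inner)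
    have "2\<^sup>2 \<le> ?r\<^sup>2" using False by (intro power_mono) auto
    then have "F (snd p \<bullet> snd p) = (1 + ?r\<^sup>2) powr (\<alpha> / 2)" unfolding r by (intro F_eq) simp
    then have "(1 + ?r\<^sup>2) powr (\<alpha> / 2) \<le> T" using assms(2) \<open>0 < fst p\<close> by (simp add: S_def)
    moreover have "(?r\<^sup>2) powr (\<alpha> / 2) \<le> (1 + ?r\<^sup>2) powr (\<alpha> / 2)" using alpha by (intro powr_mono2) auto
    moreover have "(?r\<^sup>2) powr (\<alpha> / 2) = ?r powr \<alpha>"
      using False powr_powr[of ?r 2 "\<alpha> / 2"] by (simp add: powr_numeral)
    ultimately have "(?r powr \<alpha>) powr (1 / \<alpha>) \<le> T powr (1 / \<alpha>)"
      using alpha by (intro powr_mono2) auto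
    then have "?r \<le> T powr (1 / \<alpha>)" using alpha False by (simp add: powr_powr)
    then show ?thesis using T by simp
  qed
qed

lemma zeta_support:
  fixes p :: "real \<times> (real ^ 'n)"
  assumes "p \<in> half_space" "0 < \<tau>" "1 \<le> N" "1 \<le> m"
    and "p \<notin> {\<tau>..exp (2 * N)} \<times> cball 0 (2 * exp (2 * N) powr (1 / \<alpha>))"
  shows "\<zeta> \<tau> N m p = 0"
proof (cases "fst p < \<tau>")
  case True
  then show ?thesis using assms(2) by (simp add: \<zeta>_def \<omega>_def eta(3))
next
  case False
  then have "\<not> (fst p \<le> exp (2 * N) \<and> norm (snd p) \<le> 2 * exp (2 * N) powr (1 / \<alpha>))"
    using assms(5) by (cases p) auto
  moreover have "1 \<le> exp (2 * N)" using assms(3) by simp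
  ultimately have "\<not> S p \<le> exp (2 * N)"
    using sublevel_bounds[OF assms(1)] by blast
  then have "2 * N < ln (S p)" using S_pos[OF assms(1)] by (simp add: exp_less_ln not_le)
  then have "2 \<le> ln (S p) / N" using assms(3) by (simp add: field_simps)
  then show ?thesis using assms(4) by (simp add: \<zeta>_def \<psi>_def eta(4))
qed

lemma zeta_eq_1:
  fixes p :: "real \<times> (real ^ 'n)"
  assumes "p \<in> half_space" "0 < \<tau>" "0 < N" "2 * \<tau> \<le> fst p" "S p \<le> exp N"
  shows "\<zeta> \<tau> N m p = 1"
proof -
  have "2 \<le> fst p / \<tau>" using assms by (simp add: field_simps)
  moreover have "ln (S p) \<le> N" using assms(5) S_pos[OF assms(1)] by (simp add: ln_le_exp)
  then have "ln (S p) / N \<le> 1" using assms(3) by simp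
  ultimately show ?thesis by (simp add: \<zeta>_def \<omega>_def \<psi>_def eta(3,4))
qed

text \<open>A box with one side \<open>T\<close> and the other sides
  \<open>4 * T powr (1 / \<alpha>)\<close> contains the sublevel set; its volume is
  explicit.\<close>

lemma sublevel_measure:
  assumes "1 \<le> T"
  shows "{p :: real \<times> (real ^ 'n). p \<in> half_space \<and> S p \<le> T} \<in> sets lebesgue"
    and "emeasure lebesgue {p :: real \<times> (real ^ 'n). p \<in> half_space \<and> S p \<le> T} \<le> 4 ^ CARD('n) * T powr (1 + real CARD('n) / \<alpha>)"
proof -
  let ?V = "{p :: real \<times> (real ^ 'n). p \<in> half_space \<and> S p \<le> T}"
  let ?r = "2 * T powr (1 / \<alpha>)"
  let ?B = "cbox (0, \<chi> i. - ?r) (T, \<chi> i. ?r) :: (real \<times> (real ^ 'n)) set"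
  have "S \<in> borel_measurable (lebesgue_on (half_space :: (real \<times> (real ^ 'n)) set))"
    by (rule continuous_imp_measurable_on_sets_lebesgue[OF smooth_on_imp_continuous_on[OF smooth_on_S] half_space_sets(2)])
  then have "{p \<in> space (lebesgue_on half_space). S p \<le> T} \<in> sets (lebesgue_on (half_space :: (real \<times> (real ^ 'n)) set))"
    by measurable
  then show V: "?V \<in> sets lebesgue"
    using half_space_sets(2) by (auto simp: sets_restrict_space intro: sets.Int)
  have r: "0 \<le> ?r" by simp
  have sub: "?V \<subseteq> ?B"
  proof
    fix p :: "real \<times> (real ^ 'n)" assume "p \<in> ?V"
    then have b: "0 < fst p" "fst p \<le> T" "norm (snd p) \<le> ?r" using sublevel_bounds[of p T] assms by auto
    have "\<bar>snd p $ i\<bar> \<le> ?r" for i using component_le_norm_cart[of "snd p" i] b(3) by linarith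
    then have "- ?r \<le> snd p $ i \<and> snd p $ i \<le> ?r" for i by (simp add: abs_le_iff minus_le_iff)
    then show "p \<in> ?B" using b by (cases p) (auto simp: cbox_Pair_iff mem_box_cart)
  qed
  have cB: "measure lborel ?B = T * (4 * T powr (1 / \<alpha>)) ^ CARD('n)"
  proof -
    have ne: "cbox (\<chi> i. - ?r) (\<chi> i. ?r) \<noteq> ({} :: (real ^ 'n) set)"
    proof -
      have "0 \<in> cbox (\<chi> i. - ?r) (\<chi> i :: 'n. ?r)" using r by (simp add: mem_box_cart)
      then show ?thesis by blast
    qed
    have "measure lborel (cbox (\<chi> i. - ?r) (\<chi> i. ?r) :: (real ^ 'n) set) = (4 * T powr (1 / \<alpha>)) ^ CARD('n)"
      by (simp add: content_cbox_cart[OF ne])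
    moreover have "measure lborel (cbox 0 T) = T" using assms by simp
    ultimately show ?thesis by (simp only: content_Pair)
  qed
  also have "\<dots> = 4 ^ CARD('n) * T powr (1 + real CARD('n) / \<alpha>)"
    using assms by (simp add: power_mult_distrib powr_add powr_power)
  finally have cB: "measure lborel ?B = 4 ^ CARD('n) * T powr (1 + real CARD('n) / \<alpha>)" .
  have "emeasure lebesgue ?V \<le> emeasure lebesgue ?B" by (rule emeasure_mono[OF sub]) simp
  also have "\<dots> = ennreal (measure lborel ?B)"
    using emeasure_eq_ennreal_measure[of lborel ?B] by (simp add: emeasure_lborel_cbox_eq)
  finally show "emeasure lebesgue ?V \<le> 4 ^ CARD('n) * T powr (1 + real CARD('n) / \<alpha>)"
    unfolding cB .
qed

end

section \<open>Integrals over the shell\<close>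

text \<open>The case distinction replaces Young's inequality: either the first summand on the right
  dominates, or \<open>u\<close> is below \<open>\<epsilon>\<close>, or \<open>u powr (q - 1)\<close> is small compared with \<open>\<kappa> / z\<^sup>2\<close>.\<close>

lemma pointwise_absorption:
  fixes q \<nu> \<epsilon> u \<kappa> z C :: real
  assumes q: "1 < q" and \<nu>: "0 < \<nu>" "\<nu> \<le> 1/2" and \<epsilon>: "0 < \<epsilon>" and u: "0 \<le> u" and \<kappa>: "0 \<le> \<kappa>"
    and z: "0 \<le> z" "z \<le> 1" and C: "1 \<le> C" and m: "2 + 2 / (q - 1) \<le> real m"
  shows "C * (u + \<epsilon>) powr (1 - \<nu>) * z ^ (m - 2) * \<kappa>
    \<le> 1 / 8 * (u powr q * (u + \<epsilon>) powr (- \<nu>) * z ^ m)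
      + (2 * C * \<epsilon> powr (1 - \<nu>) * \<kappa> + 2 * C * (16 * C) powr (1 / (q - 1)) * \<kappa> powr (1 + (1 - \<nu>) / (q - 1)))"
    (is "?L \<le> ?X + (?Y + ?Z)")
proof -
  have m2: "2 < m" using m q divide_pos_pos[of 2 "q - 1"] by linarith
  have nn: "0 \<le> ?X" "0 \<le> ?Y" "0 \<le> ?Z" using C \<kappa> z \<epsilon> by auto
  consider "z = 0" | "\<kappa> = 0" | "u \<le> \<epsilon>" | "0 < z" "0 < \<kappa>" "\<epsilon> < u" using z \<kappa> by fastforce
  then show ?thesis
  proof cases
    case 1
    then have "?L = 0" using m2 by (simp add: power_0_left)
    then show ?thesis using nn by linarith
  next
    case 2
    then have "?L = 0" by simp
    then show ?thesis using nn by linarith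
  next
    case 3
    have "(u + \<epsilon>) powr (1 - \<nu>) \<le> (2 * \<epsilon>) powr (1 - \<nu>)" using 3 u \<epsilon> \<nu> by (intro powr_mono2) auto
    also have "\<dots> = 2 powr (1 - \<nu>) * \<epsilon> powr (1 - \<nu>)" using \<epsilon> by (simp add: powr_mult)
    also have "\<dots> \<le> 2 powr 1 * \<epsilon> powr (1 - \<nu>)" using \<nu> by (intro mult_right_mono powr_mono) auto
    finally have pw: "(u + \<epsilon>) powr (1 - \<nu>) \<le> 2 * \<epsilon> powr (1 - \<nu>)" by simp
    have "?L \<le> C * (2 * \<epsilon> powr (1 - \<nu>)) * 1 * \<kappa>"
      using C z \<kappa> pw by (intro mult_mono power_le_one) auto
    also have "\<dots> = ?Y" by simp
    finally show ?thesis using nn by linarith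
  next
    case 4
    have u0: "0 < u" using 4 \<epsilon> by simp
    have "m = (m - 2) + 2" using m2 by simp
    then have zm: "z ^ m = z ^ (m - 2) * z\<^sup>2" by (metis power_add)
    show ?thesis
    \<comment> \<open>The threshold 16 is 2 times 8: the 2 comes from
      \<open>u + \<epsilon> \<le> 2 * u\<close>, the 8 from the target coefficient
      \<open>1 / 8\<close>.\<close>
    proof (cases "16 * C * \<kappa> \<le> u powr (q - 1) * z\<^sup>2")
      case True
      have "(u + \<epsilon>) powr (1 - \<nu>) = (u + \<epsilon>) * (u + \<epsilon>) powr (- \<nu>)"
        using u0 \<epsilon> by (simp add: powr_diff powr_minus_divide)
      also have "\<dots> \<le> (2 * u) * (u + \<epsilon>) powr (- \<nu>)" using 4 by (intro mult_right_mono) auto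
      finally have "?L \<le> C * ((2 * u) * (u + \<epsilon>) powr (- \<nu>)) * z ^ (m - 2) * \<kappa>"
        using C z \<kappa> by (intro mult_right_mono mult_left_mono) auto
      also have "\<dots> = 1 / 8 * (u * (u + \<epsilon>) powr (- \<nu>) * z ^ (m - 2)) * (16 * C * \<kappa>)" by simp
      also have "\<dots> \<le> 1 / 8 * (u * (u + \<epsilon>) powr (- \<nu>) * z ^ (m - 2)) * (u powr (q - 1) * z\<^sup>2)"
        using True u0 z by (intro mult_left_mono) auto
      also have "\<dots> = ?X"
        using u0 by (simp add: zm powr_diff)
      finally show ?thesis using nn by linarith
    next
      case False
      \<comment> \<open>Raising the reversed inequality to this power turns
        \<open>u powr (q - 1)\<close> into \<open>u powr (1 - \<nu>)\<close>.\<close>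
      define \<theta> where "\<theta> = (1 - \<nu>) / (q - 1)"
      have \<theta>: "0 \<le> \<theta>" "\<theta> \<le> 1 / (q - 1)" using \<nu> q by (auto simp: \<theta>_def divide_right_mono)
      have "u powr (q - 1) \<le> 16 * C * \<kappa> / z\<^sup>2" using False 4 by (simp add: field_simps)
      then have "(u powr (q - 1)) powr \<theta> \<le> (16 * C * \<kappa> / z\<^sup>2) powr \<theta>" using \<theta> by (intro powr_mono2) auto
      moreover have "(u powr (q - 1)) powr \<theta> = u powr (1 - \<nu>)" using q by (simp add: powr_powr \<theta>_def)
      moreover have "(16 * C * \<kappa> / z\<^sup>2) powr \<theta> = (16 * C) powr \<theta> * \<kappa> powr \<theta> * z powr (- 2 * \<theta>)"
      proof -
        have "(z\<^sup>2) powr \<theta> = z powr (2 * \<theta>)" using 4 powr_powr[of z 2 \<theta>] by (simp add: powr_numeral)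
        then show ?thesis using C 4 by (simp add: powr_divide powr_mult powr_minus_divide)
      qed
      ultimately have u1: "u powr (1 - \<nu>) \<le> (16 * C) powr \<theta> * \<kappa> powr \<theta> * z powr (- 2 * \<theta>)" by simp
      have "(u + \<epsilon>) powr (1 - \<nu>) \<le> (2 * u) powr (1 - \<nu>)" using 4 u0 \<epsilon> \<nu> by (intro powr_mono2) auto
      also have "\<dots> = 2 powr (1 - \<nu>) * u powr (1 - \<nu>)" using u0 by (simp add: powr_mult)
      also have "\<dots> \<le> 2 powr 1 * u powr (1 - \<nu>)" using \<nu> by (intro mult_right_mono powr_mono) auto
      also have "\<dots> \<le> 2 * ((16 * C) powr \<theta> * \<kappa> powr \<theta> * z powr (- 2 * \<theta>))" using u1 by simp
      also have "\<dots> \<le> 2 * ((16 * C) powr (1 / (q - 1)) * \<kappa> powr \<theta> * z powr (- 2 * \<theta>))"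
        using C \<theta> by (intro mult_left_mono mult_right_mono powr_mono) auto
      finally have "?L \<le> C * (2 * ((16 * C) powr (1 / (q - 1)) * \<kappa> powr \<theta> * z powr (- 2 * \<theta>))) * z ^ (m - 2) * \<kappa>"
        using C z \<kappa> by (intro mult_right_mono mult_left_mono) auto
      also have "\<dots> = 2 * C * (16 * C) powr (1 / (q - 1)) * (\<kappa> * \<kappa> powr \<theta>) * (z powr (- 2 * \<theta>) * z ^ (m - 2))"
        by (simp add: ac_simps)
      also have "\<kappa> * \<kappa> powr \<theta> = \<kappa> powr (1 + \<theta>)" using 4 by (simp add: powr_add)
      also have "2 * C * (16 * C) powr (1 / (q - 1)) * \<kappa> powr (1 + \<theta>) * (z powr (- 2 * \<theta>) * z ^ (m - 2))
          \<le> 2 * C * (16 * C) powr (1 / (q - 1)) * \<kappa> powr (1 + \<theta>) * 1"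
      \<comment> \<open>The exponent of \<open>z\<close> left over is
        \<open>m - 2 - 2 * \<theta>\<close>. Since \<open>\<theta> \<le> 1 / (q - 1)\<close>, the
        lower bound on \<open>m\<close> makes it non-negative whatever \<nu> is, so \<open>m\<close>
        can be fixed before \<open>N\<close>.\<close>
      proof (rule mult_left_mono)
        have "z powr (- 2 * \<theta>) * z ^ (m - 2) = z powr (- 2 * \<theta> + real (m - 2))"
          using 4 by (simp only: powr_add powr_realpow)
        also have "\<dots> \<le> z powr 0"
        proof (rule powr_mono')
          have "2 * \<theta> \<le> 2 / (q - 1)" using \<theta>(2) by simp
          then show "0 \<le> - 2 * \<theta> + real (m - 2)" using m m2 by (simp add: of_nat_diff)
        qed (use z in auto)
        finally show "z powr (- 2 * \<theta>) * z ^ (m - 2) \<le> 1" using 4 by simp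
      qed (use C in auto)
      finally have "?L \<le> ?Z" by (simp add: \<theta>_def)
      then show ?thesis using nn by linarith
    qed
  qed
qed

section \<open>Volume of the layers and integrals of \<kappa>\<close>

context parabolic_cutoff
begin

lemma S_borel: "S \<in> borel_measurable (lebesgue :: (real \<times> (real ^ 'n)) measure)"
  using smooth_on_imp_continuous_on[OF smooth_on_S_UNIV[where 'n='n]]
  by (intro measurable_completion) (simp add: borel_measurable_continuous_onI)

lemma shell_sets: "(shell N :: (real \<times> (real ^ 'n)) set) \<in> sets lebesgue"
proof -
  have "{p \<in> space lebesgue. exp N \<le> S p \<and> S p \<le> exp (2 * N)} \<in> sets (lebesgue :: (real \<times> (real ^ 'n)) measure)"
    using S_borel[where 'n='n] by measurable
  then have "half_space \<inter> {p. exp N \<le> S p \<and> S p \<le> exp (2 * N)} \<in> sets (lebesgue :: (real \<times> (real ^ 'n)) measure)"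
    using half_space_sets(2) by (intro sets.Int) auto
  moreover have "shell N = half_space \<inter> {p :: real \<times> (real ^ 'n). exp N \<le> S p \<and> S p \<le> exp (2 * N)}"
    by (auto simp: shell_def)
  ultimately show ?thesis by simp
qed

text \<open>The homogeneous dimension of space-time when \<open>x\<close> scales like
  \<open>t powr (1 / \<alpha>)\<close>.\<close>

definition \<gamma> :: "nat \<Rightarrow> real" where
  "\<gamma> d = 1 + real d / \<alpha>"

text \<open>The volume bound at the top \<open>exp (k + 1)\<close> of a layer times the weight
  \<open>S powr (- \<gamma>)\<close> at its bottom \<open>exp k\<close>, which does not depend on
  \<open>k\<close>.\<close>

definition shell_const :: "nat \<Rightarrow> real" where
  "shell_const d = 4 ^ d * exp (\<gamma> d)"

lemma sublevel_integrable:
  fixes k :: real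
  assumes "0 \<le> k"
  defines "V \<equiv> {p :: real \<times> (real ^ 'n). p \<in> half_space \<and> S p \<le> exp k}"
  shows "integrable lebesgue (indicator V :: _ \<Rightarrow> real)"
    and "measure lebesgue V \<le> 4 ^ CARD('n) * exp (k * \<gamma> CARD('n))"
proof -
  have T: "1 \<le> exp k" using assms(1) by simp
  have V: "V \<in> sets lebesgue" "emeasure lebesgue V \<le> 4 ^ CARD('n) * exp k powr (\<gamma> CARD('n))"
    using sublevel_measure[OF T, where 'n='n] by (auto simp: V_def \<gamma>_def)
  have e: "4 ^ CARD('n) * exp k powr (\<gamma> CARD('n)) = 4 ^ CARD('n) * exp (k * \<gamma> CARD('n))"
    by (simp add: exp_powr_real)
  have fin: "emeasure lebesgue V < \<infinity>"
    using V(2) by (auto intro: le_less_trans)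
  show "integrable lebesgue (indicator V :: _ \<Rightarrow> real)"
    using V(1) fin by (simp add: integrable_indicator_iff)
  show "measure lebesgue V \<le> 4 ^ CARD('n) * exp (k * \<gamma> CARD('n))"
    unfolding measure_def using V(2) e by (intro enn2real_leI) auto
qed

text \<open>Each layer \<open>exp k \<le> S \<le> exp (k + 1)\<close> contributes a constant, because the sublevel set
  \<open>S \<le> T\<close> has measure of order \<open>T powr \<gamma>\<close>.\<close>

lemma shell_integral:
  fixes N :: nat
  assumes "1 \<le> N"
  defines "f \<equiv> \<lambda>p :: real \<times> (real ^ 'n). indicator (shell (real N)) p * S p powr (- \<gamma> CARD('n))"
  shows "integrable lebesgue f" "integral\<^sup>L lebesgue f \<le> real N * shell_const CARD('n)"
proof -
  let ?V = "\<lambda>k::nat. {p :: real \<times> (real ^ 'n). p \<in> half_space \<and> S p \<le> exp (real k + 1)}"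
  let ?g = "\<lambda>p. \<Sum>k\<in>{N..<2*N}. exp (- real k * \<gamma> CARD('n)) * indicator (?V k) p"
  have \<gamma>: "0 \<le> \<gamma> CARD('n)" using alpha by (simp add: \<gamma>_def)
  note V = sublevel_integrable[of "real k + 1" for k :: nat, where 'n='n]
  have ig: "integrable lebesgue ?g" using V(1) by (intro Bochner_Integration.integrable_sum integrable_mult_right) auto
  have fm: "f \<in> borel_measurable lebesgue"
    unfolding f_def using S_borel[where 'n='n] borel_measurable_indicator[OF shell_sets[where 'n='n]]
    by (intro borel_measurable_times powr_real_measurable) auto
  have f0: "0 \<le> f p" for p by (simp add: f_def)
  have fg: "f p \<le> ?g p" for p
  proof (cases "p \<in> shell (real N)")
    case False
    then show ?thesis by (auto simp: f_def intro!: sum_nonneg)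
  next
    case True
    then have p: "p \<in> half_space" "exp (real N) \<le> S p" "S p \<le> exp (2 * real N)" by (auto simp: shell_def)
    have S: "0 < S p" using S_pos[OF p(1)] .
    have l: "real N \<le> ln (S p)" "ln (S p) \<le> 2 * real N"
      using p S by (auto simp: ln_ge_iff ln_le_exp)
    \<comment> \<open>The minimum matters only for \<open>S p = exp (2 * N)\<close>: the shell is
      closed, and this boundary is assigned to the last layer.\<close>
    define k where "k = min (nat \<lfloor>ln (S p)\<rfloor>) (2 * N - 1)"
    have k: "N \<le> k" "k < 2 * N" "real k \<le> ln (S p)" "ln (S p) \<le> real k + 1"
    proof -
      have fl: "real (nat \<lfloor>ln (S p)\<rfloor>) \<le> ln (S p)" "ln (S p) < real (nat \<lfloor>ln (S p)\<rfloor>) + 1" using l(1) by linarith+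
      have "N \<le> nat \<lfloor>ln (S p)\<rfloor>" using l(1) by (simp add: le_nat_floor)
      then show "N \<le> k" "k < 2 * N" using assms(1) by (auto simp: k_def)
      show "real k \<le> ln (S p)" using fl(1) by (simp add: k_def)
      show "ln (S p) \<le> real k + 1" using fl(2) l(2) assms(1) by (auto simp: k_def min_def of_nat_diff)
    qed
    have "f p = S p powr (- \<gamma> CARD('n))" using True by (simp add: f_def)
    also have "\<dots> \<le> exp (real k) powr (- \<gamma> CARD('n))"
      using k(3) S \<gamma> by (intro powr_mono2') (auto simp: ln_ge_iff)
    also have "\<dots> = exp (- real k * \<gamma> CARD('n)) * indicator (?V k) p"
      using p(1) k(4) S by (simp add: exp_powr_real ln_le_exp)
    also have "\<dots> \<le> ?g p" using k(1,2) by (intro member_le_sum) auto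
    finally show ?thesis .
  qed
  show i: "integrable lebesgue f"
    by (rule Bochner_Integration.integrable_bound[OF ig fm]) (use f0 fg order_trans[OF f0 fg] in auto)
  have "integral\<^sup>L lebesgue f \<le> integral\<^sup>L lebesgue ?g" by (rule integral_mono[OF i ig fg])
  also have "\<dots> = (\<Sum>k\<in>{N..<2*N}. exp (- real k * \<gamma> CARD('n)) * measure lebesgue (?V k))"
    using V(1) by (subst Bochner_Integration.integral_sum) auto
  also have "\<dots> \<le> (\<Sum>k\<in>{N..<2*N}. shell_const CARD('n))"
  proof (rule sum_mono)
    fix k :: nat
    have "exp (- real k * \<gamma> CARD('n)) * measure lebesgue (?V k)
        \<le> exp (- real k * \<gamma> CARD('n)) * (4 ^ CARD('n) * exp ((real k + 1) * \<gamma> CARD('n)))"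
      using V(2)[of k] by (intro mult_left_mono) auto
    also have "\<dots> = 4 ^ CARD('n) * exp (- real k * \<gamma> CARD('n) + (real k + 1) * \<gamma> CARD('n))"
      by (simp only: exp_add) simp
    also have "\<dots> = shell_const CARD('n)" by (simp add: shell_const_def algebra_simps)
    finally show "exp (- real k * \<gamma> CARD('n)) * measure lebesgue (?V k) \<le> shell_const CARD('n)" .
  qed
  also have "\<dots> = real N * shell_const CARD('n)" by simp
  finally show "integral\<^sup>L lebesgue f \<le> real N * shell_const CARD('n)" .
qed

lemma integral_lebesgue_on_le:
  fixes f :: "real \<times> (real ^ 'n) \<Rightarrow> real"
  assumes "\<Omega> \<in> sets lebesgue" "integrable lebesgue f" "\<And>p. 0 \<le> f p"
  shows "integrable (lebesgue_on \<Omega>) f" "integral\<^sup>L (lebesgue_on \<Omega>) f \<le> integral\<^sup>L lebesgue f"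
proof -
  have s: "\<Omega> \<inter> space lebesgue \<in> sets lebesgue" using assms(1) by simp
  have i: "integrable lebesgue (\<lambda>p. indicator \<Omega> p *\<^sub>R f p)"
    using integrable_mult_indicator[OF assms(1,2)] .
  then show "integrable (lebesgue_on \<Omega>) f" by (simp add: integrable_restrict_space[OF s])
  have "integral\<^sup>L (lebesgue_on \<Omega>) f = integral\<^sup>L lebesgue (\<lambda>p. indicator \<Omega> p *\<^sub>R f p)"
    by (rule integral_restrict_space[OF s])
  also have "\<dots> \<le> integral\<^sup>L lebesgue f"
    by (rule integral_mono[OF i assms(2)]) (use assms(3) in \<open>auto simp: indicator_def\<close>)
  finally show "integral\<^sup>L (lebesgue_on \<Omega>) f \<le> integral\<^sup>L lebesgue f" .
qed

definition \<kappa> :: "real \<Rightarrow> real \<times> (real ^ 'n) \<Rightarrow> real" where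
  "\<kappa> N p = indicator (shell N) p / (N * S p)"

lemma kappa_nonneg: "0 < N \<Longrightarrow> 0 \<le> \<kappa> N p"
proof (cases "p \<in> shell N")
  case True
  then have "0 < S p" by (simp add: shell_def S_pos)
  then show "0 < N \<Longrightarrow> 0 \<le> \<kappa> N p" by (simp add: \<kappa>_def)
qed (simp add: \<kappa>_def)

lemma kappa_borel: "\<kappa> N \<in> borel_measurable (lebesgue :: (real \<times> (real ^ 'n)) measure)"
  unfolding \<kappa>_def[abs_def] using S_borel[where 'n='n] borel_measurable_indicator[OF shell_sets[where 'n='n]]
  by (intro borel_measurable_divide borel_measurable_times borel_measurable_const)

text \<open>On the shell \<kappa> is at most 1, so finite volume suffices. No bound uniform in
  \<open>N\<close> is sought here; a small \<epsilon> depending on \<open>N\<close> compensates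
  later.\<close>

lemma kappa_integrable:
  fixes N :: nat
  assumes "1 \<le> N"
  shows "integrable lebesgue (\<kappa> (real N) :: real \<times> (real ^ 'n) \<Rightarrow> real)"
proof (rule Bochner_Integration.integrable_bound[OF sublevel_integrable(1)[of "2 * real N", where 'n='n] kappa_borel])
  show "AE p :: real \<times> (real ^ 'n) in lebesgue. norm (\<kappa> (real N) p) \<le> norm (indicator {p. p \<in> half_space \<and> S p \<le> exp (2 * real N)} p :: real)"
  proof (rule AE_I2)
    fix p :: "real \<times> (real ^ 'n)"
    show "norm (\<kappa> (real N) p) \<le> norm (indicator {p. p \<in> half_space \<and> S p \<le> exp (2 * real N)} p :: real)"
    proof (cases "p \<in> shell (real N)")
      case True
      then have p: "p \<in> half_space" "exp (real N) \<le> S p" "S p \<le> exp (2 * real N)" by (auto simp: shell_def)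
      have "1 \<le> exp (real N)" by simp
      also note p(2)
      finally have "1 * 1 \<le> real N * S p" using assms by (intro mult_mono) auto
      then show ?thesis using True p by (simp add: \<kappa>_def)
    qed (simp add: \<kappa>_def)
  qed
qed simp

text \<open>The condition on \<open>q\<close> says that \<open>\<gamma> - 1\<close> is at most
  \<open>1 / (q - 1)\<close>. With \<open>r = (1 - 1 / N) / (q - 1)\<close>, the exponent
  \<open>1 + r\<close> of \<open>1 / S\<close> falls short of \<gamma> by at most
  \<open>1 / (N * (q - 1))\<close>, and since \<open>S \<le> exp (2 * N)\<close> on the shell this
  costs the factor \<open>exp (2 / (q - 1))\<close>. What remains is \<open>N powr (- 1 - r)\<close>
  times a shell integral of order \<open>N\<close>, and \<open>r\<close> is at least
  \<open>1 / (2 * (q - 1))\<close>.\<close>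

lemma kappa_power_integral:
  fixes N :: nat
  assumes N: "2 \<le> N" and q: "1 < q" "q \<le> 1 + \<alpha> / real CARD('n)"
  defines "f \<equiv> \<lambda>p :: real \<times> (real ^ 'n). \<kappa> (real N) p powr (1 + (1 - 1 / real N) / (q - 1))"
  shows "integrable lebesgue f"
    "integral\<^sup>L lebesgue f \<le> exp (2 / (q - 1)) * shell_const CARD('n) * real N powr (- (1 / (2 * (q - 1))))"
proof -
  define r where "r = (1 - 1 / real N) / (q - 1)"
  define h where "h p = indicator (shell (real N)) p * S p powr (- \<gamma> CARD('n))" for p :: "real \<times> (real ^ 'n)"
  have N1: "1 \<le> N" using N by simp
  define c where "c = exp (2 / (q - 1)) * (1 / real N * real N powr (- (1 / (2 * (q - 1)))))"
  note h = shell_integral[OF N1, where 'n='n, folded h_def]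
  have invN: "1 / real N \<le> 1 / 2" using N by (intro divide_left_mono) auto
  have crit: "real CARD('n) / \<alpha> \<le> 1 / (q - 1)"
  proof -
    have "real CARD('n) * (q - 1) \<le> \<alpha>" using q(2) by (simp add: field_simps)
    then show ?thesis using q(1) alpha by (simp add: field_simps)
  qed
  have f0: "0 \<le> f p" for p by (simp add: f_def)
  have fh: "f p \<le> c * h p" for p
  proof (cases "p \<in> shell (real N)")
    case False
    then show ?thesis by (simp add: f_def h_def \<kappa>_def)
  next
    case True
    then have p: "p \<in> half_space" "exp (real N) \<le> S p" "S p \<le> exp (2 * real N)" by (auto simp: shell_def)
    have "1 \<le> exp (real N)" by simp
    also note p(2)
    finally have S1: "1 \<le> S p" .
    have "f p = (1 / (real N * S p)) powr (1 + r)" using True by (simp add: f_def \<kappa>_def r_def)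
    also have "\<dots> = real N powr (- (1 + r)) * S p powr (- (1 + r))"
    proof -
      have "0 < real N * S p" using S1 N by simp
      then have "(1 / (real N * S p)) powr (1 + r) = (real N * S p) powr (- (1 + r))"
        unfolding powr_minus_divide by (simp only: powr_divide powr_one_eq_one)
      also have "\<dots> = real N powr (- (1 + r)) * S p powr (- (1 + r))" using S1 by (simp only: powr_mult)
      finally show ?thesis .
    qed
    also have "\<dots> \<le> (1 / real N * real N powr (- (1 / (2 * (q - 1))))) * (exp (2 / (q - 1)) * S p powr (- \<gamma> CARD('n)))"
    proof (rule mult_mono)
      have "1 / (2 * (q - 1)) = (1 / 2) / (q - 1)" by simp
      also have "\<dots> \<le> r" unfolding r_def using invN q(1) by (intro divide_right_mono) auto
      finally have "real N powr (- (1 + r)) \<le> real N powr (- 1 + - (1 / (2 * (q - 1))))"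
        using N by (intro powr_mono) auto
      also have "\<dots> = 1 / real N * real N powr (- (1 / (2 * (q - 1))))"
        unfolding powr_add using N by (simp add: powr_minus_divide)
      finally show "real N powr (- (1 + r)) \<le> 1 / real N * real N powr (- (1 / (2 * (q - 1))))" .
      have "S p powr (- (1 + r)) = S p powr (\<gamma> CARD('n) - (1 + r)) * S p powr (- \<gamma> CARD('n))"
        by (simp flip: powr_add)
      also have "\<dots> \<le> exp (2 / (q - 1)) * S p powr (- \<gamma> CARD('n))"
      proof (rule mult_right_mono)
        have "\<gamma> CARD('n) - (1 + r) \<le> 1 / (q - 1) - r" using crit by (simp add: \<gamma>_def)
        also have "\<dots> = 1 / real N / (q - 1)" by (simp add: r_def diff_divide_distrib)
        finally have "S p powr (\<gamma> CARD('n) - (1 + r)) \<le> S p powr (1 / real N / (q - 1))"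
          using S1 by (intro powr_mono) auto
        also have "\<dots> \<le> exp (2 * real N) powr (1 / real N / (q - 1))"
          using p(3) S1 q(1) by (intro powr_mono2) auto
        also have "\<dots> = exp (2 / (q - 1))" using N by (simp add: exp_powr_real)
        finally show "S p powr (\<gamma> CARD('n) - (1 + r)) \<le> exp (2 / (q - 1))" .
      qed simp
      finally show "S p powr (- (1 + r)) \<le> exp (2 / (q - 1)) * S p powr (- \<gamma> CARD('n))" .
    qed auto
    also have "\<dots> = c * h p" using True by (simp add: c_def h_def)
    finally show ?thesis .
  qed
  have fm: "f \<in> borel_measurable lebesgue"
    unfolding f_def using kappa_borel[where 'n='n] by (intro powr_real_measurable) auto
  have ih: "integrable lebesgue (\<lambda>p. c * h p)" using h(1) by simp
  show i: "integrable lebesgue f"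
    by (rule Bochner_Integration.integrable_bound[OF ih fm]) (use f0 fh order_trans[OF f0 fh] in auto)
  have "integral\<^sup>L lebesgue f \<le> integral\<^sup>L lebesgue (\<lambda>p. c * h p)" by (rule integral_mono[OF i ih fh])
  also have "\<dots> = c * integral\<^sup>L lebesgue h" by simp
  also have "\<dots> \<le> c * (real N * shell_const CARD('n))"
    using h(2) by (intro mult_left_mono) (auto simp: c_def)
  also have "\<dots> = exp (2 / (q - 1)) * shell_const CARD('n) * real N powr (- (1 / (2 * (q - 1))))"
    using N by (simp add: c_def)
  finally show "integral\<^sup>L lebesgue f \<le> exp (2 / (q - 1)) * shell_const CARD('n) * real N powr (- (1 / (2 * (q - 1))))" .
qed

end

text \<open>Each \<open>R\<close> comes with its own null set and only countably many may be united,
  so \<open>R\<close> runs over the rationals. A rational \<open>R\<close> between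
  \<open>norm (snd p)\<close> and twice this norm puts \<open>p\<close> into the annulus; passing
  from \<open>R\<close> to the norm costs at most \<open>2 powr |2 - \<alpha>|\<close>, where the
  absolute value covers both signs of the exponent.\<close>

lemma coefficient_growth:
  fixes A :: "real \<times> (real ^ 'n) \<Rightarrow> real"
  assumes c: "0 < c" and ess: "\<And>R. 1 < R \<Longrightarrow>
      esssup (lebesgue_on ({0<..} \<times> {x. R / 2 < norm x \<and> norm x < R})) (\<lambda>p. ereal (A p)) \<le> ereal (c * R powr (2 - \<alpha>))"
  shows "AE p in lebesgue_on half_space. 1 \<le> norm (snd p) \<longrightarrow> A p \<le> c * 2 powr \<bar>2 - \<alpha>\<bar> * norm (snd p) powr (2 - \<alpha>)"
proof -
  let ?D = "\<lambda>R. {0<..} \<times> {x. R / 2 < norm x \<and> norm x < R} :: (real \<times> (real ^ 'n)) set"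
  have D: "?D R \<in> sets lebesgue" for R
  proof -
    have "open {x :: real ^ 'n. R / 2 < norm x \<and> norm x < R}"
      by (intro open_Collect_conj open_Collect_less continuous_intros)
    then have "open (?D R)" by (intro open_Times) auto
    then show ?thesis by (intro sets_completionI_sets) simp
  qed
  have "AE p in lebesgue. p \<in> ?D R \<longrightarrow> A p \<le> c * R powr (2 - \<alpha>)" if "1 < R" for R
  proof -
    have "AE p in lebesgue_on (?D R). A p \<le> c * R powr (2 - \<alpha>)"
      using esssup_AE[of "\<lambda>p. ereal (A p)" "lebesgue_on (?D R)"]
    proof eventually_elim
      case (elim p)
      from order_trans[OF elim ess[OF that]] show ?case by simp
    qed
    then show ?thesis using D by (subst (asm) AE_restrict_space_iff) auto
  qed
  then have "AE p in lebesgue. \<forall>R\<in>\<rat>. 1 < R \<longrightarrow> p \<in> ?D R \<longrightarrow> A p \<le> c * R powr (2 - \<alpha>)"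
    by (subst AE_ball_countable[OF countable_rat]) auto
  then have "AE p in lebesgue. p \<in> half_space \<longrightarrow> 1 \<le> norm (snd p) \<longrightarrow> A p \<le> c * 2 powr \<bar>2 - \<alpha>\<bar> * norm (snd p) powr (2 - \<alpha>)"
  proof eventually_elim
    case (elim p)
    show ?case
    proof (intro impI)
      assume p: "p \<in> half_space" "1 \<le> norm (snd p)"
      let ?r = "norm (snd p)"
      obtain R where R: "R \<in> \<rat>" "?r < R" "R < 2 * ?r" using Rats_dense_in_real[of ?r "2 * ?r"] p(2) by fastforce
      have "p \<in> ?D R" using p R by (cases p) (auto simp: half_space_def)
      then have "A p \<le> c * R powr (2 - \<alpha>)" using elim R p(2) by auto
      also have "R powr (2 - \<alpha>) \<le> 2 powr \<bar>2 - \<alpha>\<bar> * ?r powr (2 - \<alpha>)"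
      proof (cases "0 \<le> 2 - \<alpha>")
        case True
        have "R powr (2 - \<alpha>) \<le> (2 * ?r) powr (2 - \<alpha>)" using True R p(2) by (intro powr_mono2) auto
        then show ?thesis using True by (simp add: powr_mult)
      next
        case False
        have "R powr (2 - \<alpha>) \<le> 1 * ?r powr (2 - \<alpha>)" using False R p(2) by (simp, intro powr_mono2') auto
        also have "\<dots> \<le> 2 powr \<bar>2 - \<alpha>\<bar> * ?r powr (2 - \<alpha>)" by (intro mult_right_mono ge_one_powr_ge_zero) auto
        finally show ?thesis .
      qed
      finally show "A p \<le> c * 2 powr \<bar>2 - \<alpha>\<bar> * ?r powr (2 - \<alpha>)" using c by simp
    qed
  qed
  then show ?thesis using half_space_sets(2) by (subst AE_restrict_space_iff) auto
qed

lemma grad_form_bounded: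
  fixes f g :: "real \<times> (real ^ 'n::finite) \<Rightarrow> real"
  assumes a: "\<And>i j. locally_bounded_on half_space (a i j)" and s: "0 < s"
    and fg: "smooth_on f half_space" "smooth_on g half_space"
  obtains B where "\<And>p. p \<in> cylinder s t R \<Longrightarrow> \<bar>grad_form a f g p\<bar> \<le> B"
proof -
  let ?P = "\<lambda>h :: real \<times> (real ^ 'n) \<Rightarrow> real. \<exists>B. \<forall>p\<in>cylinder s t R. \<bar>h p\<bar> \<le> B"
  have sum: "?P (\<lambda>p. \<Sum>i\<in>UNIV. h i p)" if h: "\<And>i. ?P (h i)" for h :: "'n \<Rightarrow> _"
  proof -
    have "\<forall>i. \<exists>B. \<forall>p\<in>cylinder s t R. \<bar>h i p\<bar> \<le> B" using h by blast
    from choice[OF this] obtain B where B: "\<forall>i. \<forall>p\<in>cylinder s t R. \<bar>h i p\<bar> \<le> B i" by blast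
    have "\<bar>\<Sum>i\<in>UNIV. h i p\<bar> \<le> (\<Sum>i\<in>UNIV. B i)" if "p \<in> cylinder s t R" for p
    proof -
      have "(\<Sum>i\<in>UNIV. \<bar>h i p\<bar>) \<le> (\<Sum>i\<in>UNIV. B i)" using B that by (intro sum_mono) auto
      then show ?thesis using sum_abs[of "\<lambda>i. h i p" UNIV] by linarith
    qed
    then show ?thesis by blast
  qed
  have mult: "?P (\<lambda>p. h p * k p)" if hk: "?P h" "?P k" for h k
  proof -
    obtain B C where B: "\<forall>p\<in>cylinder s t R. \<bar>h p\<bar> \<le> B" and C: "\<forall>p\<in>cylinder s t R. \<bar>k p\<bar> \<le> C"
      using hk by blast
    have "\<bar>h p * k p\<bar> \<le> B * C" if "p \<in> cylinder s t R" for p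
    proof -
      have "\<bar>h p\<bar> \<le> B" "\<bar>k p\<bar> \<le> C" using B C that by auto
      moreover have "0 \<le> B" using \<open>\<bar>h p\<bar> \<le> B\<close> by linarith
      ultimately have "\<bar>h p\<bar> * \<bar>k p\<bar> \<le> B * C" by (intro mult_mono) auto
      then show ?thesis by (simp add: abs_mult)
    qed
    then show ?thesis by blast
  qed
  have "?P (a i j)" for i j
    by (rule locally_bounded_on_cylinder[OF a s]) blast
  moreover have "?P (dx i f)" "?P (dx i g)" for i
    by (rule continuous_on_half_space_bounded[OF smooth_on_imp_continuous_on[OF smooth_on_dx[OF fg(1)]] s], blast)
      (rule continuous_on_half_space_bounded[OF smooth_on_imp_continuous_on[OF smooth_on_dx[OF fg(2)]] s], blast)
  ultimately have "?P (grad_form a f g)"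
    unfolding grad_form_def[abs_def] by (intro sum mult)
  then show ?thesis using that by blast
qed

section \<open>Vanishing of the solution\<close>

context parabolic_cutoff
begin

text \<open>The integrand is a lower bound for the weighted power that is free of \<open>N\<close>
  and \<epsilon>: for \<open>\<epsilon> \<le> 1\<close> and \<open>\<nu> \<le> 1\<close> the weight
  \<open>(u + \<epsilon>) powr (- \<nu>)\<close> is at least \<open>1 / (1 + u)\<close>. So the
  cylinder stays fixed while \<open>N\<close> grows. In \<open>C\<close> the first two terms come
  from the time derivative and the gradient of the cutoff; the 1 provides the lower bound that
  \<open>pointwise_absorption\<close> asks of its constant.\<close>

lemma cylinder_integral_bound:
  fixes a :: "'n::finite coeffs" and A u ut :: "real \<times> (real ^ 'n) \<Rightarrow> real" and N m :: nat
  defines "C \<equiv> \<lambda>c. 2 * real m * M + (real m)\<^sup>2 * energy_const c + 1"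
  assumes q: "1 < q" "q \<le> 1 + \<alpha> / real CARD('n)"
    and a: "\<And>i j. a i j \<in> borel_measurable (lebesgue_on half_space)"
      "\<And>i j. locally_bounded_on half_space (a i j)"
    and psd: "AE p in lebesgue_on half_space. psd_at a p"
    and form: "AE p in lebesgue_on half_space. \<forall>\<xi>. coeff_form a p \<xi> \<xi> \<le> A p * (norm \<xi>)\<^sup>2"
    and A: "\<And>p. p \<in> half_space \<Longrightarrow> 0 \<le> A p"
      "AE p in lebesgue_on half_space. 1 \<le> norm (snd p) \<longrightarrow> A p \<le> c * norm (snd p) powr (2 - \<alpha>)"
    and c: "0 \<le> c"
    and u: "u \<in> borel_measurable (lebesgue_on half_space)" "AE p in lebesgue_on half_space. 0 \<le> u p"
    and W: "W_loc_element a q u ut E"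
    and weak: "\<And>\<phi>. test_function \<phi> \<Longrightarrow> (\<And>p. p \<in> half_space \<Longrightarrow> 0 \<le> \<phi> p) \<Longrightarrow>
      0 \<le> (\<integral>p. ut p * \<phi> p + E \<phi> p - \<bar>u p\<bar> powr (q - 1) * u p * \<phi> p \<partial>lebesgue_on half_space)"
    and str: "0 < s" "s < t" "0 < R"
    and N: "2 \<le> N" "1 / real N \<le> min 1 (q - 1)" "\<And>p :: real \<times> (real ^ 'n). p \<in> cylinder s t R \<Longrightarrow> S p \<le> exp (real N)"
    and m: "2 + 2 / (q - 1) \<le> real m"
  shows "integrable (lebesgue_on (cylinder s t R)) (\<lambda>p. \<bar>u p\<bar> powr q / (1 + \<bar>u p\<bar>))"
    and "(\<integral>p. \<bar>u p\<bar> powr q / (1 + \<bar>u p\<bar>) \<partial>lebesgue_on (cylinder s t R))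
      \<le> 8 * (1 / real N + 2 * C c * (16 * C c) powr (1 / (q - 1)) *
          (exp (2 / (q - 1)) * shell_const CARD('n) * real N powr (- (1 / (2 * (q - 1))))))"
proof -
  define P :: "(real \<times> (real ^ 'n)) set" where "P = cylinder s t R"
  note P = cylinder_domain[OF str, where 'n='n, folded P_def]
  define \<nu> where "\<nu> = 1 / real N"
  \<comment> \<open>With this value \<omega> equals 1 from \<open>2 * \<tau> = s\<close> on, hence
    on the whole cylinder.\<close>
  define \<tau> where "\<tau> = s / 2"
  define T where "T = exp (2 * real N)"
  define r where "r = 2 * T powr (1 / \<alpha>)"
  define K where "K = {\<tau>..T} \<times> cball (0 :: real ^ 'n) r"
  define \<Omega> :: "(real \<times> (real ^ 'n)) set" where "\<Omega> = cylinder (\<tau> / 2) (T + 1) (r + 1)"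
  define L where "L = lebesgue_on \<Omega>"
  define D where "D = C c"
  have N0: "0 < real N" "1 \<le> N" "1 \<le> real N" using N(1) by auto
  have \<nu>: "0 < \<nu>" "\<nu> \<le> 1/2" "\<nu> \<le> min 1 (q - 1)"
    using N(1,2) by (auto simp: \<nu>_def field_simps)
  have \<tau>: "0 < \<tau>" using str by (simp add: \<tau>_def)
  have T: "1 \<le> T" by (simp add: T_def)
  have r: "0 \<le> r" by (simp add: r_def)
  have m2: "2 < m" using m q divide_pos_pos[of 2 "q - 1"] by linarith
  have D1: "1 \<le> D" using M_nonneg c by (simp add: D_def C_def energy_const_def)
  have \<zeta>P: "\<zeta> \<tau> N m p = 1" if "p \<in> P" for p
    by (rule zeta_eq_1) (use that \<tau> N0 N(3) P(5) in \<open>auto simp: \<tau>_def P_def cylinder_def\<close>)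
  have \<zeta>0: "\<zeta> \<tau> N m p = 0" if "p \<in> half_space - K" for p
    by (rule zeta_support) (use that \<tau> N0 m2 in \<open>auto simp: K_def T_def r_def\<close>)
  \<comment> \<open>The radii need not be compared: \<zeta> is 1 on \<open>P\<close> and 0 off
    \<open>K\<close>.\<close>
  have PK: "P \<subseteq> K"
  proof
    fix p assume p: "p \<in> P"
    show "p \<in> K"
    proof (rule ccontr)
      assume "p \<notin> K"
      then have "\<zeta> \<tau> N m p = 0" using p P(5) by (intro \<zeta>0) auto
      then show False using \<zeta>P[OF p] by simp
    qed
  qed
  have \<tau>T: "\<tau> / 2 < T + 1"
  proof -
    obtain p where "p \<in> P" using P(3) by blast
    then have "\<tau> \<le> T" using PK by (auto simp: K_def)
    then show ?thesis using \<tau> by simp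
  qed
  have dom: "0 < \<tau> / 2" "\<tau> / 2 < T + 1" "0 < r + 1" using \<tau> \<tau>T r by auto
  note \<Omega> = cylinder_domain[OF dom, where 'n='n, folded \<Omega>_def]
  have KO: "K \<subseteq> \<Omega>" using \<tau> by (auto simp: K_def \<Omega>_def cylinder_def)
  have cK: "compact K" unfolding K_def by (intro compact_Times compact_cball) simp
  have spL: "space L = \<Omega>" by (simp add: L_def)
  have to_L: "f \<in> borel_measurable (lebesgue_on half_space) \<Longrightarrow> f \<in> borel_measurable L" for f :: "_ \<Rightarrow> real"
    unfolding L_def using measurable_half_space_subset[OF _ \<Omega>(5,6)] .
  have smooth_L: "smooth_on f half_space \<Longrightarrow> f \<in> borel_measurable L" for f :: "_ \<Rightarrow> real"
    using continuous_imp_measurable_on_sets_lebesgue[OF smooth_on_imp_continuous_on half_space_sets(2)] by (intro to_L)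
  define J where "J = integral\<^sup>L lebesgue (\<kappa> (real N) :: real \<times> (real ^ 'n) \<Rightarrow> real)"
  have J: "0 \<le> J" unfolding J_def by (intro integral_nonneg_AE AE_I2 kappa_nonneg N0(1))
  \<comment> \<open>\<open>J\<close> depends on \<open>N\<close>, so \<epsilon> is chosen after
    \<open>N\<close> to make the term with \<open>J\<close> at most \<open>1 / N\<close>. The square
    compensates for \<open>\<epsilon> powr (1 - \<nu>) \<le> sqrt \<epsilon>\<close>, and
    \<open>J + 1\<close> avoids a division by 0.\<close>
  define \<epsilon> where "\<epsilon> = min 1 ((1 / (real N * (2 * D * (J + 1))))\<^sup>2)"
  have \<epsilon>: "0 < \<epsilon>" "\<epsilon> \<le> 1" using N0 D1 J by (auto simp: \<epsilon>_def)
  have \<epsilon>J: "2 * D * \<epsilon> powr (1 - \<nu>) * J \<le> 1 / real N"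
  proof -
    have "\<epsilon> powr (1 - \<nu>) \<le> \<epsilon> powr (1/2)" using \<epsilon> \<nu> by (intro powr_mono') auto
    also have "\<dots> = sqrt \<epsilon>" using \<epsilon> by (simp add: powr_half_sqrt)
    also have "\<dots> \<le> sqrt ((1 / (real N * (2 * D * (J + 1))))\<^sup>2)"
      unfolding \<epsilon>_def by (intro real_sqrt_le_mono min.cobounded2)
    also have "\<dots> = 1 / (real N * (2 * D * (J + 1)))" using N0 D1 J by (intro real_sqrt_unique) auto
    finally have "2 * D * \<epsilon> powr (1 - \<nu>) * J \<le> 2 * D * (1 / (real N * (2 * D * (J + 1)))) * (J + 1)"
      using D1 J N0 by (intro mult_mono) auto
    also have "\<dots> = 1 / real N"
    proof -
      have "2 * D * (J + 1) \<noteq> 0" using D1 J by simp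
      then show ?thesis using N0 by simp
    qed
    finally show ?thesis .
  qed
  \<comment> \<open>The parameter \<beta> of the weight is \<open>min 1 (q - 1)\<close>, the largest
    admissible value; it stays fixed while \<nu> shrinks with \<open>N\<close>.\<close>
  have pre: "0 < \<epsilon>" "\<epsilon> \<le> 1" "0 < \<nu>" "\<nu> \<le> min 1 (q - 1)" "min 1 (q - 1) \<le> 1" "\<nu> \<le> 1/2" "1 + min 1 (q - 1) \<le> q"
    using \<epsilon> \<nu> by auto
  obtain g g' G :: "real \<Rightarrow> real" and B1 B2 where g:
    "smooth_on g UNIV" "\<And>x. (g has_real_derivative g' x) (at x)" "continuous_on UNIV g'"
    "\<And>x. (G has_real_derivative g x) (at x)" "G 0 = 0"
    "\<And>x. 0 < g x" "\<And>x. g x \<le> B1" "\<And>x. g' x < 0" "\<And>x. \<bar>g' x\<bar> \<le> B1"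
    "\<And>x. (g x)\<^sup>2 / (2 * \<bar>g' x\<bar>) \<le> B2 * (1 + \<bar>x\<bar> powr q)"
    "\<And>x. 0 \<le> x \<Longrightarrow> G x \<le> 2 * (x + \<epsilon>) powr (1 - \<nu>)"
    "\<And>x. 0 \<le> x \<Longrightarrow> 0 \<le> G x"
    "\<And>x. 0 \<le> x \<Longrightarrow> (g x)\<^sup>2 / (2 * \<bar>g' x\<bar>) \<le> (1 / \<nu>) * (x + \<epsilon>) powr (1 - \<nu>)"
    "\<And>x. 0 \<le> x \<Longrightarrow> (x + \<epsilon>) powr (- \<nu>) / 4 \<le> g x"
    by (rule weight_function_exists[OF pre], rule that, assumption+)
  define H where "H x = (g x)\<^sup>2 / (2 * \<bar>g' x\<bar>)" for x
  have H0: "0 \<le> H x" for x by (simp add: H_def)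
  \<comment> \<open>Positive semidefiniteness holds only almost everywhere, whereas
    \<open>energy_inequality\<close> asks for a non-negative \<open>b\<close> at every point of the
    cylinder; the absolute value takes care of the exceptional set.\<close>
  define b where "b p = \<bar>energy_weight a \<tau> N m p\<bar>" for p
  obtain B where B: "\<And>p. p \<in> \<Omega> \<Longrightarrow> \<bar>grad_form a (\<psi> N) (\<psi> N) p\<bar> \<le> B"
    by (rule grad_form_bounded[OF a(2) dom(1) smooth_on_psi smooth_on_psi]) (rule that, unfold \<Omega>_def)
  have \<omega>\<psi>: "0 \<le> \<omega> \<tau> p * \<psi> N p ^ (m - 2)" "\<omega> \<tau> p * \<psi> N p ^ (m - 2) \<le> 1" for p :: "real \<times> (real ^ 'n)"
    using omega_range[of \<tau> p] psi_range[of N p] mult_mono[of "\<omega> \<tau> p" 1 "\<psi> N p ^ (m - 2)" 1] power_le_one[of "\<psi> N p" "m - 2"] by auto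
  have bB: "b p \<le> (real m)\<^sup>2 * 1 * B" if "p \<in> \<Omega>" for p
    unfolding b_def energy_weight_def abs_mult
    using B[OF that] \<omega>\<psi>[of p] by (intro mult_mono) (auto simp: abs_mult)
  have mb: "b \<in> borel_measurable L"
  proof -
    have "(\<lambda>p. \<omega> \<tau> p * \<psi> N p ^ (m - 2)) \<in> borel_measurable L"
      by (intro smooth_L smooth_on_mult smooth_on_power smooth_on_omega smooth_on_psi half_space_sets(1))
    moreover have "grad_form a (\<psi> N) (\<psi> N) \<in> borel_measurable L"
      by (intro to_L grad_form_measurable[OF a(1) half_space_sets(1) subset_refl] smooth_on_psi)
    ultimately show ?thesis unfolding b_def energy_weight_def by measurable
  qed
  have aeL: "AE p in L. p \<in> half_space \<and> psd_at a p \<and> (\<forall>\<xi>. coeff_form a p \<xi> \<xi> \<le> A p * (norm \<xi>)\<^sup>2)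
      \<and> (1 \<le> norm (snd p) \<longrightarrow> A p \<le> c * norm (snd p) powr (2 - \<alpha>)) \<and> 0 \<le> u p"
    using AE_half_space_subset[OF psd \<Omega>(5,6), folded L_def] AE_half_space_subset[OF form \<Omega>(5,6), folded L_def]
      AE_half_space_subset[OF A(2) \<Omega>(5,6), folded L_def] AE_half_space_subset[OF u(2) \<Omega>(5,6), folded L_def] AE_space[of L]
    by eventually_elim (use \<Omega>(5) spL in auto)
  have ew0: "0 \<le> energy_weight a \<tau> N m p" if "psd_at a p" for p
    unfolding energy_weight_def grad_form_eq using psd_at_nonneg[OF that] \<omega>\<psi>(1)[of p] by auto
  have CS: "AE p in L. \<forall>x. (coeff_form a p (grad (\<zeta> \<tau> N m) p) x)\<^sup>2 \<le> b p * \<zeta> \<tau> N m p * coeff_form a p x x"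
    using aeL
  proof eventually_elim
    case (elim p)
    then have "b p = energy_weight a \<tau> N m p" using ew0 by (simp add: b_def)
    then show ?case using energy_weight_Cauchy_Schwarz[of p "real N" \<tau> a m] elim N0 \<tau> m2 by auto
  qed
  note EI = energy_inequality[OF q(1) dom a(1) psd u(1) W weak smooth_on_zeta zeta_range(1) cK KO[unfolded \<Omega>_def] \<zeta>0
      mb[unfolded L_def \<Omega>_def] _ bB[unfolded \<Omega>_def] CS[unfolded L_def \<Omega>_def] g(1-4,6-10), folded \<Omega>_def, folded L_def H_def]
  have iv: "integrable L (\<lambda>p. \<bar>u p\<bar> powr (q - 1) * u p * (g (u p) * \<zeta> \<tau> N m p))"
    and iG: "integrable L (\<lambda>p. G (u p) * dt (\<zeta> \<tau> N m) p)"
    and iH: "integrable L (\<lambda>p. H (u p) * b p)"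
    and ineq: "(\<integral>p. \<bar>u p\<bar> powr (q - 1) * u p * (g (u p) * \<zeta> \<tau> N m p) \<partial>L)
      \<le> - (\<integral>p. G (u p) * dt (\<zeta> \<tau> N m) p \<partial>L) + (\<integral>p. H (u p) * b p \<partial>L)"
    by (rule EI; auto simp: b_def)+
  define X where "X p = \<bar>u p\<bar> powr q * (\<bar>u p\<bar> + \<epsilon>) powr (- \<nu>) * \<zeta> \<tau> N m p" for p
  have X0: "0 \<le> X p" for p using zeta_range(1)[of \<tau> N m p] by (simp add: X_def)
  have mu: "u \<in> borel_measurable L" by (rule to_L[OF u(1)])
  have mX: "X \<in> borel_measurable L"
    unfolding X_def using mu smooth_L[OF smooth_on_zeta[of \<tau> N m]]
    by (intro borel_measurable_times powr_real_measurable borel_measurable_add borel_measurable_abs) auto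
  have Xle: "AE p in L. X p \<le> 4 * (\<bar>u p\<bar> powr (q - 1) * u p * (g (u p) * \<zeta> \<tau> N m p))"
    using aeL
  proof eventually_elim
    case (elim p)
    then have u0: "0 \<le> u p" by simp
    have "\<bar>u p\<bar> powr (q - 1) * u p = u p powr q"
      using u0 powr_add[of "u p" "q - 1" 1] by simp
    moreover have "u p powr q * ((u p + \<epsilon>) powr (- \<nu>) * \<zeta> \<tau> N m p) \<le> u p powr q * (4 * g (u p) * \<zeta> \<tau> N m p)"
      using g(14)[OF u0] zeta_range(1)[of \<tau> N m p] by (intro mult_left_mono mult_right_mono) auto
    ultimately show ?case using u0 by (simp add: X_def ac_simps)
  qed
  have iX: "integrable L X"
  proof (rule Bochner_Integration.integrable_bound[OF _ mX])
    show "integrable L (\<lambda>p. 4 * (\<bar>u p\<bar> powr (q - 1) * u p * (g (u p) * \<zeta> \<tau> N m p)))" using iv by simp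
    show "AE p in L. norm (X p) \<le> norm (4 * (\<bar>u p\<bar> powr (q - 1) * u p * (g (u p) * \<zeta> \<tau> N m p)))"
      using Xle
    proof eventually_elim
      case (elim p)
      then show ?case using X0[of p] by simp
    qed
  qed
  define e where "e = 1 + (1 - \<nu>) / (q - 1)"
  define Z where "Z = 2 * D * (16 * D) powr (1 / (q - 1))"
  have Z0: "0 \<le> Z" using D1 by (simp add: Z_def)
  \<comment> \<open>The factor \<open>1 / \<nu> = real N\<close> in the bound for \<open>H\<close>
    meets the extra \<open>1 / N\<close> of \<open>energy_weight_bound\<close>, so both error terms
    become multiples of \<kappa>. The absorption is applied with \<open>\<psi>\<close> as
    \<open>z\<close>, and \<omega> stays outside as a common factor until it completes \<zeta>
    inside \<open>X\<close>.\<close>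
  have up: "AE p in L. - (G (u p) * dt (\<zeta> \<tau> N m) p) + H (u p) * b p
      \<le> 1 / 8 * X p + (2 * D * \<epsilon> powr (1 - \<nu>) * \<kappa> N p + Z * \<kappa> N p powr e)"
    using aeL
  proof eventually_elim
    case (elim p)
    then have p: "p \<in> half_space" and psdp: "psd_at a p" and u0: "0 \<le> u p" by auto
    define w where "w = (u p + \<epsilon>) powr (1 - \<nu>)"
    define z where "z = \<omega> \<tau> p * \<psi> N p ^ (m - 2)"
    have w0: "0 \<le> w" by (simp add: w_def)
    have z: "0 \<le> z" "z \<le> 1" using \<omega>\<psi>[of p] by (auto simp: z_def)
    have \<kappa>0: "0 \<le> \<kappa> N p" by (rule kappa_nonneg[OF N0(1)])
    have "- dt (\<zeta> \<tau> N m) p \<le> real m * M * (\<omega> \<tau> p * \<psi> N p ^ (m - 1)) * \<kappa> N p"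
      using dt_zeta[OF p N0(1) \<tau>] by (simp add: \<kappa>_def)
    also have "\<dots> \<le> real m * M * z * \<kappa> N p"
      unfolding z_def using M_nonneg \<kappa>0 psi_range[of N p] omega_range[of \<tau> p]
      by (intro mult_right_mono mult_left_mono power_decreasing) auto
    finally have "G (u p) * (- dt (\<zeta> \<tau> N m) p) \<le> G (u p) * (real m * M * z * \<kappa> N p)"
      using g(12)[OF u0] by (intro mult_left_mono)
    also have "\<dots> \<le> (2 * w) * (real m * M * z * \<kappa> N p)"
      using g(11)[OF u0] M_nonneg z \<kappa>0 by (intro mult_right_mono) (auto simp: w_def)
    finally have 1: "- (G (u p) * dt (\<zeta> \<tau> N m) p) \<le> (2 * w) * (real m * M * z * \<kappa> N p)" by simp
    have "b p \<le> (real m)\<^sup>2 * z * (energy_const c / N * \<kappa> N p)"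
      using energy_weight_bound[OF p N0(3) c A(1)[OF p], of a \<tau> m] elim ew0[OF psdp]
      by (simp add: b_def z_def \<kappa>_def)
    then have "H (u p) * b p \<le> (real N * w) * ((real m)\<^sup>2 * z * (energy_const c / N * \<kappa> N p))"
      using g(13)[OF u0] H0 w0 by (intro mult_mono) (auto simp: H_def w_def \<nu>_def b_def)
    also have "\<dots> = w * ((real m)\<^sup>2 * z * (energy_const c * \<kappa> N p))" using N0 by simp
    finally have "- (G (u p) * dt (\<zeta> \<tau> N m) p) + H (u p) * b p
        \<le> (2 * w) * (real m * M * z * \<kappa> N p) + w * ((real m)\<^sup>2 * z * (energy_const c * \<kappa> N p))" using 1 by simp
    also have "\<dots> = (D - 1) * (w * z * \<kappa> N p)" by (simp add: D_def C_def algebra_simps)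
    also have "\<dots> \<le> D * (w * z * \<kappa> N p)" using w0 z \<kappa>0 by (intro mult_right_mono) auto
    also have "\<dots> = \<omega> \<tau> p * (D * (u p + \<epsilon>) powr (1 - \<nu>) * \<psi> N p ^ (m - 2) * \<kappa> N p)"
      by (simp add: w_def z_def ac_simps)
    also have "\<dots> \<le> \<omega> \<tau> p * (1 / 8 * (u p powr q * (u p + \<epsilon>) powr (- \<nu>) * \<psi> N p ^ m)
        + (2 * D * \<epsilon> powr (1 - \<nu>) * \<kappa> N p + Z * \<kappa> N p powr e))"
      unfolding Z_def e_def
      by (intro mult_left_mono pointwise_absorption q(1) \<nu> \<epsilon> u0 \<kappa>0 psi_range D1 m omega_range)
    also have "\<dots> = 1 / 8 * X p + \<omega> \<tau> p * (2 * D * \<epsilon> powr (1 - \<nu>) * \<kappa> N p + Z * \<kappa> N p powr e)"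
      using u0 by (simp add: X_def \<zeta>_def algebra_simps)
    also have "\<dots> \<le> 1 / 8 * X p + 1 * (2 * D * \<epsilon> powr (1 - \<nu>) * \<kappa> N p + Z * \<kappa> N p powr e)"
      using omega_range[of \<tau> p] D1 Z0 \<kappa>0 by (intro add_left_mono mult_right_mono) auto
    finally show ?case by simp
  qed
  note k1 = integral_lebesgue_on_le[OF \<Omega>(6) kappa_integrable[OF N0(2)] kappa_nonneg[OF N0(1)], folded L_def J_def]
  note kp = kappa_power_integral[OF N(1) q, folded \<nu>_def, folded e_def]
  have k2: "integrable L (\<lambda>p. \<kappa> N p powr e)"
    "(\<integral>p. \<kappa> N p powr e \<partial>L) \<le> exp (2 / (q - 1)) * shell_const CARD('n) * real N powr (- (1 / (2 * (q - 1))))"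
    using integral_lebesgue_on_le[OF \<Omega>(6) kp(1), folded L_def] kp(2) by auto
  \<comment> \<open>\<open>X\<close> is integrable, so an eighth of its integral can be moved to the
    left; \<open>1/4 - 1/8\<close> leaves the factor 8.\<close>
  have "1 / 4 * integral\<^sup>L L X \<le> (\<integral>p. \<bar>u p\<bar> powr (q - 1) * u p * (g (u p) * \<zeta> \<tau> N m p) \<partial>L)"
  proof -
    have "integral\<^sup>L L X \<le> (\<integral>p. 4 * (\<bar>u p\<bar> powr (q - 1) * u p * (g (u p) * \<zeta> \<tau> N m p)) \<partial>L)"
      by (rule integral_mono_AE[OF iX _ Xle]) (use iv in simp)
    then show ?thesis by simp
  qed
  also note ineq
  also have "- (\<integral>p. G (u p) * dt (\<zeta> \<tau> N m) p \<partial>L) + (\<integral>p. H (u p) * b p \<partial>L)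
      = (\<integral>p. - (G (u p) * dt (\<zeta> \<tau> N m) p) + H (u p) * b p \<partial>L)"
    using iG iH by simp
  also have "\<dots> \<le> (\<integral>p. 1 / 8 * X p + (2 * D * \<epsilon> powr (1 - \<nu>) * \<kappa> N p + Z * \<kappa> N p powr e) \<partial>L)"
    by (rule integral_mono_AE[OF _ _ up]) (use iG iH iX k1(1) k2(1) in auto)
  also have "\<dots> = 1 / 8 * integral\<^sup>L L X + (2 * D * \<epsilon> powr (1 - \<nu>) * integral\<^sup>L L (\<kappa> N) + Z * (\<integral>p. \<kappa> N p powr e \<partial>L))"
    using iX k1(1) k2(1) by simp
  also have "2 * D * \<epsilon> powr (1 - \<nu>) * integral\<^sup>L L (\<kappa> N) \<le> 2 * D * \<epsilon> powr (1 - \<nu>) * J"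
    using k1(2) D1 by (intro mult_left_mono) auto
  also note \<epsilon>J
  also have "Z * (\<integral>p. \<kappa> N p powr e \<partial>L) \<le> Z * (exp (2 / (q - 1)) * shell_const CARD('n) * real N powr (- (1 / (2 * (q - 1)))))"
    using k2(2) Z0 by (intro mult_left_mono) auto
  finally have Xbound: "integral\<^sup>L L X \<le> 8 * (1 / real N + Z * (exp (2 / (q - 1)) * shell_const CARD('n) * real N powr (- (1 / (2 * (q - 1))))))"
    by simp
  define f where "f p = \<bar>u p\<bar> powr q / (1 + \<bar>u p\<bar>)" for p
  have PO: "P \<subseteq> \<Omega>" using PK KO by blast
  have rP: "restrict_space L P = lebesgue_on P"
    unfolding L_def using PO P(6) \<Omega>(6) by (subst restrict_restrict_space) (auto simp: Int_absorb1)
  have sP: "P \<inter> space L \<in> sets L"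
    using PO P(6) \<Omega>(6) by (auto simp: L_def sets_restrict_space Int_absorb1 Int_absorb2 intro!: image_eqI[of _ _ P])
  have fX: "AE p in L. norm (indicator P p *\<^sub>R f p) \<le> norm (X p)"
    using aeL
  proof eventually_elim
    case (elim p)
    show ?case
    proof (cases "p \<in> P")
      case True
      have u0: "0 \<le> u p" using elim by simp
      have "(u p + \<epsilon>) powr \<nu> \<le> (1 + u p) powr \<nu>" using u0 \<epsilon> \<nu> by (intro powr_mono2) auto
      also have "\<dots> \<le> (1 + u p) powr 1" using u0 \<nu> by (intro powr_mono) auto
      finally have "1 / (1 + u p) \<le> 1 / (u p + \<epsilon>) powr \<nu>" using u0 \<epsilon> by (intro divide_left_mono) auto
      then have "u p powr q * (1 / (1 + u p)) \<le> u p powr q * (u p + \<epsilon>) powr (- \<nu>)"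
        unfolding powr_minus_divide by (intro mult_left_mono) auto
      then show ?thesis using True u0 \<zeta>P[OF True] by (simp add: f_def X_def)
    qed simp
  qed
  have mf: "f \<in> borel_measurable L"
    unfolding f_def using mu by (intro borel_measurable_divide powr_real_measurable borel_measurable_add borel_measurable_abs) auto
  have iPf: "integrable L (\<lambda>p. indicator P p *\<^sub>R f p)"
  proof (rule Bochner_Integration.integrable_bound[OF iX _ fX])
    show "(\<lambda>p. indicator P p *\<^sub>R f p) \<in> borel_measurable L"
      using mf P(6) by (intro borel_measurable_scaleR) (auto simp: L_def intro: measurable_restrict_space1 borel_measurable_indicator)
  qed
  then have "integrable (restrict_space L P) f" by (simp only: integrable_restrict_space[OF sP])
  then show "integrable (lebesgue_on (cylinder s t R)) (\<lambda>p. \<bar>u p\<bar> powr q / (1 + \<bar>u p\<bar>))"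
    unfolding rP unfolding f_def P_def .
  have "(\<integral>p. f p \<partial>lebesgue_on P) = (\<integral>p. indicator P p *\<^sub>R f p \<partial>L)"
    using integral_restrict_space[OF sP, of f] unfolding rP by simp
  also have "\<dots> \<le> integral\<^sup>L L X"
  proof (rule integral_mono_AE[OF iPf iX])
    show "AE p in L. indicator P p *\<^sub>R f p \<le> X p"
      using fX
    proof eventually_elim
      case (elim p)
      then show ?case using X0[of p] by simp
    qed
  qed
  also note Xbound
  finally show "(\<integral>p. \<bar>u p\<bar> powr q / (1 + \<bar>u p\<bar>) \<partial>lebesgue_on (cylinder s t R))
      \<le> 8 * (1 / real N + 2 * C c * (16 * C c) powr (1 / (q - 1)) *
          (exp (2 / (q - 1)) * shell_const CARD('n) * real N powr (- (1 / (2 * (q - 1))))))"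
    unfolding f_def P_def Z_def D_def .
qed

end

theorem theorem3:
  fixes a :: "'n::finite coeffs"
    and A u :: "real \<times> (real ^ 'n) \<Rightarrow> real"
    and \<alpha> q c :: real
  assumes "0 < \<alpha>" and "1 < q" and "q \<le> 1 + \<alpha> / real CARD('n)"
    and "\<And>i j. a i j \<in> borel_measurable (lebesgue_on half_space)"
    and "\<And>i j. locally_bounded_on half_space (a i j)"
    and "\<And>i j. AE p in lebesgue_on half_space. a i j p = a j i p"
    and "A \<in> borel_measurable (lebesgue_on half_space)"
    and "locally_bounded_on half_space A"
    and "\<And>p. p \<in> half_space \<Longrightarrow> 0 \<le> A p"
    and "AE p in lebesgue_on half_space. \<forall>\<xi> :: real ^ 'n.
           0 \<le> (\<Sum>i\<in>UNIV. \<Sum>j\<in>UNIV. a i j p * \<xi> $ i * \<xi> $ j) \<and>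
           (\<Sum>i\<in>UNIV. \<Sum>j\<in>UNIV. a i j p * \<xi> $ i * \<xi> $ j) \<le> A p * (norm \<xi>)\<^sup>2"
    and "0 < c"
    and "\<And>R. 1 < R \<Longrightarrow>
           esssup (lebesgue_on ({0<..} \<times> {x. R / 2 < norm x \<and> norm x < R})) (\<lambda>p. ereal (A p))
             \<le> ereal (c * R powr (2 - \<alpha>))"
    and "entire_weak_solution a q u"
    and "AE p in lebesgue_on half_space. 0 \<le> u p"
  shows "AE p in lebesgue_on half_space. u p = 0"
proof -
  obtain \<eta> \<eta>' :: "real \<Rightarrow> real" and M :: real where eta:
    "smooth_on \<eta> UNIV" "\<And>x. (\<eta> has_real_derivative \<eta>' x) (at x)"
    "\<And>x. x \<le> 1 \<Longrightarrow> \<eta> x = 1" "\<And>x. 2 \<le> x \<Longrightarrow> \<eta> x = 0" "\<And>x. 0 \<le> \<eta> x" "\<And>x. \<eta> x \<le> 1"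
    "\<And>x. \<eta>' x \<le> 0" "\<And>x. \<bar>\<eta>' x\<bar> \<le> M" "\<And>x. x \<le> 1 \<Longrightarrow> \<eta>' x = 0" "\<And>x. 2 \<le> x \<Longrightarrow> \<eta>' x = 0"
    by (rule smooth_cutoff_exists, rule that, assumption+)
  interpret parabolic_cutoff \<eta> \<eta>' M \<alpha>
    by unfold_locales (fact eta assms(1))+
  \<comment> \<open>The exceptional sets of the finitely many index pairs are united.\<close>
  have sym: "AE p in lebesgue_on half_space. \<forall>i\<in>UNIV. \<forall>j\<in>UNIV. a i j p = a j i p"
    by (intro AE_finite_allI finite assms(6))
  have psd: "AE p in lebesgue_on half_space. psd_at a p"
    using sym assms(10) by eventually_elim (auto simp: psd_at_def coeff_form_def)
  have form: "AE p in lebesgue_on half_space. \<forall>\<xi>. coeff_form a p \<xi> \<xi> \<le> A p * (norm \<xi>)\<^sup>2"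
    using assms(10) by eventually_elim (auto simp: coeff_form_def)
  define c' where "c' = c * 2 powr \<bar>2 - \<alpha>\<bar>"
  have c': "0 \<le> c'" using assms(11) by (simp add: c'_def)
  note growth = coefficient_growth[OF assms(11,12), folded c'_def]
  obtain ut E where um: "u \<in> borel_measurable (lebesgue_on half_space)" and W: "W_loc_element a q u ut E"
    and weak': "\<forall>\<phi>. test_function \<phi> \<and> (\<forall>p\<in>half_space. 0 \<le> \<phi> p) \<longrightarrow>
      0 \<le> (\<integral>p. ut p * \<phi> p + E \<phi> p - \<bar>u p\<bar> powr (q - 1) * u p * \<phi> p \<partial>lebesgue_on half_space)"
    using assms(13) unfolding entire_weak_solution_def by (elim conjE exE)
  have weak: "0 \<le> (\<integral>p. ut p * \<phi> p + E \<phi> p - \<bar>u p\<bar> powr (q - 1) * u p * \<phi> p \<partial>lebesgue_on half_space)"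
    if "test_function \<phi>" "\<And>p. p \<in> half_space \<Longrightarrow> 0 \<le> \<phi> p" for \<phi>
    by (rule weak'[rule_format]) (use that in blast)
  obtain m :: nat where m: "2 + 2 / (q - 1) \<le> real m" using real_arch_simple by blast
  show ?thesis
  proof (rule AE_half_space_exhaustion)
    fix s t R :: real assume str: "0 < s" "s < t" "0 < R"
    define f where "f p = \<bar>u p\<bar> powr q / (1 + \<bar>u p\<bar>)" for p
    let ?P = "cylinder s t R :: (real \<times> (real ^ 'n)) set"
    obtain Z where Z: "\<And>p :: real \<times> (real ^ 'n). p \<in> ?P \<Longrightarrow> \<bar>S p\<bar> \<le> Z"
      by (rule continuous_on_half_space_bounded[OF smooth_on_imp_continuous_on[OF smooth_on_S] str(1)]) (rule that)
    \<comment> \<open>\<open>Z\<close> bounds \<open>S\<close> on the cylinder, and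
      \<open>Z \<le> N \<le> exp N\<close> places the cylinder where the cutoff
      \<open>\<psi>\<close> equals 1. The entries 2 and \<open>1 / (q - 1)\<close> give
      \<open>1 / N \<le> 1/2\<close> and \<open>1 / N \<le> q - 1\<close>.\<close>
    obtain N0 :: nat where N0: "max (max 2 Z) (max 1 (1 / (q - 1))) \<le> real N0" using real_arch_simple by blast
    define K where "K = 2 * real m * M + (real m)\<^sup>2 * energy_const c' + 1"
    define B where "B N = 8 * (1 / real N + 2 * K * (16 * K) powr (1 / (q - 1)) *
        (exp (2 / (q - 1)) * shell_const CARD('n) * real N powr (- (1 / (2 * (q - 1))))))" for N :: nat
    have bound: "integrable (lebesgue_on ?P) f \<and> integral\<^sup>L (lebesgue_on ?P) f \<le> B N" if "N0 \<le> N" for N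
    proof -
      have N: "max (max 2 Z) (max 1 (1 / (q - 1))) \<le> real N" using N0 that by (meson of_nat_mono order_trans)
      have N1: "2 \<le> N" using N by auto
      have N2: "1 / real N \<le> min 1 (q - 1)" using N N1 assms(2) by (auto simp: field_simps)
      have N3: "S p \<le> exp (real N)" if "p \<in> ?P" for p
        using Z[OF that] N exp_ge_add_one_self[of "real N"] by linarith
      note * = cylinder_integral_bound[OF assms(2-5) psd form assms(9) growth c' um assms(14) W _ str N1 N2 N3 m]
      show ?thesis unfolding f_def[abs_def] B_def K_def
        by (intro conjI *) (assumption | rule weak | blast)+
    qed
    have lim: "B \<longlonglongrightarrow> 0"
    proof -
      have "(\<lambda>N. real N powr (- (1 / (2 * (q - 1))))) \<longlonglongrightarrow> 0"
        using assms(2) by (intro tendsto_neg_powr filterlim_real_sequentially) auto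
      moreover have "(\<lambda>N. 1 / real N) \<longlonglongrightarrow> 0" by (rule lim_1_over_n)
      ultimately have "B \<longlonglongrightarrow> 8 * (0 + 2 * K * (16 * K) powr (1 / (q - 1)) * (exp (2 / (q - 1)) * shell_const CARD('n) * 0))"
        unfolding B_def by (intro tendsto_intros)
      then show ?thesis by simp
    qed
    have int: "integrable (lebesgue_on ?P) f" using bound[of N0] by simp
    have "integral\<^sup>L (lebesgue_on ?P) f \<le> 0"
      by (rule LIMSEQ_le_const[OF lim]) (use bound in blast)
    moreover have f0: "0 \<le> f p" for p by (simp add: f_def)
    then have "0 \<le> integral\<^sup>L (lebesgue_on ?P) f" by (intro integral_nonneg_AE) auto
    ultimately have "integral\<^sup>L (lebesgue_on ?P) f = 0" by simp
    then have "AE p in lebesgue_on ?P. f p = 0"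
      using integral_nonneg_eq_0_iff_AE[OF int] f0 by auto
    then show "AE p in lebesgue_on ?P. u p = 0"
    proof eventually_elim
      case (elim p)
      have "1 + \<bar>u p\<bar> \<noteq> 0" by linarith
      then show ?case using elim by (simp add: f_def)
    qed
  qed
qed

end
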